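(* Let $\mathcal{X}$ be a complete and separable metric space and let $\mathcal{Y}\subseteq\mathbb{R}$ be closed. Let $\mathrm{P}_1,\mathrm{P}_2\in\mathcal{M}_1(\mathcal{X}\times\mathcal{Y})$ be probability measures. For $i=1,2$ let $\boldsymbol{\mathcal{X}_{A_i}^{(i)}}:=\{\mathcal{X}_1^{(i)},\dots,\mathcal{X}_{A_i}^{(i)}\}$ be a partition of $\mathcal{X}$ into nonempty, pairwise disjoint Borel sets. Let $\{\mathcal{X}_1^*,\dots,\mathcal{X}_B^*\}$ be the collection of all nonempty intersections $\mathcal{X}_{a_1}^{(1)}\cap\mathcal{X}_{a_2}^{(2)}$ ($a_1\in\{1,\dots,A_1\}$, $a_2\in\{1,\dots,A_2\}$), and assume $\mathrm{P}_i(\mathcal{X}_b^*\times\mathcal{Y})>0$ for all $b\in\{1,\dots,B\}$ and $i\in\{1,2\}$. For $i\in\{1,2\}$ and $b\in\{1,\dots,B\}$ let $a(i,b)$ be the unique index $a\in\{1,\dots,A_i\}$ with $\mathcal{X}_b^*\subseteq\mathcal{X}_a^{(i)}$. For all $i\in\{1,2\}$ and $a\in\{1,\dots,A_i\}$, let $\lambda_{i,a}>0$ and let $k_{i,a}$ be a bounded and measurable kernel on $\mathcal{X}_a^{(i)}$ with separable RKHS $H_{i,a}$. For $b\in\{1,\dots,B\}$ put $\kappa_b:=\max\{\|k_{1,a(1,b)}\|_\infty,\|k_{2,a(2,b)}\|_\infty\}$, $\tau_b:=\min\{\lambda_{1,a(1,b)},\lambda_{2,a(2,b)}\}$, $\rho_{1,b}:=\max\{\mathrm{P}_1^X(\mathcal{X}_{a(1,b)}^{(1)}),\mathrm{P}_1^X(\mathcal{X}_{a(2,b)}^{(2)})\}$,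 $\mathrm{P}_{1,b}^*:=\mathrm{P}_{1,\mathcal{X}_b^*}$ and $k_{i,b}^*:=k_{i,a(i,b)}|_{\mathcal{X}_b^*\times\mathcal{X}_b^*}$. Let $L$ be a convex and Lipschitz continuous loss function with Lipschitz constant $|L|_1$. For $i=1,2$ define the localized SVM $$f_i:\mathcal{X}\to\mathbb{R},\qquad f_i(x):=\sum_{a=1}^{A_i}\hat f_{\mathrm{P}_{i,a},\lambda_{i,a},k_{i,a}}(x),$$ where $\mathrm{P}_{i,a}:=\mathrm{P}_{i,\mathcal{X}_a^{(i)}}$ and $\hat f$ denotes the zero-extension to $\mathcal{X}$ of the local SVM $f_{\mathrm{P}_{i,a},\lambda_{i,a},k_{i,a}}:\mathcal{X}_a^{(i)}\to\mathbb{R}$. Then $$\begin{aligned}\|f_1-f_2\|_{L_1(\mathrm{P}_1^X)}\le\ &|L|_1\cdot\sum_{a=1}^{A_2}\mathrm{P}_1^X(\mathcal{X}_a^{(2)})\cdot\frac{\|k_{2,a}\|_\infty^2}{\lambda_{2,a}}\cdot\left\|\mathrm{P}_{1,\mathcal{X}_a^{(2)}}-\mathrm{P}_{2,\mathcal{X}_a^{(2)}}\right\|_{tv}\\&+|L|_1\cdot\sum_{b=1}^B\bigg(\rho_{1,b}\cdot\frac{\kappa_b^2}{\tau_b^2}\cdot|\lambda_{1,a(1,b)}-\lambda_{2,a(2,b)}|\\&\qquad+\mathrm{P}_1^X(\mathcal{X}_b^* )\cdot\Big(\frac1{2\tau_b}\cdot\|k_{1,b}^*-k_{2,b}^*\|_{L_1((\mathrm{P}_{1,b}^*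 )^X\otimes(\mathrm{P}_{1,b}^* )^X)}+\frac{\kappa_b}{\tau_b}\cdot\sqrt{\|k_{1,b}^*-k_{2,b}^*\|_{L_1((\mathrm{P}_{1,b}^* )^X\otimes(\mathrm{P}_{1,b}^* )^X)}}\Big)\\&\qquad+\rho_{1,b}\cdot\frac{\kappa_b^2}{\tau_b}\cdot\mathrm{d}_{\mathrm{P}_1^X,b}\big(\boldsymbol{\mathcal{X}_{A_1}^{(1)}},\boldsymbol{\mathcal{X}_{A_2}^{(2)}}\big)\bigg),\end{aligned}$$ where, for a probability measure $\mathrm{Q}$ on $\mathcal{X}$ with $\mathrm{Q}(\mathcal{X}_a^{(i)})>0$ for all $i,a$, and with $q_{i,b}:=\mathrm{Q}(\mathcal{X}_b^* )/\mathrm{Q}(\mathcal{X}_{a(i,b)}^{(i)})$, $$\mathrm{d}_{\mathrm{Q},b}\big(\boldsymbol{\mathcal{X}_{A_1}^{(1)}},\boldsymbol{\mathcal{X}_{A_2}^{(2)}}\big):=\frac{\left|\mathrm{Q}(\mathcal{X}_{a(1,b)}^{(1)})-\mathrm{Q}(\mathcal{X}_{a(2,b)}^{(2)})\right|}{\max\left\{\mathrm{Q}(\mathcal{X}_{a(1,b)}^{(1)}),\mathrm{Q}(\mathcal{X}_{a(2,b)}^{(2)})\right\}}+\sum_{i=1}^2\left(\frac12\,q_{i,b}(1-q_{i,b})+\sqrt{q_{i,b}(1-q_{i,b})}\right).$$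
   Context: All spaces carry their Borel $\sigma$-algebras; $\mathcal{M}_1(\mathcal{X}\times\mathcal{Y})$ is the set of Borel probability measures on $\mathcal{X}\times\mathcal{Y}$. For a probability measure $\mathrm{Q}$ on $\tilde{\mathcal{X}}\times\mathcal{Y}$, $\mathrm{Q}^X$ denotes its marginal distribution on $\tilde{\mathcal{X}}$. A kernel on a set $S$ is a symmetric positive semidefinite function $k:S\times S\to\mathbb{R}$; its reproducing kernel Hilbert space is abbreviated RKHS. For a kernel $k$, $\|k\|_\infty:=\sup_{x}\sqrt{k(x,x)}$, and $k$ is bounded if this is finite. A loss function is a measurable function $L:\mathcal{X}\times\mathcal{Y}\times\mathbb{R}\to[0,\infty)$. It is convex if $L(x,y,\cdot)$ is convex for all $(x,y)$, and Lipschitz continuous if there is $c\ge0$ with $|L(x,y,t_1)-L(x,y,t_2)|\le c|t_1-t_2|$ for all $x,y,t_1,t_2$; the smallest such $c$ is $|L|_1$. The shifted loss function is $L^\star(x,y,t):=L(x,y,t)-L(x,y,0)$. For a Borel set $\tilde{\mathcal{X}}\subseteq\mathcal{X}$, a Borel probability measure $\mathrm{Q}$ on $\tilde{\mathcal{X}}\times\mathcal{Y}$, $\lambda>0$ and a bounded measurable kernel $k$ on $\tilde{\mathcal{X}}$ with separable RKHS $H$, the support vector machine (SVM) is the (existing and unique) minimizer $$f_{\mathrm{Q},\lambda,k}:=\arg\inf_{f\in H}\ \mathbb{E}_{\mathrm{Q}}[L^\star(X,Y,f(X))]+\lambda\|f\|_H^2,\qquad f_{\mathrm{Q},\lambda,k}:\tilde{\mathcal{X}}\to\mathbb{R}$$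 (the loss $L$ is fixed and omitted from the notation). Local probability measures: for a Borel set $\tilde{\mathcal{X}}\subseteq\mathcal{X}$ with $\mathrm{P}_i(\tilde{\mathcal{X}}\times\mathcal{Y})>0$, $\mathrm{P}_{i,\tilde{\mathcal{X}}}:=\frac{1}{\mathrm{P}_i(\tilde{\mathcal{X}}\times\mathcal{Y})}\mathrm{P}_i|_{\tilde{\mathcal{X}}\times\mathcal{Y}}$, a probability measure on $\tilde{\mathcal{X}}\times\mathcal{Y}$. Zero-extension: for $g:\tilde{\mathcal{X}}\to\mathbb{R}$, $\hat g:\mathcal{X}\to\mathbb{R}$ equals $g$ on $\tilde{\mathcal{X}}$ and $0$ elsewhere. For a finite signed measure $\nu$, $\|\nu\|_{tv}:=\sup\{\sum_{i=1}^n|\nu(E_i)|: E_1,\dots,E_n \text{ a finite measurable partition of the whole space}\}$. *)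

theory Defs
  imports "HOL-Probability.Probability"
begin

section \<open>Kernels and their reproducing kernel Hilbert spaces\<close>

text \<open>
  A function on a set \<open>S\<close> is an element of \<open>extensional S\<close>. A kernel on \<open>S\<close> is a total function of
  two arguments of which only the values on \<open>S \<times> S\<close> are relevant.
\<close>

definition kernel_on :: "'x set \<Rightarrow> ('x \<Rightarrow> 'x \<Rightarrow> real) \<Rightarrow> bool" where
  "kernel_on S k \<longleftrightarrow>
     (\<forall>x\<in>S. \<forall>x'\<in>S. k x x' = k x' x) \<and>
     (\<forall>(n::nat) (x::nat \<Rightarrow> 'x) (c::nat \<Rightarrow> real). (\<forall>i<n. x i \<in> S) \<longrightarrow>
        0 \<le> (\<Sum>i<n. \<Sum>j<n. c i * c j * k (x i) (x j)))"

definition kernel_norm :: "'x set \<Rightarrow> ('x \<Rightarrow> 'x \<Rightarrow> real) \<Rightarrow> real" where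
  "kernel_norm S k = (SUP x\<in>S. sqrt (k x x))"

definition bounded_kernel :: "'x set \<Rightarrow> ('x \<Rightarrow> 'x \<Rightarrow> real) \<Rightarrow> bool" where
  "bounded_kernel S k \<longleftrightarrow> bdd_above ((\<lambda>x. sqrt (k x x)) ` S)"

definition measurable_kernel ::
    "'x::topological_space set \<Rightarrow> ('x \<Rightarrow> 'x \<Rightarrow> real) \<Rightarrow> bool" where
  "measurable_kernel S k \<longleftrightarrow>
     (\<lambda>(x, x'). k x x') \<in> borel_measurable (restrict_space borel (S \<times> S))"

definition fun_norm :: "(('x \<Rightarrow> real) \<Rightarrow> ('x \<Rightarrow> real) \<Rightarrow> real) \<Rightarrow> ('x \<Rightarrow> real) \<Rightarrow> real" where
  "fun_norm ip f = sqrt (ip f f)"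

definition fun_dist ::
    "'x set \<Rightarrow> (('x \<Rightarrow> real) \<Rightarrow> ('x \<Rightarrow> real) \<Rightarrow> real) \<Rightarrow> ('x \<Rightarrow> real) \<Rightarrow> ('x \<Rightarrow> real) \<Rightarrow> real" where
  "fun_dist S ip f g = fun_norm ip (\<lambda>x\<in>S. f x - g x)"

text \<open>A real Hilbert space \<open>H\<close> of functions on \<open>S\<close>, with pointwise operations and inner product
  \<open>ip\<close>; the values of \<open>ip\<close> off \<open>H \<times> H\<close> are irrelevant.\<close>

definition hilbert_function_space ::
    "'x set \<Rightarrow> ('x \<Rightarrow> real) set \<Rightarrow> (('x \<Rightarrow> real) \<Rightarrow> ('x \<Rightarrow> real) \<Rightarrow> real) \<Rightarrow> bool" where
  "hilbert_function_space S H ip \<longleftrightarrow>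
     H \<subseteq> extensional S \<and>
     (\<lambda>x\<in>S. 0) \<in> H \<and>
     (\<forall>f\<in>H. \<forall>g\<in>H. (\<lambda>x\<in>S. f x + g x) \<in> H) \<and>
     (\<forall>c. \<forall>f\<in>H. (\<lambda>x\<in>S. c * f x) \<in> H) \<and>
     (\<forall>f\<in>H. \<forall>g\<in>H. ip f g = ip g f) \<and>
     (\<forall>f\<in>H. \<forall>g\<in>H. \<forall>h\<in>H. ip (\<lambda>x\<in>S. f x + g x) h = ip f h + ip g h) \<and>
     (\<forall>c. \<forall>f\<in>H. \<forall>h\<in>H. ip (\<lambda>x\<in>S. c * f x) h = c * ip f h) \<and>
     (\<forall>f\<in>H. 0 \<le> ip f f) \<and>
     (\<forall>f\<in>H. ip f f = 0 \<longrightarrow> f = (\<lambda>x\<in>S. 0)) \<and>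
     (\<forall>u::nat \<Rightarrow> 'x \<Rightarrow> real.
        (\<forall>n. u n \<in> H) \<and> (\<forall>\<epsilon>>0. \<exists>N. \<forall>m\<ge>N. \<forall>n\<ge>N. fun_dist S ip (u m) (u n) < \<epsilon>) \<longrightarrow>
        (\<exists>f\<in>H. (\<lambda>n. fun_dist S ip (u n) f) \<longlonglongrightarrow> 0))"

definition is_rkhs ::
    "'x set \<Rightarrow> ('x \<Rightarrow> 'x \<Rightarrow> real) \<Rightarrow> ('x \<Rightarrow> real) set \<Rightarrow>
      (('x \<Rightarrow> real) \<Rightarrow> ('x \<Rightarrow> real) \<Rightarrow> real) \<Rightarrow> bool" where
  "is_rkhs S k H ip \<longleftrightarrow>
     hilbert_function_space S H ip \<and>
     (\<forall>x\<in>S. (\<lambda>x'\<in>S. k x' x) \<in> H) \<and>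
     (\<forall>x\<in>S. \<forall>f\<in>H. f x = ip f (\<lambda>x'\<in>S. k x' x))"

definition separable_function_space ::
    "'x set \<Rightarrow> ('x \<Rightarrow> real) set \<Rightarrow> (('x \<Rightarrow> real) \<Rightarrow> ('x \<Rightarrow> real) \<Rightarrow> real) \<Rightarrow> bool" where
  "separable_function_space S H ip \<longleftrightarrow>
     (\<exists>D. countable D \<and> D \<subseteq> H \<and> (\<forall>f\<in>H. \<forall>\<epsilon>>0. \<exists>g\<in>D. fun_dist S ip f g < \<epsilon>))"


section \<open>Loss functions and support vector machines\<close>

text \<open>The input space is a type, the output space is \<open>Y \<subseteq> \<real>\<close>; values of a loss at \<open>y \<notin> Y\<close> are
  irrelevant.\<close>

definition loss_function :: "real set \<Rightarrow> ('x::topological_space \<Rightarrow> real \<Rightarrow> real \<Rightarrow> real) \<Rightarrow> bool" where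
  "loss_function Y L \<longleftrightarrow>
     (\<lambda>(x, y, t). L x y t) \<in> borel_measurable (restrict_space borel (UNIV \<times> Y \<times> UNIV)) \<and>
     (\<forall>x. \<forall>y\<in>Y. \<forall>t. 0 \<le> L x y t)"

definition convex_loss :: "real set \<Rightarrow> ('x \<Rightarrow> real \<Rightarrow> real \<Rightarrow> real) \<Rightarrow> bool" where
  "convex_loss Y L \<longleftrightarrow> (\<forall>x. \<forall>y\<in>Y. convex_on UNIV (L x y))"

definition lipschitz_loss :: "real set \<Rightarrow> ('x \<Rightarrow> real \<Rightarrow> real \<Rightarrow> real) \<Rightarrow> bool" where
  "lipschitz_loss Y L \<longleftrightarrow> (\<exists>c\<ge>0. \<forall>x. \<forall>y\<in>Y. c-lipschitz_on UNIV (L x y))"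

definition lipschitz_const :: "real set \<Rightarrow> ('x \<Rightarrow> real \<Rightarrow> real \<Rightarrow> real) \<Rightarrow> real" where
  "lipschitz_const Y L = Inf {c. 0 \<le> c \<and> (\<forall>x. \<forall>y\<in>Y. c-lipschitz_on UNIV (L x y))}"

definition shifted_loss :: "('x \<Rightarrow> real \<Rightarrow> real \<Rightarrow> real) \<Rightarrow> 'x \<Rightarrow> real \<Rightarrow> real \<Rightarrow> real" where
  "shifted_loss L x y t = L x y t - L x y 0"

definition regularized_risk ::
    "('x \<Rightarrow> real \<Rightarrow> real \<Rightarrow> real) \<Rightarrow> ('x \<times> real) measure \<Rightarrow> real \<Rightarrow>
      (('x \<Rightarrow> real) \<Rightarrow> ('x \<Rightarrow> real) \<Rightarrow> real) \<Rightarrow> ('x \<Rightarrow> real) \<Rightarrow> real" where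
  "regularized_risk L Q l ip f =
     (LINT (x, y)|Q. shifted_loss L x y (f x)) + l * (fun_norm ip f)\<^sup>2"

definition svm ::
    "('x \<Rightarrow> real \<Rightarrow> real \<Rightarrow> real) \<Rightarrow> ('x \<times> real) measure \<Rightarrow> real \<Rightarrow> ('x \<Rightarrow> real) set \<Rightarrow>
      (('x \<Rightarrow> real) \<Rightarrow> ('x \<Rightarrow> real) \<Rightarrow> real) \<Rightarrow> 'x \<Rightarrow> real" where
  "svm L Q l H ip = (THE f. is_arg_min (regularized_risk L Q l ip) (\<lambda>f. f \<in> H) f)"

definition zero_extension :: "'x set \<Rightarrow> ('x \<Rightarrow> real) \<Rightarrow> 'x \<Rightarrow> real" where
  "zero_extension S g x = (if x \<in> S then g x else 0)"


section \<open>Measures\<close>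

definition local_measure ::
    "('x \<times> real) measure \<Rightarrow> real set \<Rightarrow> 'x set \<Rightarrow> ('x \<times> real) measure" where
  "local_measure P Y S =
     scale_measure (1 / emeasure P (S \<times> Y)) (restrict_space P (S \<times> Y))"

definition marginal :: "'x::topological_space set \<Rightarrow> ('x \<times> real) measure \<Rightarrow> 'x measure" where
  "marginal S Q = distr Q (restrict_space borel S) fst"

text \<open>Total variation norm of a finite signed measure, given as a real-valued set function \<open>\<nu>\<close> on
  the \<open>\<sigma>\<close>-algebra of \<open>M\<close>.\<close>

definition tv_norm :: "'a measure \<Rightarrow> ('a set \<Rightarrow> real) \<Rightarrow> real" where
  "tv_norm M \<nu> =
     Sup {\<Sum>E\<in>\<E>. \<bar>\<nu> E\<bar> | \<E>. finite \<E> \<and> \<E> \<subseteq> sets M \<and> partition_on (space M) \<E>}"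

text \<open>The integral of a non-integrable function is \<open>0\<close>, so an upper bound on \<open>L1_norm M f\<close> is meaningful
  only together with \<open>integrable M f\<close>.\<close>

definition L1_norm :: "'a measure \<Rightarrow> ('a \<Rightarrow> real) \<Rightarrow> real" where
  "L1_norm M f = (LINT x|M. \<bar>f x\<bar>)"


section \<open>Regionalizations\<close>

definition regionalization :: "nat \<Rightarrow> (nat \<Rightarrow> 'x::topological_space set) \<Rightarrow> bool" where
  "regionalization A X \<longleftrightarrow>
     (\<forall>a\<in>{1..A}. X a \<in> sets borel \<and> X a \<noteq> {}) \<and>
     disjoint_family_on X {1..A} \<and> (\<Union>a\<in>{1..A}. X a) = UNIV"

definition cell_index :: "nat \<Rightarrow> (nat \<Rightarrow> 'x set) \<Rightarrow> 'x set \<Rightarrow> nat" where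
  "cell_index A X T = (THE a. a \<in> {1..A} \<and> T \<subseteq> X a)"

text \<open>The quantity \<open>d\<^bsub>Q,b\<^esub>\<close>, where \<open>S 1\<close> and \<open>S 2\<close> are the cells of the two regionalizations that
  contain the intersection \<open>T\<close> with index \<open>b\<close>.\<close>

definition regionalization_dist :: "'x measure \<Rightarrow> (nat \<Rightarrow> 'x set) \<Rightarrow> 'x set \<Rightarrow> real" where
  "regionalization_dist Q S T =
     \<bar>measure Q (S 1) - measure Q (S 2)\<bar> / max (measure Q (S 1)) (measure Q (S 2)) +
     (\<Sum>i\<in>{1, 2}. let q = measure Q T / measure Q (S i)
                 in 1 / 2 * q * (1 - q) + sqrt (q * (1 - q)))"

end

(*
  The subgradient of a Lipschitz loss is replaced by the difference quotient h_e(t) = (L(t + e) - L(t)) / e,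
  which is monotone, Lipschitz continuous and bounded by the Lipschitz constant of the loss. The equation
  2 l <f, g> = - E[h_e(f) g] (all g in H) has a solution by Banach's fixed point theorem, and the solution
  converges to the SVM as e -> 0, with respect to the same measure, regularization and kernel.

  Two SVMs in the same RKHS with respect to different measures are compared through their variational
  inequalities. Two localized SVMs with respect to the same measure P are compared on an intersection T
  of their cells: there the equations give f_i = - (K_i h_i + r_i) / mu_i with mu_i = 2 l_i P(S_i), the
  integral operator K_i of the i-th kernel over T, and a remainder r_i from S_i - T. Testing
  f_1 - f_2 with w = h_1 - h_2 and using (h_1 - h_2)(f_1 - f_2) >= 0 bounds the energy <w, K_1 w>, which in
  turn bounds f_1 - f_2. No RKHS of a restricted kernel is needed.
*)
theory Submission imports Defs begin

section \<open>Hilbert spaces of functions\<close>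

text \<open>The two comparisons meet at an intermediate function: the localized SVM for the first
  measure, but with the cells, kernels and parameters of the second regionalization. Passing from it
  to the second function changes only the measure and costs the total variation sum; passing to the
  first changes only cells, kernels and parameters and costs the sum over the intersections. A
  convex loss need not be differentiable, and a variational inequality can be tested only in its own
  RKHS. The comparison on T involves two spaces, so it needs equations with explicit bounded
  weights; difference quotients supply them without a measurable choice of subgradients. Smoothed
  solutions are within order sqrt(e) of the SVM and obey a bound free of e, so e can tend to 0. The
  square roots in the bound arise because the kernel difference and the remainders control the
  square of the RKHS norm of K_1 w, which is the energy. The factor P(S_i) in mu_i undoes the
  normalization of the local measure on S_i, so that both equations share the unnormalized
  restriction to T.\<close>

lemma nonneg_of_small_steps:
  fixes a b :: real
  assumes "\<And>s. 0 < s \<Longrightarrow> s < 1 \<Longrightarrow> 0 \<le> a + s * b"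
  shows "0 \<le> a"
proof (rule tendsto_lowerbound[of "\<lambda>s. a + s * b" _ "at_right 0"])
  have "((\<lambda>s. a + s * b) \<longlongrightarrow> a + 0 * b) (at_right 0)" by (intro tendsto_intros)
  then show "((\<lambda>s. a + s * b) \<longlongrightarrow> a) (at_right 0)" by simp
  show "\<forall>\<^sub>F s in at_right 0. 0 \<le> a + s * b"
    using eventually_at_right_less[of 0] eventually_at_right_real[of 0 1, simplified]
    by eventually_elim (use assms in auto)
qed auto

locale hilbert_fs =
  fixes S :: "'x set" and H :: "('x \<Rightarrow> real) set" and ip :: "('x \<Rightarrow> real) \<Rightarrow> ('x \<Rightarrow> real) \<Rightarrow> real"
  assumes hfs: "hilbert_function_space S H ip"
begin

abbreviation "nrm \<equiv> fun_norm ip"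

text \<open>Elements of \<open>H\<close> are extensional, so every sum or multiple carries a
  restriction to \<open>S\<close>. One combination with two coefficients covers differences,
  midpoints, segments and gradient steps, and one set of rules expands \<open>ip\<close> on all of
  them.\<close>

definition comb :: "real \<Rightarrow> ('x \<Rightarrow> real) \<Rightarrow> real \<Rightarrow> ('x \<Rightarrow> real) \<Rightarrow> 'x \<Rightarrow> real" where
  "comb a f b g = (\<lambda>x\<in>S. a * f x + b * g x)"

lemma comb_apply: "x \<in> S \<Longrightarrow> comb a f b g x = a * f x + b * g x"
  by (simp add: comb_def)

lemma zero_in: "(\<lambda>x\<in>S. 0) \<in> H"
  using hfs by (simp add: hilbert_function_space_def)

lemma H_ext: "f \<in> H \<Longrightarrow> f \<in> extensional S"
  using hfs by (auto simp: hilbert_function_space_def)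

lemma scale_in: "f \<in> H \<Longrightarrow> (\<lambda>x\<in>S. c * f x) \<in> H"
  and add_in: "f \<in> H \<Longrightarrow> g \<in> H \<Longrightarrow> (\<lambda>x\<in>S. f x + g x) \<in> H"
  and ip_sym: "f \<in> H \<Longrightarrow> g \<in> H \<Longrightarrow> ip f g = ip g f"
  and ip_add: "f \<in> H \<Longrightarrow> g \<in> H \<Longrightarrow> h \<in> H \<Longrightarrow> ip (\<lambda>x\<in>S. f x + g x) h = ip f h + ip g h"
  and ip_scale: "f \<in> H \<Longrightarrow> h \<in> H \<Longrightarrow> ip (\<lambda>x\<in>S. c * f x) h = c * ip f h"
  and ip_nonneg: "f \<in> H \<Longrightarrow> 0 \<le> ip f f"
  and ip_eq_0: "f \<in> H \<Longrightarrow> ip f f = 0 \<Longrightarrow> f = (\<lambda>x\<in>S. 0)"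
  and complete: "(\<And>n. u n \<in> H) \<Longrightarrow>
     (\<And>\<epsilon>. \<epsilon> > 0 \<Longrightarrow> \<exists>N. \<forall>m\<ge>N. \<forall>n\<ge>N. fun_dist S ip (u m) (u n) < \<epsilon>) \<Longrightarrow>
     \<exists>f\<in>H. (\<lambda>n. fun_dist S ip (u n) f) \<longlonglongrightarrow> 0"
  using hfs unfolding hilbert_function_space_def by blast+

lemma comb_conv: "comb a f b g = (\<lambda>x\<in>S. (\<lambda>x\<in>S. a * f x) x + (\<lambda>x\<in>S. b * g x) x)"
  by (auto simp: comb_def)

lemma comb_in: "f \<in> H \<Longrightarrow> g \<in> H \<Longrightarrow> comb a f b g \<in> H"
  unfolding comb_conv by (intro add_in scale_in)

lemma ip_comb_left:
  "f \<in> H \<Longrightarrow> g \<in> H \<Longrightarrow> h \<in> H \<Longrightarrow> ip (comb a f b g) h = a * ip f h + b * ip g h"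
  unfolding comb_conv by (simp only: ip_add ip_scale scale_in)

lemma ip_comb_right:
  "f \<in> H \<Longrightarrow> g \<in> H \<Longrightarrow> h \<in> H \<Longrightarrow> ip h (comb a f b g) = a * ip h f + b * ip h g"
  using ip_comb_left[of f g h a b] by (simp add: ip_sym[of h] comb_in)

lemmas ip_comb = ip_comb_left ip_comb_right comb_in

lemma fun_dist_comb: "fun_dist S ip f g = nrm (comb 1 f (-1) g)"
  by (simp add: fun_dist_def comb_def)

lemma nrm_nonneg: "f \<in> H \<Longrightarrow> 0 \<le> nrm f"
  by (simp add: fun_norm_def ip_nonneg)

lemma nrm_sq: "f \<in> H \<Longrightarrow> (nrm f)\<^sup>2 = ip f f"
  by (simp add: fun_norm_def ip_nonneg)

lemma nrm_eq_0: "f \<in> H \<Longrightarrow> nrm f = 0 \<Longrightarrow> f = (\<lambda>x\<in>S. 0)"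
  by (simp add: fun_norm_def ip_eq_0)

lemma ip_zero_left: "h \<in> H \<Longrightarrow> ip (\<lambda>x\<in>S. 0) h = 0"
  using ip_scale[OF zero_in, of h 0] by simp

lemma nrm_zero: "nrm (\<lambda>x\<in>S. 0) = 0"
  by (simp add: fun_norm_def ip_zero_left zero_in)

lemma cauchy_schwarz:
  assumes f: "f \<in> H" and g: "g \<in> H"
  shows "\<bar>ip f g\<bar> \<le> nrm f * nrm g"
proof (cases "ip g g = 0")
  case True
  then have "ip f g = 0"
    using ip_eq_0[OF g] ip_zero_left[OF f] ip_sym[OF f g] by simp
  then show ?thesis using nrm_nonneg f g by simp
next
  case False
  then have pos: "ip g g > 0" using ip_nonneg[OF g] by simp
  \<comment> \<open>This is \<open>ip g g\<close> times the component of \<open>f\<close> orthogonal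
    to \<open>g\<close>; the scaling avoids a division, and the squared norm contains the
    Cauchy-Schwarz gap as a factor.\<close>
  let ?u = "comb (ip g g) f (- ip f g) g"
  have "0 \<le> ip ?u ?u" by (intro ip_nonneg comb_in f g)
  also have "ip ?u ?u = ip g g * (ip g g * ip f f - (ip f g)\<^sup>2)"
    using f g by (simp add: ip_comb ip_sym[of g f] algebra_simps power2_eq_square)
  finally have "(ip f g)\<^sup>2 \<le> ip g g * ip f f"
    using pos by (simp add: zero_le_mult_iff)
  also have "\<dots> = (nrm f * nrm g)\<^sup>2"
    using f g by (simp add: nrm_sq power_mult_distrib)
  finally show ?thesis
    using nrm_nonneg[OF f] nrm_nonneg[OF g] by (metis abs_le_square_iff abs_of_nonneg mult_nonneg_nonneg)
qed

lemma nrm_sq_comb: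
  assumes f: "f \<in> H" and g: "g \<in> H"
  shows "(nrm (comb a f b g))\<^sup>2 = a\<^sup>2 * (nrm f)\<^sup>2 + 2 * a * b * ip f g + b\<^sup>2 * (nrm g)\<^sup>2"
  using f g by (simp add: nrm_sq ip_comb ip_sym[of g f]) (simp add: algebra_simps power2_eq_square)

lemma nrm_comb_le:
  assumes f: "f \<in> H" and g: "g \<in> H"
  shows "nrm (comb a f b g) \<le> \<bar>a\<bar> * nrm f + \<bar>b\<bar> * nrm g"
proof (rule power2_le_imp_le)
  have "a * b * ip f g \<le> \<bar>a * b\<bar> * \<bar>ip f g\<bar>"
    by (simp flip: abs_mult)
  also have "\<dots> \<le> \<bar>a * b\<bar> * (nrm f * nrm g)"
    using cauchy_schwarz[OF f g] by (intro mult_left_mono) auto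
  finally show "(nrm (comb a f b g))\<^sup>2 \<le> (\<bar>a\<bar> * nrm f + \<bar>b\<bar> * nrm g)\<^sup>2"
    by (simp add: nrm_sq_comb[OF f g] power2_sum power_mult_distrib abs_mult algebra_simps)
qed (use nrm_nonneg f g in simp)

lemma fun_dist_sym:
  assumes "f \<in> H" "g \<in> H"
  shows "fun_dist S ip f g = fun_dist S ip g f"
proof -
  have "(nrm (comb 1 f (-1) g))\<^sup>2 = (nrm (comb 1 g (-1) f))\<^sup>2"
    using assms by (simp add: nrm_sq_comb ip_sym[of g f])
  then show ?thesis
    unfolding fun_dist_comb by (rule power2_eq_imp_eq) (use assms nrm_nonneg comb_in in auto)
qed

lemma fun_dist_triangle:
  assumes "f \<in> H" "g \<in> H" "h \<in> H"
  shows "fun_dist S ip f h \<le> fun_dist S ip f g + fun_dist S ip g h"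
proof -
  have "comb 1 f (-1) h = comb 1 (comb 1 f (-1) g) 1 (comb 1 g (-1) h)"
    by (auto simp: comb_def)
  then show ?thesis
    unfolding fun_dist_comb using nrm_comb_le[of "comb 1 f (-1) g" "comb 1 g (-1) h" 1 1] assms
    by (simp add: comb_in)
qed

lemma fun_dist_nonneg: "f \<in> H \<Longrightarrow> g \<in> H \<Longrightarrow> 0 \<le> fun_dist S ip f g"
  by (simp add: fun_dist_comb nrm_nonneg comb_in)

lemma fun_dist_eq_0:
  assumes "f \<in> H" "g \<in> H"
  shows "fun_dist S ip f g = 0 \<longleftrightarrow> f = g"
proof
  assume "fun_dist S ip f g = 0"
  then have *: "comb 1 f (-1) g = (\<lambda>x\<in>S. 0)"
    unfolding fun_dist_comb using assms by (intro nrm_eq_0 comb_in)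
  show "f = g"
  proof (rule extensionalityI[OF H_ext H_ext])
    show "f x = g x" if "x \<in> S" for x
      using fun_cong[OF *, of x] that by (simp add: comb_apply)
  qed (use assms in auto)
next
  assume "f = g"
  moreover have "comb 1 g (-1) g = (\<lambda>x\<in>S. 0)" by (auto simp: comb_def)
  ultimately show "fun_dist S ip f g = 0"
    by (simp add: fun_dist_comb nrm_zero)
qed

lemma nrm_diff_le: "f \<in> H \<Longrightarrow> g \<in> H \<Longrightarrow> \<bar>nrm f - nrm g\<bar> \<le> fun_dist S ip f g"
proof -
  assume f: "f \<in> H" and g: "g \<in> H"
  have *: "comb 1 f 1 (\<lambda>x\<in>S. 0) = f" if "f \<in> H" for f
    using H_ext[OF that] by (auto simp: comb_def extensional_def)
  have **: "fun_dist S ip f (\<lambda>x\<in>S. 0) = nrm f" if "f \<in> H" for f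
    unfolding fun_dist_comb using *[OF that] by (simp add: comb_def cong: restrict_cong)
  show ?thesis
    using fun_dist_triangle[OF f g zero_in] fun_dist_triangle[OF g f zero_in]
      fun_dist_sym[OF f g] by (simp add: ** f g)
qed

section \<open>Minimizers of a convex functional plus a squared norm\<close>

definition midpoint_closed :: "('x \<Rightarrow> real) set \<Rightarrow> bool" where
  "midpoint_closed V \<longleftrightarrow> (\<forall>f\<in>V. \<forall>g\<in>V. comb (1/2) f (1/2) g \<in> V)"

definition seq_closed :: "('x \<Rightarrow> real) set \<Rightarrow> bool" where
  "seq_closed V \<longleftrightarrow>
     (\<forall>u. \<forall>f\<in>H. (\<forall>n. u n \<in> V) \<longrightarrow> (\<lambda>n. fun_dist S ip (u n) f) \<longlonglongrightarrow> 0 \<longrightarrow> f \<in> V)"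

text \<open>Parallelogram identity for the penalty: the midpoint undercuts the average by
  \<open>l / 4\<close> times the squared distance. Both the Cauchy property of minimizing sequences
  and the uniqueness of minimizers come from this gain.\<close>

lemma midpoint_gap:
  assumes f: "f \<in> H" and g: "g \<in> H"
    and "\<Phi> (comb (1/2) f (1/2) g) \<le> (\<Phi> f + \<Phi> g) / 2"
  shows "\<Phi> (comb (1/2) f (1/2) g) + l * (nrm (comb (1/2) f (1/2) g))\<^sup>2
    \<le> (\<Phi> f + l * (nrm f)\<^sup>2 + (\<Phi> g + l * (nrm g)\<^sup>2)) / 2 - l / 4 * (fun_dist S ip f g)\<^sup>2"
  using assms(3) unfolding fun_dist_comb nrm_sq_comb[OF f g]
  by (simp add: field_simps power2_eq_square)

text \<open>By \<open>midpoint_gap\<close> a minimizing sequence is Cauchy in norm, and the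
  objective is norm continuous. The set \<open>V\<close> is a parameter because the result serves
  SVMs and Riesz representers with \<open>V = H\<close>, and the projection onto a closed subspace
  with a smaller \<open>V\<close>.\<close>

lemma exists_minimizer:
  assumes V: "V \<subseteq> H" "V \<noteq> {}" "midpoint_closed V" "seq_closed V" and l: "l > 0"
    and mid: "\<And>f g. f \<in> V \<Longrightarrow> g \<in> V \<Longrightarrow> \<Phi> (comb (1/2) f (1/2) g) \<le> (\<Phi> f + \<Phi> g) / 2"
    and lip: "\<And>f g. f \<in> V \<Longrightarrow> g \<in> V \<Longrightarrow> \<bar>\<Phi> f - \<Phi> g\<bar> \<le> C * fun_dist S ip f g"
  shows "\<exists>f\<in>V. \<forall>g\<in>V. \<Phi> f + l * (nrm f)\<^sup>2 \<le> \<Phi> g + l * (nrm g)\<^sup>2"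
proof -
  define J where "J f = \<Phi> f + l * (nrm f)\<^sup>2" for f
  define D where "D = \<bar>C\<bar>"
  have lip': "\<bar>\<Phi> f - \<Phi> g\<bar> \<le> D * fun_dist S ip f g" if "f \<in> V" "g \<in> V" for f g
  proof -
    have "C * fun_dist S ip f g \<le> D * fun_dist S ip f g"
      using fun_dist_nonneg[of f g] that V(1) by (intro mult_right_mono) (auto simp: D_def)
    then show ?thesis using lip[OF that] by simp
  qed
  obtain f0 where f0: "f0 \<in> V" using V(2) by auto
  \<comment> \<open>The Lipschitz part decreases at most linearly in \<open>nrm f\<close>, which the
    quadratic penalty outgrows; completing the square makes the lower bound explicit.\<close>
  have low: "\<Phi> f0 - D * nrm f0 - D\<^sup>2 / (4 * l) \<le> J f" if f: "f \<in> V" for f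
  proof -
    have fH: "f \<in> H" "f0 \<in> H" using f f0 V by auto
    have "fun_dist S ip f f0 \<le> nrm f + nrm f0"
      unfolding fun_dist_comb using nrm_comb_le[OF fH, of 1 "-1"] by simp
    then have "D * fun_dist S ip f f0 \<le> D * (nrm f + nrm f0)"
      by (intro mult_left_mono) (auto simp: D_def)
    then have "\<Phi> f0 - D * nrm f0 - D * nrm f \<le> \<Phi> f"
      using lip'[OF f f0] by (simp add: algebra_simps)
    moreover have "l * (nrm f - D / (2 * l))\<^sup>2 = l * (nrm f)\<^sup>2 - (D * nrm f - D\<^sup>2 / (4 * l))"
      using l by (simp add: field_simps power2_eq_square)
    then have "D * nrm f - D\<^sup>2 / (4 * l) \<le> l * (nrm f)\<^sup>2"
      using l by (metis diff_ge_0_iff_ge less_imp_le mult_nonneg_nonneg zero_le_power2)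
    ultimately show ?thesis by (simp add: J_def)
  qed
  define m where "m = Inf (J ` V)"
  have bdd: "bdd_below (J ` V)" using low by (auto intro!: bdd_belowI)
  have m_le: "m \<le> J f" if "f \<in> V" for f
    unfolding m_def using bdd that by (intro cInf_lower) auto
  have "\<exists>f\<in>V. J f < m + 1 / real (Suc n)" for n
  proof -
    have "Inf (J ` V) < m + 1 / real (Suc n)" by (simp add: m_def)
    then show ?thesis using cInf_less_iff[OF _ bdd] V(2) by auto
  qed
  then obtain u where u: "\<And>n. u n \<in> V" "\<And>n. J (u n) < m + 1 / real (Suc n)" by metis
  have uH: "u n \<in> H" for n using u(1) V(1) by auto
  have close: "(fun_dist S ip (u i) (u j))\<^sup>2 \<le> 2 / l * (1 / real (Suc i) + 1 / real (Suc j))" for i j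
  proof -
    let ?v = "comb (1/2) (u i) (1/2) (u j)"
    have "?v \<in> V" using V(3) u(1) by (auto simp: midpoint_closed_def)
    then have "m \<le> J ?v" by (rule m_le)
    also have "\<dots> \<le> (J (u i) + J (u j)) / 2 - l / 4 * (fun_dist S ip (u i) (u j))\<^sup>2"
      unfolding J_def by (rule midpoint_gap[OF uH uH mid[OF u(1) u(1)]])
    finally have "l * (fun_dist S ip (u i) (u j))\<^sup>2 \<le> 2 * (1 / real (Suc i) + 1 / real (Suc j))"
      using u(2)[of i] u(2)[of j] by argo
    then have "(fun_dist S ip (u i) (u j))\<^sup>2 \<le> 2 * (1 / real (Suc i) + 1 / real (Suc j)) / l"
      using l by (simp add: pos_le_divide_eq mult.commute)
    then show ?thesis by simp
  qed
  have "\<exists>f\<in>H. (\<lambda>n. fun_dist S ip (u n) f) \<longlonglongrightarrow> 0"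
  proof (rule complete[OF uH])
    fix e :: real assume e: "e > 0"
    \<comment> \<open>\<open>N\<close> is chosen so that \<open>2 / l * (2 / real (Suc N))\<close>,
      which bounds the right side of \<open>close\<close> for indices from \<open>N\<close> on, lies
      below \<open>e\<^sup>2\<close>.\<close>
    obtain N where N: "4 / (l * e\<^sup>2) < real N" using reals_Archimedean2 by blast
    have "fun_dist S ip (u i) (u j) < e" if "N \<le> i" "N \<le> j" for i j
    proof (rule power_less_imp_less_base)
      have "1 / real (Suc i) \<le> 1 / real (Suc N)" "1 / real (Suc j) \<le> 1 / real (Suc N)"
        using that by (auto intro!: divide_left_mono)
      then have "2 / l * (1 / real (Suc i) + 1 / real (Suc j)) \<le> 2 / l * (2 / real (Suc N))"
        using l by (intro mult_left_mono) auto
      also have "\<dots> < e\<^sup>2"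
      proof -
        have "4 < l * e\<^sup>2 * real (Suc N)"
        proof -
          have "4 < l * e\<^sup>2 * real N" using N l e by (simp add: field_simps)
          also have "\<dots> \<le> l * e\<^sup>2 * real (Suc N)" using l by (intro mult_left_mono) auto
          finally show ?thesis .
        qed
        then have "4 / (l * real (Suc N)) < e\<^sup>2"
          using l by (subst pos_divide_less_eq) (simp_all add: mult_ac)
        then show ?thesis by simp
      qed
      finally show "(fun_dist S ip (u i) (u j))\<^sup>2 < e\<^sup>2" using close[of i j] by simp
    qed (use e in simp)
    then show "\<exists>N. \<forall>m\<ge>N. \<forall>n\<ge>N. fun_dist S ip (u m) (u n) < e" by blast
  qed
  then obtain f where f: "f \<in> H" "(\<lambda>n. fun_dist S ip (u n) f) \<longlonglongrightarrow> 0" by auto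
  have fV: "f \<in> V" using V(4) f u(1) unfolding seq_closed_def by blast
  have "(\<lambda>n. \<Phi> (u n)) \<longlonglongrightarrow> \<Phi> f"
  proof (rule LIM_zero_cancel, rule Lim_null_comparison)
    show "\<forall>\<^sub>F n in sequentially. norm (\<Phi> (u n) - \<Phi> f) \<le> D * fun_dist S ip (u n) f"
      using lip'[OF u(1) fV] by simp
    show "(\<lambda>n. D * fun_dist S ip (u n) f) \<longlonglongrightarrow> 0"
      using tendsto_mult_right_zero[OF f(2)] by simp
  qed
  moreover have "(\<lambda>n. nrm (u n)) \<longlonglongrightarrow> nrm f"
  proof (rule LIM_zero_cancel, rule Lim_null_comparison[OF _ f(2)])
    show "\<forall>\<^sub>F n in sequentially. norm (nrm (u n) - nrm f) \<le> fun_dist S ip (u n) f"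
      using nrm_diff_le[OF uH f(1)] by simp
  qed
  ultimately have "(\<lambda>n. J (u n)) \<longlonglongrightarrow> J f"
    unfolding J_def by (intro tendsto_intros)
  moreover have "(\<lambda>n. m + 1 / real (Suc n)) \<longlonglongrightarrow> m + 0"
    by (intro tendsto_intros LIMSEQ_Suc[OF lim_1_over_n])
  ultimately have "J f \<le> m + 0"
    using u(2) by (intro LIMSEQ_le[of "\<lambda>n. J (u n)"]) (auto intro: less_imp_le)
  then show ?thesis using m_le fV unfolding J_def by force
qed

lemma seq_closed_H: "seq_closed H" by (simp add: seq_closed_def)
lemma midpoint_closed_H: "midpoint_closed H" by (simp add: midpoint_closed_def comb_in)

lemma minimizer_unique:
  assumes f: "f \<in> H" "\<And>g. g \<in> H \<Longrightarrow> \<Phi> f + l * (nrm f)\<^sup>2 \<le> \<Phi> g + l * (nrm g)\<^sup>2"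
    and f': "f' \<in> H" "\<And>g. g \<in> H \<Longrightarrow> \<Phi> f' + l * (nrm f')\<^sup>2 \<le> \<Phi> g + l * (nrm g)\<^sup>2"
    and mid: "\<Phi> (comb (1/2) f (1/2) f') \<le> (\<Phi> f + \<Phi> f') / 2" and l: "l > 0"
  shows "f = f'"
proof -
  \<comment> \<open>The midpoint competes with both minimizers, so its value is at least each of
    theirs, and the gap in \<open>midpoint_gap\<close> has to vanish.\<close>
  have "d \<le> 0" if "m \<le> (a + b) / 2 - d" "a \<le> m" "b \<le> m" for a b m d :: real
    using that by argo
  from this[OF midpoint_gap[OF f(1) f'(1), where \<Phi>=\<Phi> and l=l, OF mid] f(2) f'(2)]
  have "l / 4 * (fun_dist S ip f f')\<^sup>2 \<le> 0"
    using f(1) f'(1) by (simp add: comb_in)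
  then have "fun_dist S ip f f' = 0" using l by (simp add: mult_le_0_iff)
  then show ?thesis using fun_dist_eq_0 f f' by simp
qed

text \<open>First-order condition along the segment from \<open>f\<close> to \<open>g\<close>. Only
  the squared norm is differentiated; \<open>\<Phi>\<close> is merely convex along the segment, so
  it contributes its increment instead of a derivative.\<close>

lemma variational_ineq:
  assumes f: "f \<in> H" "\<And>g. g \<in> H \<Longrightarrow> \<Phi> f + l * (nrm f)\<^sup>2 \<le> \<Phi> g + l * (nrm g)\<^sup>2"
    and g: "g \<in> H"
    and cvx: "\<And>s. 0 < s \<Longrightarrow> s < 1 \<Longrightarrow> \<Phi> (comb (1 - s) f s g) \<le> (1 - s) * \<Phi> f + s * \<Phi> g"
  shows "0 \<le> \<Phi> g - \<Phi> f + 2 * l * ip f (comb 1 g (-1) f)"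
proof (rule nonneg_of_small_steps)
  fix s :: real assume s: "0 < s" "s < 1"
  have "0 \<le> \<Phi> (comb (1 - s) f s g) - \<Phi> f + l * ((nrm (comb (1 - s) f s g))\<^sup>2 - (nrm f)\<^sup>2)"
    using f(2)[OF comb_in[OF f(1) g], of "1 - s" s] by (simp add: algebra_simps)
  also have "\<dots> \<le> (1 - s) * \<Phi> f + s * \<Phi> g - \<Phi> f + l * ((nrm (comb (1 - s) f s g))\<^sup>2 - (nrm f)\<^sup>2)"
    using cvx[OF s] by simp
  also have "\<dots> = s * (\<Phi> g - \<Phi> f + 2 * l * ip f (comb 1 g (-1) f)
       + s * (l * (ip f f - 2 * ip f g + ip g g)))"
    using f g by (simp add: nrm_sq_comb ip_comb nrm_sq ip_sym[of g f]) (simp add: algebra_simps power2_eq_square)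
  finally show "0 \<le> \<Phi> g - \<Phi> f + 2 * l * ip f (comb 1 g (-1) f)
       + s * (l * (ip f f - 2 * ip f g + ip g g))"
    using s by (simp add: zero_le_mult_iff)
qed

end

section \<open>Reproducing kernels and representers\<close>

text \<open>\<open>K\<close> is an upper bound of the kernel norm rather than the norm itself, so
  that two kernels on different cells can share one constant, as \<open>kappa\<close> in the theorem
  requires.\<close>

locale rkhs =
  fixes S :: "'x::polish_space set" and k :: "'x \<Rightarrow> 'x \<Rightarrow> real"
    and H :: "('x \<Rightarrow> real) set" and ip :: "('x \<Rightarrow> real) \<Rightarrow> ('x \<Rightarrow> real) \<Rightarrow> real"
    and K :: real
  assumes rk: "is_rkhs S k H ip"
    and k_diag_le: "\<And>x. x \<in> S \<Longrightarrow> k x x \<le> K\<^sup>2"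
    and K_nonneg: "0 \<le> K"
    and k_meas: "measurable_kernel S k"
begin

sublocale hilbert_fs S H ip
  using rk by unfold_locales (simp add: is_rkhs_def)

definition kx :: "'x \<Rightarrow> 'x \<Rightarrow> real" where
  "kx x = (\<lambda>x'\<in>S. k x' x)"

lemma kx_in: "x \<in> S \<Longrightarrow> kx x \<in> H"
  and reproducing: "x \<in> S \<Longrightarrow> f \<in> H \<Longrightarrow> ip f (kx x) = f x"
  using rk by (auto simp: is_rkhs_def kx_def)

lemma nrm_kx_le:
  assumes x: "x \<in> S"
  shows "nrm (kx x) \<le> K"
proof (rule power2_le_imp_le[OF _ K_nonneg])
  have "(nrm (kx x))\<^sup>2 = kx x x"
    using nrm_sq[OF kx_in[OF x]] reproducing[OF x kx_in[OF x]] by simp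
  also have "\<dots> = k x x" using x by (simp add: kx_def)
  finally show "(nrm (kx x))\<^sup>2 \<le> K\<^sup>2" using k_diag_le[OF x] by simp
qed

lemma abs_eval_le:
  assumes "f \<in> H" "x \<in> S"
  shows "\<bar>f x\<bar> \<le> K * nrm f"
proof -
  have "\<bar>f x\<bar> \<le> nrm f * nrm (kx x)"
    using cauchy_schwarz[OF assms(1) kx_in[OF assms(2)]] assms by (simp add: reproducing)
  also have "\<dots> \<le> nrm f * K"
    by (intro mult_left_mono nrm_kx_le assms nrm_nonneg)
  finally show ?thesis by (simp add: mult.commute)
qed

lemma abs_k_le:
  assumes "x \<in> S" "y \<in> S"
  shows "\<bar>k x y\<bar> \<le> K\<^sup>2"
proof -
  have "\<bar>k x y\<bar> \<le> K * nrm (kx y)"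
    using abs_eval_le[OF kx_in[OF assms(2)] assms(1)] assms by (simp add: kx_def)
  also have "\<dots> \<le> K * K"
    by (intro mult_left_mono nrm_kx_le assms K_nonneg)
  finally show ?thesis by (simp add: power2_eq_square)
qed

lemma k_measurable_pair:
  assumes "f \<in> M \<rightarrow>\<^sub>M restrict_space borel S" "g \<in> M \<rightarrow>\<^sub>M restrict_space borel S"
  shows "(\<lambda>z. k (f z) (g z)) \<in> borel_measurable M"
proof -
  have "(\<lambda>z. (f z, g z)) \<in> M \<rightarrow>\<^sub>M restrict_space borel (S \<times> S)"
    using assms by (auto simp: measurable_restrict_space2_iff)
  from measurable_compose[OF this k_meas[unfolded measurable_kernel_def]]
  show ?thesis by simp
qed

lemma kx_measurable:
  assumes x: "x \<in> S"
  shows "kx x \<in> borel_measurable (restrict_space borel S)"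
proof -
  have "(\<lambda>x'. k x' x) \<in> borel_measurable (restrict_space borel S)"
    using x by (intro k_measurable_pair measurable_ident_sets measurable_const)
      (simp_all add: space_restrict_space)
  then show ?thesis
    by (subst measurable_cong[where g="\<lambda>x'. k x' x"]) (simp_all add: kx_def space_restrict_space)
qed

text \<open>The measurable members of \<open>H\<close> form a closed subspace that contains all \<open>k(\<cdot>, x)\<close>; the
  projection of \<open>f\<close> onto it agrees with \<open>f\<close> by the reproducing property.\<close>

lemma H_measurable:
  assumes f: "f \<in> H"
  shows "f \<in> borel_measurable (restrict_space borel S)"
proof -
  let ?M = "restrict_space borel S"
  define V where "V = H \<inter> borel_measurable ?M"
  have sp: "space ?M = S" by (simp add: space_restrict_space)
  have comb_V: "comb a g b h \<in> V" if "g \<in> V" "h \<in> V" for a b g h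
  proof -
    have "comb a g b h \<in> borel_measurable ?M"
      unfolding comb_def using that
      by (subst measurable_cong[where g="\<lambda>x. a * g x + b * h x"]) (auto simp: V_def sp)
    then show ?thesis using that by (simp add: V_def comb_in)
  qed
  \<comment> \<open>Up to the constant \<open>(nrm f)\<^sup>2\<close> the objective is the squared
    distance from \<open>f\<close>, so its minimizer on \<open>V\<close> is the orthogonal
    projection of \<open>f\<close>.\<close>
  have "\<exists>g\<in>V. \<forall>h\<in>V. - 2 * ip f g + 1 * (nrm g)\<^sup>2 \<le> - 2 * ip f h + 1 * (nrm h)\<^sup>2"
  proof (rule exists_minimizer)
    show "V \<subseteq> H" by (simp add: V_def)
    show "V \<noteq> {}"
    proof -
      have "(\<lambda>x\<in>S. 0) \<in> borel_measurable ?M"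
        by (subst measurable_cong[where g="\<lambda>x. 0"]) (auto simp: sp)
      then show ?thesis using zero_in by (auto simp: V_def)
    qed
    show "midpoint_closed V" by (simp add: midpoint_closed_def comb_V)
    show "seq_closed V"
      unfolding seq_closed_def
    proof (intro allI ballI impI)
      fix u g assume g: "g \<in> H" and u: "\<forall>n. u n \<in> V" and lim: "(\<lambda>n. fun_dist S ip (u n) g) \<longlonglongrightarrow> 0"
      have uH: "u n \<in> H" for n using u by (simp add: V_def)
      have "g \<in> borel_measurable ?M"
      proof (rule borel_measurable_LIMSEQ_metric)
        show "u n \<in> borel_measurable ?M" for n using u by (simp add: V_def)
        fix x assume "x \<in> space ?M"
        then have x: "x \<in> S" by (simp add: sp)
        show "(\<lambda>n. u n x) \<longlonglongrightarrow> g x"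
        proof (rule LIM_zero_cancel, rule Lim_null_comparison)
          show "\<forall>\<^sub>F n in sequentially. norm (u n x - g x) \<le> K * fun_dist S ip (u n) g"
            using abs_eval_le[OF comb_in[OF uH g], of x 1 _ "-1"] x
            by (simp add: comb_apply fun_dist_comb)
          show "(\<lambda>n. K * fun_dist S ip (u n) g) \<longlonglongrightarrow> 0"
            using tendsto_mult_right_zero[OF lim] by simp
        qed
      qed
      then show "g \<in> V" using g by (simp add: V_def)
    qed
    show "- 2 * ip f (comb (1/2) g (1/2) h) \<le> (- 2 * ip f g + - 2 * ip f h) / 2"
      if "g \<in> V" "h \<in> V" for g h
      using that f by (simp add: V_def ip_comb)
    show "\<bar>- 2 * ip f g - - 2 * ip f h\<bar> \<le> (2 * nrm f) * fun_dist S ip g h"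
      if "g \<in> V" "h \<in> V" for g h
    proof -
      have "\<bar>ip f g - ip f h\<bar> \<le> nrm f * fun_dist S ip g h"
        using cauchy_schwarz[OF f comb_in, of g h 1 "-1"] that f
        by (simp add: fun_dist_comb V_def ip_comb)
      moreover have "\<bar>- 2 * ip f g - - 2 * ip f h\<bar> = 2 * \<bar>ip f g - ip f h\<bar>"
        by (simp add: abs_if)
      ultimately show ?thesis by simp
    qed
  qed simp
  then obtain g where g: "g \<in> V" and
    min: "\<And>h. h \<in> V \<Longrightarrow> - 2 * ip f g + (nrm g)\<^sup>2 \<le> - 2 * ip f h + (nrm h)\<^sup>2" by auto
  have gH: "g \<in> H" using g by (simp add: V_def)
  have "f x = g x" if x: "x \<in> S" for x
  proof -
    have kV: "kx x \<in> V" using x by (simp add: V_def kx_in kx_measurable)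
    \<comment> \<open>Perturbing the projection by \<open>s\<close> times \<open>kx x\<close> stays
      in the subspace for either sign of \<open>s\<close>, which forces the linear coefficient
      \<open>g x - f x\<close> to be 0.\<close>
    have *: "0 \<le> s * (2 * (g x - f x) + s * (nrm (kx x))\<^sup>2)" for s
    proof -
      have "0 \<le> - 2 * ip f (comb 1 g s (kx x)) + (nrm (comb 1 g s (kx x)))\<^sup>2 - (- 2 * ip f g + (nrm g)\<^sup>2)"
        using min[OF comb_V[OF g kV], of 1 s] by simp
      also have "\<dots> = s * (2 * (g x - f x) + s * (nrm (kx x))\<^sup>2)"
        using f gH x kx_in[OF x]
        by (simp add: nrm_sq_comb ip_comb reproducing) (simp add: algebra_simps power2_eq_square)
      finally show ?thesis .
    qed
    have "0 \<le> 2 * (g x - f x)"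
    proof (rule nonneg_of_small_steps[where b="(nrm (kx x))\<^sup>2"])
      fix s :: real assume "0 < s" "s < 1"
      then show "0 \<le> 2 * (g x - f x) + s * (nrm (kx x))\<^sup>2"
        using *[of s] by (simp only: zero_le_mult_iff) linarith
    qed
    moreover have "0 \<le> 2 * (f x - g x)"
    proof (rule nonneg_of_small_steps[where b="(nrm (kx x))\<^sup>2"])
      fix s :: real assume s: "0 < s" "s < 1"
      have "- s * (2 * (g x - f x) + - s * (nrm (kx x))\<^sup>2) = s * (2 * (f x - g x) + s * (nrm (kx x))\<^sup>2)"
        by (simp add: algebra_simps)
      then show "0 \<le> 2 * (f x - g x) + s * (nrm (kx x))\<^sup>2"
        using *[of "- s"] s by (simp add: zero_le_mult_iff)
    qed
    ultimately show ?thesis by simp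
  qed
  then have "f = g" by (rule extensionalityI[OF H_ext[OF f] H_ext[OF gH]])
  then show ?thesis using g by (simp add: V_def)
qed

end

text \<open>The measure lives on an abstract space mapped into \<open>S\<close> by
  \<open>\<pi>\<close>, because a sample carries an output besides the input. A finite
  \<open>N\<close> covers local probability measures as well as unnormalized restrictions to an
  intersection inside the cell \<open>S\<close>.\<close>

locale rkhs_measure = rkhs S k H ip K + finite_measure N
  for S :: "'x::polish_space set" and k H ip K and N :: "'z measure" +
  fixes \<pi> :: "'z \<Rightarrow> 'x"
  assumes \<pi>_meas: "\<pi> \<in> N \<rightarrow>\<^sub>M restrict_space borel S"
begin

abbreviation mass :: real where "mass \<equiv> measure N (space N)"

lemma \<pi>_in: "z \<in> space N \<Longrightarrow> \<pi> z \<in> S"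
  using measurable_space[OF \<pi>_meas] by (auto simp: space_restrict_space)

lemma H_comp_measurable: "f \<in> H \<Longrightarrow> (\<lambda>z. f (\<pi> z)) \<in> borel_measurable N"
  using measurable_compose[OF \<pi>_meas H_measurable] .

lemma integrable_bounded:
  fixes w :: "'z \<Rightarrow> real"
  shows "w \<in> borel_measurable N \<Longrightarrow> (\<And>z. z \<in> space N \<Longrightarrow> \<bar>w z\<bar> \<le> C) \<Longrightarrow> integrable N w"
  by (rule integrable_const_bound[where B=C]) auto

lemma abs_integral_le:
  fixes w :: "'z \<Rightarrow> real"
  assumes "\<And>z. z \<in> space N \<Longrightarrow> \<bar>w z\<bar> \<le> C" "0 \<le> C"
  shows "\<bar>\<integral>z. w z \<partial>N\<bar> \<le> C * mass"
proof (cases "integrable N w")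
  case True
  have "\<bar>\<integral>z. w z \<partial>N\<bar> \<le> (\<integral>z. \<bar>w z\<bar> \<partial>N)" by (rule integral_abs_bound)
  also have "\<dots> \<le> (\<integral>z. C \<partial>N)"
    using True assms by (intro integral_mono) auto
  finally show ?thesis by (simp add: mult.commute)
\<comment> \<open>A non-integrable \<open>w\<close> has integral 0 by convention, which the bound
  allows since \<open>C\<close> is nonnegative.\<close>
qed (use assms in \<open>simp add: not_integrable_integral_eq\<close>)

text \<open>This class of weights is integrable for the finite \<open>N\<close>, closed under
  products and differences, and contains members of \<open>H\<close> composed with
  \<open>\<pi>\<close>, so integrability follows by rules alone.\<close>

definition bm :: "('z \<Rightarrow> real) \<Rightarrow> bool" where
  "bm w \<longleftrightarrow> w \<in> borel_measurable N \<and> (\<exists>C. \<forall>z\<in>space N. \<bar>w z\<bar> \<le> C)"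

lemma bm_I: "w \<in> borel_measurable N \<Longrightarrow> (\<And>z. z \<in> space N \<Longrightarrow> \<bar>w z\<bar> \<le> C) \<Longrightarrow> bm w"
  by (auto simp: bm_def)

lemma bm_H: "f \<in> H \<Longrightarrow> bm (\<lambda>z. f (\<pi> z))"
  by (rule bm_I[OF H_comp_measurable abs_eval_le]) (auto simp: \<pi>_in)

lemma bm_integrable: "bm w \<Longrightarrow> integrable N w"
  unfolding bm_def by (auto intro: integrable_bounded)

lemma bm_mult: "bm w \<Longrightarrow> bm v \<Longrightarrow> bm (\<lambda>z. w z * v z)"
proof -
  assume "bm w" "bm v"
  then obtain C D where *: "\<forall>z\<in>space N. \<bar>w z\<bar> \<le> C" "\<forall>z\<in>space N. \<bar>v z\<bar> \<le> D"
    and "w \<in> borel_measurable N" "v \<in> borel_measurable N" by (auto simp: bm_def)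
  moreover have "\<bar>w z * v z\<bar> \<le> C * D" if "z \<in> space N" for z
    unfolding abs_mult using * that by (intro mult_mono) (auto intro: order_trans[OF abs_ge_zero])
  ultimately show ?thesis by (auto intro!: bm_I)
qed

lemma bm_diff: "bm w \<Longrightarrow> bm v \<Longrightarrow> bm (\<lambda>z. w z - v z)"
proof -
  assume "bm w" "bm v"
  then obtain C D where *: "\<forall>z\<in>space N. \<bar>w z\<bar> \<le> C" "\<forall>z\<in>space N. \<bar>v z\<bar> \<le> D"
    and "w \<in> borel_measurable N" "v \<in> borel_measurable N" by (auto simp: bm_def)
  moreover have "\<bar>w z - v z\<bar> \<le> C + D" if "z \<in> space N" for z
    using * that by (metis abs_triangle_ineq4 add_mono order_trans)
  ultimately show ?thesis by (auto intro!: bm_I)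
qed

lemma integral_comb:
  assumes "bm w" "f \<in> H" "g \<in> H"
  shows "(\<integral>z. w z * comb a f b g (\<pi> z) \<partial>N) = a * (\<integral>z. w z * f (\<pi> z) \<partial>N) + b * (\<integral>z. w z * g (\<pi> z) \<partial>N)"
proof -
  have "(\<integral>z. w z * comb a f b g (\<pi> z) \<partial>N) = (\<integral>z. a * (w z * f (\<pi> z)) + b * (w z * g (\<pi> z)) \<partial>N)"
    by (intro Bochner_Integration.integral_cong) (auto simp: comb_apply \<pi>_in algebra_simps)
  also have "\<dots> = a * (\<integral>z. w z * f (\<pi> z) \<partial>N) + b * (\<integral>z. w z * g (\<pi> z) \<partial>N)"
    using assms by (subst Bochner_Integration.integral_add) (auto intro!: bm_integrable bm_mult bm_H)
  finally show ?thesis .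
qed

lemma abs_integral_H_le:
  assumes "\<And>z. z \<in> space N \<Longrightarrow> \<bar>w z\<bar> \<le> C" "0 \<le> C" "f \<in> H"
  shows "\<bar>\<integral>z. w z * f (\<pi> z) \<partial>N\<bar> \<le> C * K * mass * nrm f"
proof -
  have "\<bar>w z * f (\<pi> z)\<bar> \<le> C * (K * nrm f)" if "z \<in> space N" for z
    unfolding abs_mult using that assms by (intro mult_mono abs_eval_le \<pi>_in) auto
  from abs_integral_le[OF this] show ?thesis
    using assms nrm_nonneg K_nonneg by (simp add: mult_ac)
qed

text \<open>Riesz representation by minimization: half the squared norm minus the functional attains
  its minimum at the representer.\<close>

lemma riesz:
  assumes w: "bm w"
  shows "\<exists>G\<in>H. \<forall>g\<in>H. ip G g = (\<integral>z. w z * g (\<pi> z) \<partial>N)"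
proof -
  define \<Phi> where "\<Phi> g = - (\<integral>z. w z * g (\<pi> z) \<partial>N)" for g
  have \<Phi>_comb: "\<Phi> (comb a f b g) = a * \<Phi> f + b * \<Phi> g" if "f \<in> H" "g \<in> H" for a b f g
    using integral_comb[OF w that, of a b] by (simp add: \<Phi>_def)
  obtain C0 where C0: "\<And>z. z \<in> space N \<Longrightarrow> \<bar>w z\<bar> \<le> C0" using w by (auto simp: bm_def)
  define C where "C = max C0 0"
  have C: "\<And>z. z \<in> space N \<Longrightarrow> \<bar>w z\<bar> \<le> C" "0 \<le> C" using C0 by (auto simp: C_def le_max_iff_disj)
  have "\<exists>f\<in>H. \<forall>g\<in>H. \<Phi> f + (1/2) * (nrm f)\<^sup>2 \<le> \<Phi> g + (1/2) * (nrm g)\<^sup>2"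
  proof (rule exists_minimizer[OF order_refl _ midpoint_closed_H seq_closed_H])
    show "H \<noteq> {}" using zero_in by auto
    show "\<Phi> (comb (1/2) f (1/2) g) \<le> (\<Phi> f + \<Phi> g) / 2" if "f \<in> H" "g \<in> H" for f g
      by (simp add: \<Phi>_comb that)
    show "\<bar>\<Phi> f - \<Phi> g\<bar> \<le> (C * K * mass) * fun_dist S ip f g" if "f \<in> H" "g \<in> H" for f g
      using abs_integral_H_le[of w C "comb 1 f (-1) g", OF C comb_in[OF that]] \<Phi>_comb[OF that, of 1 "-1"]
      by (simp add: \<Phi>_def fun_dist_comb)
  qed simp
  then obtain f where f: "f \<in> H" "\<And>g. g \<in> H \<Longrightarrow> \<Phi> f + (1/2) * (nrm f)\<^sup>2 \<le> \<Phi> g + (1/2) * (nrm g)\<^sup>2"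
    by auto
  have "ip f g = (\<integral>z. w z * g (\<pi> z) \<partial>N)" if g: "g \<in> H" for g
  proof -
    \<comment> \<open>The functional is linear, so the variational inequality at
      \<open>f + s g\<close> is homogeneous in \<open>s\<close>; the values 1 and -1 turn it into an
      equation.\<close>
    have *: "0 \<le> s * (\<Phi> g + ip f g)" for s
    proof -
      have gs: "comb 1 f s g \<in> H" by (intro comb_in f g)
      have "0 \<le> \<Phi> (comb 1 f s g) - \<Phi> f + 2 * (1/2) * ip f (comb 1 (comb 1 f s g) (-1) f)"
        by (rule variational_ineq[OF f gs]) (simp_all add: \<Phi>_comb f gs)
      then show ?thesis using f g gs by (simp add: \<Phi>_comb ip_comb algebra_simps)
    qed
    show ?thesis using *[of 1] *[of "-1"] by (simp add: \<Phi>_def)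
  qed
  then show ?thesis using f by auto
qed

text \<open>The kernel integral operator applied to the weight \<open>w\<close>, taken as a Riesz
  representer. This weak form avoids integrals with values in \<open>H\<close>;
  \<open>rep_apply\<close> recovers the pointwise formula through the reproducing property.\<close>

definition rep :: "('z \<Rightarrow> real) \<Rightarrow> 'x \<Rightarrow> real" where
  "rep w = (SOME G. G \<in> H \<and> (\<forall>g\<in>H. ip G g = (\<integral>z. w z * g (\<pi> z) \<partial>N)))"

lemma rep: "bm w \<Longrightarrow> rep w \<in> H \<and> (\<forall>g\<in>H. ip (rep w) g = (\<integral>z. w z * g (\<pi> z) \<partial>N))"
  using riesz[of w] unfolding rep_def Bex_def by (rule someI_ex)

lemma rep_in: "bm w \<Longrightarrow> rep w \<in> H"
  and ip_rep: "bm w \<Longrightarrow> g \<in> H \<Longrightarrow> ip (rep w) g = (\<integral>z. w z * g (\<pi> z) \<partial>N)"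
  using rep by auto

lemma rep_apply:
  assumes "bm w" "x \<in> S"
  shows "rep w x = (\<integral>z. w z * k (\<pi> z) x \<partial>N)"
proof -
  have "rep w x = (\<integral>z. w z * kx x (\<pi> z) \<partial>N)"
    using ip_rep[OF assms(1) kx_in[OF assms(2)]] by (simp add: reproducing assms rep_in)
  also have "\<dots> = (\<integral>z. w z * k (\<pi> z) x \<partial>N)"
    by (intro Bochner_Integration.integral_cong) (auto simp: kx_def \<pi>_in)
  finally show ?thesis .
qed

text \<open>\<open>G\<close> is tested with itself and one factor \<open>nrm G\<close> cancels. The
  identity is asked for at \<open>G\<close> alone, so the bound applies to a single representer and
  to a difference of two.\<close>

lemma nrm_le_of_represents:
  assumes G: "G \<in> H" "ip G G = (\<integral>z. w z * G (\<pi> z) \<partial>N)"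
    and w: "\<And>z. z \<in> space N \<Longrightarrow> \<bar>w z\<bar> \<le> C" "0 \<le> C"
  shows "nrm G \<le> C * K * mass"
proof (cases "nrm G = 0")
  case True
  then show ?thesis using w(2) K_nonneg by simp
next
  case False
  then have "nrm G > 0" using nrm_nonneg[OF G(1)] by simp
  moreover have "nrm G * nrm G \<le> C * K * mass * nrm G"
    using abs_integral_H_le[of w C, OF w G(1)] nrm_sq[OF G(1)] unfolding G(2) power2_eq_square by linarith
  ultimately show ?thesis by simp
qed

lemma nrm_rep_le:
  assumes "bm w" "\<And>z. z \<in> space N \<Longrightarrow> \<bar>w z\<bar> \<le> C" "0 \<le> C"
  shows "nrm (rep w) \<le> C * K * mass"
  by (rule nrm_le_of_represents[OF rep_in[OF assms(1)] ip_rep[OF assms(1) rep_in[OF assms(1)]] assms(2,3)])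

lemma ip_rep_diff:
  assumes "bm w" "bm v" "g \<in> H"
  shows "ip (comb 1 (rep w) (-1) (rep v)) g = (\<integral>z. (w z - v z) * g (\<pi> z) \<partial>N)"
  using assms
  by (simp add: ip_comb rep_in ip_rep left_diff_distrib bm_integrable bm_mult bm_H)

end

section \<open>Support vector machines and smoothed loss derivatives\<close>

lemma convex_chord:
  fixes \<phi> :: "real \<Rightarrow> real"
  assumes "convex_on UNIV \<phi>" "x < y" "y < z"
  shows "\<phi> y * (z - x) \<le> \<phi> x * (z - y) + \<phi> z * (y - x)"
proof -
  define t where "t = (y - x) / (z - x)"
  have t: "0 \<le> t" "t \<le> 1" "t * (z - x) = y - x"
    using assms by (auto simp: t_def field_simps)
  have "(1 - t) * x + t * z = y" using t(3) by (simp add: algebra_simps)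
  then have "\<phi> y \<le> (1 - t) * \<phi> x + t * \<phi> z"
    using convex_onD[OF assms(1) t(1,2), of x z] by simp
  then have "\<phi> y * (z - x) \<le> ((1 - t) * \<phi> x + t * \<phi> z) * (z - x)"
    using assms by (intro mult_right_mono) auto
  also have "\<dots> = \<phi> x * ((z - x) - t * (z - x)) + \<phi> z * (t * (z - x))"
    by (simp add: algebra_simps)
  finally show ?thesis by (simp add: t(3))
qed

definition slope :: "real \<Rightarrow> (real \<Rightarrow> real) \<Rightarrow> real \<Rightarrow> real" where
  "slope e \<phi> t = (\<phi> (t + e) - \<phi> t) / e"

lemma slope_mono:
  assumes cvx: "convex_on UNIV \<phi>" and "e > 0" "s \<le> t"
  shows "slope e \<phi> s \<le> slope e \<phi> t"
proof (cases "s = t")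
  case False
  then have st: "s < t" using assms by simp
  \<comment> \<open>The chord inequalities at the points \<open>s + e\<close> and \<open>t\<close>
    of the interval from \<open>s\<close> to \<open>t + e\<close> have complementary weights; their
    sum gives both endpoints full weight.\<close>
  have "(\<phi> (s + e) + \<phi> t) * (t + e - s) \<le> (\<phi> s + \<phi> (t + e)) * (t + e - s)"
    using convex_chord[OF cvx, of s "s + e" "t + e"] convex_chord[OF cvx, of s t "t + e"] st \<open>e > 0\<close>
    by (simp add: algebra_simps)
  then have "\<phi> (s + e) + \<phi> t \<le> \<phi> s + \<phi> (t + e)"
    using st \<open>e > 0\<close> by (simp add: mult_le_cancel_right)
  then show ?thesis using \<open>e > 0\<close> by (simp add: slope_def divide_right_mono)
qed simp

lemma slope_monotone_mult:
  assumes "convex_on UNIV \<phi>" "e > 0"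
  shows "0 \<le> (slope e \<phi> s - slope e \<phi> t) * (s - t)"
proof (cases "s \<le> t")
  case True
  then show ?thesis using slope_mono[OF assms True] by (intro mult_nonpos_nonpos) auto
next
  case False
  then show ?thesis using slope_mono[OF assms, of t s] by (intro mult_nonneg_nonneg) auto
qed

lemma abs_slope_le:
  assumes "\<And>s t. \<bar>\<phi> s - \<phi> t\<bar> \<le> c * \<bar>s - t\<bar>" "e > 0"
  shows "\<bar>slope e \<phi> t\<bar> \<le> c"
  using assms(1)[of "t + e" t] assms(2) by (simp add: slope_def abs_divide field_simps)

lemma slope_lipschitz:
  assumes "\<And>s t. \<bar>\<phi> s - \<phi> t\<bar> \<le> c * \<bar>s - t\<bar>" "e > 0"
  shows "\<bar>slope e \<phi> s - slope e \<phi> t\<bar> \<le> 2 * c / e * \<bar>s - t\<bar>"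
proof -
  have "\<bar>(\<phi> (s + e) - \<phi> (t + e)) - (\<phi> s - \<phi> t)\<bar> \<le> 2 * c * \<bar>s - t\<bar>"
    using assms(1)[of "s + e" "t + e"] assms(1)[of s t] by simp
  moreover have "slope e \<phi> s - slope e \<phi> t = ((\<phi> (s + e) - \<phi> (t + e)) - (\<phi> s - \<phi> t)) / e"
    by (simp add: slope_def diff_divide_distrib)
  ultimately show ?thesis using assms(2) by (simp add: abs_divide divide_right_mono)
qed

text \<open>For \<open>a\<close> outside the interval from \<open>b\<close> to \<open>b + e\<close>
  the quotient at \<open>b\<close> satisfies the exact subgradient inequality, so the left side is
  at most 0. Inside it, the increment and the linear term are each at most \<open>c * e\<close> by
  the Lipschitz bound.\<close>

lemma slope_almost_subgradient:
  assumes cvx: "convex_on UNIV \<phi>" and lip: "\<And>s t. \<bar>\<phi> s - \<phi> t\<bar> \<le> c * \<bar>s - t\<bar>" and e: "e > 0"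
  shows "\<phi> b - \<phi> a + slope e \<phi> b * (a - b) \<le> 2 * c * e"
proof -
  have c: "0 \<le> c" using lip[of 0 1] by simp
  have e_cancel: "slope e \<phi> b * e = \<phi> (b + e) - \<phi> b" using e by (simp add: slope_def)
  consider "b + e < a" | "a < b" | "b \<le> a" "a \<le> b + e" by linarith
  then show ?thesis
  proof cases
    case 1
    have "(\<phi> b - \<phi> a + slope e \<phi> b * (a - b)) * e = (\<phi> b - \<phi> a) * e + (slope e \<phi> b * e) * (a - b)"
      by (simp add: algebra_simps)
    also have "\<dots> \<le> 0"
      unfolding e_cancel using convex_chord[OF cvx, of b "b + e" a] 1 e by (simp add: algebra_simps)
    finally have "\<phi> b - \<phi> a + slope e \<phi> b * (a - b) \<le> 0" using e by (simp add: mult_le_0_iff)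
    then show ?thesis using c e by (smt (verit) mult_nonneg_nonneg)
  next
    case 2
    have "(\<phi> b - \<phi> a + slope e \<phi> b * (a - b)) * e = (\<phi> b - \<phi> a) * e + (slope e \<phi> b * e) * (a - b)"
      by (simp add: algebra_simps)
    also have "\<dots> \<le> 0"
      unfolding e_cancel using convex_chord[OF cvx, of a b "b + e"] 2 e by (simp add: algebra_simps)
    finally have "\<phi> b - \<phi> a + slope e \<phi> b * (a - b) \<le> 0" using e by (simp add: mult_le_0_iff)
    then show ?thesis using c e by (smt (verit) mult_nonneg_nonneg)
  next
    case 3
    have "\<phi> b - \<phi> a \<le> c * \<bar>b - a\<bar>" using lip[of b a] by simp
    also have "\<dots> \<le> c * e" using 3 c by (intro mult_left_mono) auto
    finally have "\<phi> b - \<phi> a \<le> c * e" .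
    moreover have "slope e \<phi> b * (a - b) \<le> c * e"
      using abs_slope_le[of \<phi> c e b, OF lip e] 3 c by (intro mult_mono) auto
    ultimately show ?thesis by simp
  qed
qed

text \<open>The loss is a family \<open>\<psi> z\<close> of functions of the prediction.
  Measurability is stated for compositions with measurable predictions; this one form serves both
  the risk and the difference quotients.\<close>

locale svm_problem = rkhs_measure S k H ip K N \<pi>
  for S :: "'x::polish_space set" and k H ip K and N :: "'z measure" and \<pi> +
  fixes \<psi> :: "'z \<Rightarrow> real \<Rightarrow> real" and c l :: real
  assumes \<psi>_meas: "\<And>v. v \<in> borel_measurable N \<Longrightarrow> (\<lambda>z. \<psi> z (v z)) \<in> borel_measurable N"
    and \<psi>_convex: "\<And>z. z \<in> space N \<Longrightarrow> convex_on UNIV (\<psi> z)"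
    and \<psi>_lip: "\<And>z s t. z \<in> space N \<Longrightarrow> \<bar>\<psi> z s - \<psi> z t\<bar> \<le> c * \<bar>s - t\<bar>"
    and c_nonneg: "0 \<le> c" and l_pos: "0 < l"
begin

text \<open>Subtracting \<open>\<psi> z 0\<close> bounds the integrand by
  \<open>c * (K * nrm f)\<close>, so the risk is finite even when the loss has no finite
  mean.\<close>

definition risk :: "('x \<Rightarrow> real) \<Rightarrow> real" where
  "risk f = (\<integral>z. \<psi> z (f (\<pi> z)) - \<psi> z 0 \<partial>N)"

definition minimizer :: "('x \<Rightarrow> real) \<Rightarrow> bool" where
  "minimizer f \<longleftrightarrow> f \<in> H \<and> (\<forall>g\<in>H. risk f + l * (nrm f)\<^sup>2 \<le> risk g + l * (nrm g)\<^sup>2)"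

lemma bm_loss:
  assumes f: "f \<in> H"
  shows "bm (\<lambda>z. \<psi> z (f (\<pi> z)) - \<psi> z 0)"
proof (rule bm_I)
  show "(\<lambda>z. \<psi> z (f (\<pi> z)) - \<psi> z 0) \<in> borel_measurable N"
    by (intro borel_measurable_diff \<psi>_meas H_comp_measurable f borel_measurable_const)
  fix z assume z: "z \<in> space N"
  have "\<bar>\<psi> z (f (\<pi> z)) - \<psi> z 0\<bar> \<le> c * \<bar>f (\<pi> z)\<bar>" using \<psi>_lip[OF z, of _ 0] by simp
  also have "\<dots> \<le> c * (K * nrm f)" by (intro mult_left_mono abs_eval_le f \<pi>_in z c_nonneg)
  finally show "\<bar>\<psi> z (f (\<pi> z)) - \<psi> z 0\<bar> \<le> c * (K * nrm f)" .
qed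

lemma bm_loss_diff: "f \<in> H \<Longrightarrow> g \<in> H \<Longrightarrow> bm (\<lambda>z. \<psi> z (f (\<pi> z)) - \<psi> z (g (\<pi> z)))"
  using bm_diff[OF bm_loss bm_loss] by simp

lemma risk_diff:
  assumes "f \<in> H" "g \<in> H"
  shows "risk f - risk g = (\<integral>z. \<psi> z (f (\<pi> z)) - \<psi> z (g (\<pi> z)) \<partial>N)"
  using Bochner_Integration.integral_diff[OF bm_integrable[OF bm_loss[OF assms(1)]]
      bm_integrable[OF bm_loss[OF assms(2)]]]
  by (simp add: risk_def)

lemma abs_risk_diff_le:
  assumes "f \<in> H" "g \<in> H"
  shows "\<bar>risk f - risk g\<bar> \<le> (c * K * mass) * fun_dist S ip f g"
proof -
  have "\<bar>\<psi> z (f (\<pi> z)) - \<psi> z (g (\<pi> z))\<bar> \<le> c * (K * fun_dist S ip f g)" if z: "z \<in> space N" for z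
  proof -
    have "\<bar>\<psi> z (f (\<pi> z)) - \<psi> z (g (\<pi> z))\<bar> \<le> c * \<bar>f (\<pi> z) - g (\<pi> z)\<bar>" by (rule \<psi>_lip[OF z])
    also have "\<dots> \<le> c * (K * fun_dist S ip f g)"
      using abs_eval_le[OF comb_in[OF assms, of 1 "-1"] \<pi>_in[OF z]] \<pi>_in[OF z]
      by (intro mult_left_mono c_nonneg) (simp add: comb_apply fun_dist_comb)
    finally show ?thesis .
  qed
  from abs_integral_le[OF this] show ?thesis
    unfolding risk_diff[OF assms] using fun_dist_nonneg[OF assms] c_nonneg K_nonneg
    by (simp add: mult_ac)
qed

lemma risk_convex:
  assumes fg: "f \<in> H" "g \<in> H" and s: "0 \<le> s" "s \<le> 1"
  shows "risk (comb (1 - s) f s g) \<le> (1 - s) * risk f + s * risk g"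
proof -
  have "risk (comb (1 - s) f s g)
      \<le> (\<integral>z. (1 - s) * (\<psi> z (f (\<pi> z)) - \<psi> z 0) + s * (\<psi> z (g (\<pi> z)) - \<psi> z 0) \<partial>N)"
    unfolding risk_def
  proof (rule integral_mono)
    show "\<psi> z (comb (1 - s) f s g (\<pi> z)) - \<psi> z 0
        \<le> (1 - s) * (\<psi> z (f (\<pi> z)) - \<psi> z 0) + s * (\<psi> z (g (\<pi> z)) - \<psi> z 0)"
      if z: "z \<in> space N" for z
      using convex_onD[OF \<psi>_convex[OF z] s, of "f (\<pi> z)" "g (\<pi> z)"]
      by (simp add: comb_apply \<pi>_in[OF z] algebra_simps)
    show "integrable N (\<lambda>z. (1 - s) * (\<psi> z (f (\<pi> z)) - \<psi> z 0) + s * (\<psi> z (g (\<pi> z)) - \<psi> z 0))"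
      by (rule Bochner_Integration.integrable_add; intro integrable_mult_right bm_integrable[OF bm_loss] fg)
  qed (intro bm_integrable bm_loss comb_in fg)
  also have "\<dots> = (1 - s) * risk f + s * risk g"
    unfolding risk_def by (subst Bochner_Integration.integral_add) (auto intro!: bm_integrable bm_loss fg)
  finally show ?thesis .
qed

lemma risk_midpoint:
  assumes "f \<in> H" "g \<in> H"
  shows "risk (comb (1/2) f (1/2) g) \<le> (risk f + risk g) / 2"
  using risk_convex[OF assms, of "1/2"] by simp

lemma ex_minimizer: "\<exists>f. minimizer f"
proof -
  have "\<exists>f\<in>H. \<forall>g\<in>H. risk f + l * (nrm f)\<^sup>2 \<le> risk g + l * (nrm g)\<^sup>2"
    using zero_in
    by (intro exists_minimizer[OF order_refl _ midpoint_closed_H seq_closed_H l_pos risk_midpoint abs_risk_diff_le])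
       auto
  then show ?thesis by (auto simp: minimizer_def)
qed

lemma svm_unique: "minimizer f \<Longrightarrow> minimizer g \<Longrightarrow> f = g"
  unfolding minimizer_def
  by (rule minimizer_unique[where \<Phi>=risk and l=l, OF _ _ _ _ _ l_pos]) (blast intro: risk_midpoint)+

lemma minimizer_variational:
  assumes "minimizer f" "g \<in> H"
  shows "0 \<le> risk g - risk f + 2 * l * ip f (comb 1 g (-1) f)"
  using assms unfolding minimizer_def by (intro variational_ineq risk_convex) auto

definition pslope :: "real \<Rightarrow> ('x \<Rightarrow> real) \<Rightarrow> 'z \<Rightarrow> real" where
  "pslope e f z = slope e (\<psi> z) (f (\<pi> z))"

lemma abs_pslope_le: "e > 0 \<Longrightarrow> z \<in> space N \<Longrightarrow> \<bar>pslope e f z\<bar> \<le> c"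
  unfolding pslope_def by (intro abs_slope_le \<psi>_lip)

lemma bm_pslope:
  assumes "e > 0" "f \<in> H"
  shows "bm (pslope e f)"
proof (rule bm_I[OF _ abs_pslope_le[OF assms(1)]])
  show "pslope e f \<in> borel_measurable N"
    unfolding pslope_def slope_def
    by (intro borel_measurable_divide borel_measurable_diff \<psi>_meas borel_measurable_add
        H_comp_measurable assms borel_measurable_const)
qed

text \<open>For a small step \<open>\<theta>\<close> the map \<open>f \<mapsto> f - \<theta> (2 l f + rep (pslope e f))\<close> is a contraction, because
  \<open>f \<mapsto> rep (pslope e f)\<close> is monotone and Lipschitz continuous.\<close>

lemma ex_smoothed_solution:
  assumes e: "e > 0"
  shows "\<exists>f\<in>H. \<forall>g\<in>H. 2 * l * ip f g = - (\<integral>z. pslope e f z * g (\<pi> z) \<partial>N)"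
proof -
  \<comment> \<open>\<open>M\<close> is a Lipschitz constant of
    \<open>f \<mapsto> rep (pslope e f)\<close>: \<open>2 * c / e\<close> from the slope, one
    \<open>K\<close> from evaluation, and \<open>K * mass\<close> from the representer.
    \<open>\<theta>\<close> minimizes \<open>(1 - 2 * \<theta> * l)\<^sup>2 + \<theta>\<^sup>2 *
    M\<^sup>2\<close>, and \<open>q\<^sup>2\<close> is the minimum.\<close>
  define M where "M = 2 * c / e * K * K * mass"
  define \<theta> where "\<theta> = 2 * l / (4 * l\<^sup>2 + M\<^sup>2)"
  define R where "R f = rep (pslope e f)" for f
  define F where "F f = comb (1 - 2 * \<theta> * l) f (- \<theta>) (R f)" for f
  define q where "q = sqrt (M\<^sup>2 / (4 * l\<^sup>2 + M\<^sup>2))"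
  have pos: "0 < 4 * l\<^sup>2 + M\<^sup>2" using l_pos by (simp add: add_pos_nonneg)
  have M: "0 \<le> M" using c_nonneg K_nonneg e by (simp add: M_def)
  have \<theta>: "0 < \<theta>" "2 * \<theta> * l \<le> 1"
    using l_pos pos by (simp_all add: \<theta>_def field_simps power2_eq_square)
  have q: "0 \<le> q" "q < 1" using l_pos pos by (simp_all add: q_def)
  have q2: "(1 - 2 * \<theta> * l)\<^sup>2 + \<theta>\<^sup>2 * M\<^sup>2 = q\<^sup>2"
  proof -
    have "\<theta> * (4 * l\<^sup>2 + M\<^sup>2) = 2 * l" using pos by (simp add: \<theta>_def)
    then have "\<theta> * (\<theta> * (4 * l\<^sup>2 + M\<^sup>2)) = \<theta> * (2 * l)" by simp
    then have "(1 - 2 * \<theta> * l)\<^sup>2 + \<theta>\<^sup>2 * M\<^sup>2 = 1 - 2 * l * \<theta>"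
      by (simp add: power2_eq_square algebra_simps)
    also have "\<dots> = M\<^sup>2 / (4 * l\<^sup>2 + M\<^sup>2)"
      using pos by (simp add: \<theta>_def field_simps power2_eq_square)
    finally show ?thesis using pos by (simp add: q_def)
  qed
  have RH: "R f \<in> H" if "f \<in> H" for f unfolding R_def by (intro rep_in bm_pslope e that)
  have FH: "F f \<in> H" if "f \<in> H" for f unfolding F_def by (intro comb_in RH that)
  have contr: "fun_dist S ip (F f) (F g) \<le> q * fun_dist S ip f g" if fg: "f \<in> H" "g \<in> H" for f g
  proof -
    let ?u = "comb 1 f (-1) g" and ?v = "comb 1 (R f) (-1) (R g)"
    have uv: "?u \<in> H" "?v \<in> H" by (intro comb_in RH fg)+
    have ip_v: "ip ?v h = (\<integral>z. (pslope e f z - pslope e g z) * h (\<pi> z) \<partial>N)" if "h \<in> H" for h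
      unfolding R_def by (intro ip_rep_diff bm_pslope e fg that)
    have "nrm ?v \<le> (2 * c / e * (K * nrm ?u)) * K * mass"
    proof (rule nrm_le_of_represents[OF uv(2) ip_v[OF uv(2)]])
      fix z assume z: "z \<in> space N"
      have "\<bar>pslope e f z - pslope e g z\<bar> \<le> 2 * c / e * \<bar>f (\<pi> z) - g (\<pi> z)\<bar>"
        unfolding pslope_def by (intro slope_lipschitz \<psi>_lip z e)
      also have "\<dots> \<le> 2 * c / e * (K * nrm ?u)"
        using abs_eval_le[OF uv(1) \<pi>_in[OF z]] c_nonneg e
        by (intro mult_left_mono) (simp_all add: comb_apply \<pi>_in[OF z])
      finally show "\<bar>pslope e f z - pslope e g z\<bar> \<le> 2 * c / e * (K * nrm ?u)" .
    qed (use c_nonneg K_nonneg e nrm_nonneg[OF uv(1)] in simp)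
    then have v_le: "nrm ?v \<le> M * nrm ?u" by (simp add: M_def mult_ac)
    \<comment> \<open>Slopes of a convex function increase, so the cross term has the right sign.
      The Lipschitz bound alone would give a contraction only for \<open>M < 2 * l\<close>, while
      \<open>M\<close> grows like \<open>1 / e\<close>.\<close>
    have "0 \<le> ip ?v ?u"
      unfolding ip_v[OF uv(1)]
    proof (rule Bochner_Integration.integral_nonneg)
      fix z assume z: "z \<in> space N"
      show "0 \<le> (pslope e f z - pslope e g z) * comb 1 f (- 1) g (\<pi> z)"
        using slope_monotone_mult[OF \<psi>_convex[OF z] e] by (simp add: comb_apply \<pi>_in[OF z] pslope_def)
    qed
    then have mono: "0 \<le> ip ?u ?v" using ip_sym[OF uv] by simp
    have eq: "comb 1 (F f) (-1) (F g) = comb (1 - 2 * \<theta> * l) ?u (- \<theta>) ?v"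
      by (auto simp: F_def comb_def algebra_simps)
    have "(fun_dist S ip (F f) (F g))\<^sup>2
        = (1 - 2 * \<theta> * l)\<^sup>2 * (nrm ?u)\<^sup>2 - 2 * ((1 - 2 * \<theta> * l) * \<theta> * ip ?u ?v) + \<theta>\<^sup>2 * (nrm ?v)\<^sup>2"
      unfolding fun_dist_comb eq nrm_sq_comb[OF uv] by simp
    also have "\<dots> \<le> (1 - 2 * \<theta> * l)\<^sup>2 * (nrm ?u)\<^sup>2 + \<theta>\<^sup>2 * (M * nrm ?u)\<^sup>2"
    proof -
      have "0 \<le> (1 - 2 * \<theta> * l) * \<theta> * ip ?u ?v" using \<theta> mono by simp
      moreover have "\<theta>\<^sup>2 * (nrm ?v)\<^sup>2 \<le> \<theta>\<^sup>2 * (M * nrm ?u)\<^sup>2"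
        using v_le nrm_nonneg[OF uv(2)] by (intro mult_left_mono power_mono) auto
      ultimately show ?thesis by linarith
    qed
    also have "\<dots> = ((1 - 2 * \<theta> * l)\<^sup>2 + \<theta>\<^sup>2 * M\<^sup>2) * (nrm ?u)\<^sup>2"
      by (simp add: power_mult_distrib algebra_simps)
    also have "\<dots> = (q * fun_dist S ip f g)\<^sup>2"
      by (simp add: q2 fun_dist_comb power_mult_distrib)
    finally show ?thesis
      by (rule power2_le_imp_le) (use q fun_dist_nonneg[OF fg] in simp)
  qed
  \<comment> \<open>\<open>Metric_space\<close> asks for nonnegativity and symmetry at all
    arguments, but \<open>ip\<close> is unspecified off \<open>H\<close>; hence the value 0
    there.\<close>
  define d where "d f g = (if f \<in> H \<and> g \<in> H then fun_dist S ip f g else 0)" for f g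
  interpret D: Metric_space H d
    by unfold_locales
      (auto simp: d_def fun_dist_nonneg fun_dist_eq_0 intro: fun_dist_sym fun_dist_triangle)
  have "\<exists>f\<in>H. F f = f"
  proof -
    have "D.mcomplete"
      unfolding D.mcomplete_def
    proof (intro allI impI)
      fix \<sigma> assume \<sigma>: "D.MCauchy \<sigma>"
      then have \<sigma>H: "\<sigma> n \<in> H" for n by (auto simp: D.MCauchy_def)
      have "\<exists>f\<in>H. (\<lambda>n. fun_dist S ip (\<sigma> n) f) \<longlonglongrightarrow> 0"
        using \<sigma> by (intro complete \<sigma>H) (auto simp: D.MCauchy_def d_def \<sigma>H)
      then obtain f where "f \<in> H" "(\<lambda>n. fun_dist S ip (\<sigma> n) f) \<longlonglongrightarrow> 0" by auto
      then have "limitin D.mtopology \<sigma> f sequentially"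
        by (simp add: D.limitin_metric_dist_null \<sigma>H d_def)
      then show "\<exists>f. limitin D.mtopology \<sigma> f sequentially" by blast
    qed
    then obtain f where "f \<in> H" "F f = f"
      using D.Banach_fixedpoint_thm[of F q] q(2) contr FH zero_in
      by (auto simp: d_def)
    then show ?thesis by auto
  qed
  then obtain f where f: "f \<in> H" "F f = f" by auto
  have "2 * l * ip f g = - (\<integral>z. pslope e f z * g (\<pi> z) \<partial>N)" if g: "g \<in> H" for g
  proof -
    have "ip (F f) g = (1 - 2 * \<theta> * l) * ip f g - \<theta> * ip (R f) g"
      unfolding F_def using f g RH by (simp add: ip_comb)
    then have "\<theta> * (2 * l * ip f g + ip (R f) g) = 0"
      using f(2) by (simp add: algebra_simps)
    then have "2 * l * ip f g = - ip (R f) g" using \<theta> by simp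
    then show ?thesis using ip_rep[OF bm_pslope[OF e f(1)] g] by (simp add: R_def)
  qed
  then show ?thesis using f by auto
qed

text \<open>The variational inequality of \<open>f0\<close> at \<open>f\<close> and the equation of
  \<open>f\<close> tested with \<open>f0 - f\<close> combine to bound \<open>2 * l\<close> times the
  squared distance. The remaining integrand is the defect in
  \<open>slope_almost_subgradient\<close>, at most \<open>2 * c * e\<close>.\<close>

lemma smoothed_solution_close:
  assumes e: "e > 0" and f: "f \<in> H" "\<And>g. g \<in> H \<Longrightarrow> 2 * l * ip f g = - (\<integral>z. pslope e f z * g (\<pi> z) \<partial>N)"
    and f0: "minimizer f0"
  shows "(fun_dist S ip f0 f)\<^sup>2 \<le> c * e * mass / l"
proof -
  let ?u = "comb 1 f0 (-1) f"
  have f0H: "f0 \<in> H" using f0 by (simp add: minimizer_def)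
  have u: "?u \<in> H" by (intro comb_in f f0H)
  have "0 \<le> risk f - risk f0 + 2 * l * ip f0 (comb 1 f (-1) f0)"
    by (rule minimizer_variational[OF f0 f(1)])
  moreover have "2 * l * (fun_dist S ip f0 f)\<^sup>2
      = - (2 * l * ip f0 (comb 1 f (-1) f0)) - 2 * l * ip f ?u"
    using f(1) f0H by (simp add: fun_dist_comb nrm_sq ip_comb ip_sym[of f f0]) (simp add: algebra_simps)
  ultimately have "2 * l * (fun_dist S ip f0 f)\<^sup>2
      \<le> risk f - risk f0 + (\<integral>z. pslope e f z * ?u (\<pi> z) \<partial>N)"
    using f(2)[OF u] by linarith
  also have "\<dots> = (\<integral>z. \<psi> z (f (\<pi> z)) - \<psi> z (f0 (\<pi> z)) + pslope e f z * ?u (\<pi> z) \<partial>N)"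
    unfolding risk_diff[OF f(1) f0H]
    by (intro Bochner_Integration.integral_add[symmetric] bm_integrable bm_loss_diff bm_mult bm_pslope bm_H f0H f(1) e u)
  also have "\<dots> \<le> (\<integral>z. 2 * c * e \<partial>N)"
  proof (rule integral_mono)
    fix z assume z: "z \<in> space N"
    show "\<psi> z (f (\<pi> z)) - \<psi> z (f0 (\<pi> z)) + pslope e f z * ?u (\<pi> z) \<le> 2 * c * e"
      using slope_almost_subgradient[OF \<psi>_convex[OF z] \<psi>_lip[OF z] e, of "f (\<pi> z)" "f0 (\<pi> z)"]
      by (simp add: comb_apply \<pi>_in[OF z] pslope_def)
  next
    show "integrable N (\<lambda>z. \<psi> z (f (\<pi> z)) - \<psi> z (f0 (\<pi> z)) + pslope e f z * ?u (\<pi> z))"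
      by (rule Bochner_Integration.integrable_add;
          intro bm_integrable bm_loss_diff bm_mult bm_pslope bm_H f0H f(1) e u)
  qed simp
  finally show ?thesis using l_pos by (simp add: field_simps)
qed

end

section \<open>Total variation and comparison of two solutions\<close>

lemma tv_norm_upper:
  assumes "finite_measure Q1" "finite_measure Q2" "sets Q1 = sets Q2"
    and \<E>: "finite \<E>" "\<E> \<subseteq> sets Q1" "partition_on (space Q1) \<E>"
  shows "(\<Sum>E\<in>\<E>. \<bar>measure Q1 E - measure Q2 E\<bar>) \<le> tv_norm Q1 (\<lambda>E. measure Q1 E - measure Q2 E)"
proof -
  interpret A: finite_measure Q1 by fact
  interpret B: finite_measure Q2 by fact
  have sp: "space Q1 = space Q2" using assms(3) by (rule sets_eq_imp_space_eq)
  \<comment> \<open>A real \<open>Sup\<close> bounds its elements only for a bounded set; the two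
    total masses provide the bound.\<close>
  have bound: "(\<Sum>E\<in>\<F>. \<bar>measure Q1 E - measure Q2 E\<bar>) \<le> measure Q1 (space Q1) + measure Q2 (space Q2)"
    if \<F>: "finite \<F>" "\<F> \<subseteq> sets Q1" "partition_on (space Q1) \<F>" for \<F>
  proof -
    have dis: "disjoint_family_on (\<lambda>E. E) \<F>" and un: "\<Union>\<F> = space Q1"
      using \<F>(3) by (auto simp: partition_on_def disjoint_def disjoint_family_on_def)
    have "(\<Sum>E\<in>\<F>. \<bar>measure Q1 E - measure Q2 E\<bar>) \<le> (\<Sum>E\<in>\<F>. measure Q1 E + measure Q2 E)"
      by (intro sum_mono) (simp add: abs_le_iff)
    also have "\<dots> = measure Q1 (\<Union>\<F>) + measure Q2 (\<Union>\<F>)"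
      using A.finite_measure_finite_Union[OF \<F>(1) _ dis] B.finite_measure_finite_Union[OF \<F>(1) _ dis]
        \<F>(2) assms(3)
      by (simp add: sum.distrib)
    finally show ?thesis by (simp add: un sp)
  qed
  show ?thesis
    unfolding tv_norm_def
  proof (rule cSup_upper)
    show "bdd_above {\<Sum>E\<in>\<E>. \<bar>measure Q1 E - measure Q2 E\<bar> |\<E>.
        finite \<E> \<and> \<E> \<subseteq> sets Q1 \<and> partition_on (space Q1) \<E>}"
      using bound by (intro bdd_aboveI) blast
  qed (use \<E> in blast)
qed

lemma tv_norm_nonneg:
  assumes "finite_measure Q1" "finite_measure Q2" "sets Q1 = sets Q2" "space Q1 \<noteq> {}"
  shows "0 \<le> tv_norm Q1 (\<lambda>E. measure Q1 E - measure Q2 E)"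
proof -
  have "partition_on (space Q1) {space Q1}"
    using assms(4) by (auto simp: partition_on_def disjoint_def)
  from tv_norm_upper[OF assms(1-3) _ _ this] show ?thesis
    using order_trans[OF abs_ge_zero] by simp
qed

text \<open>The level sets of \<open>s\<close> form a finite measurable partition, and the
  difference of the integrals is a sum over it with coefficients of size at most
  \<open>M\<close>.\<close>

lemma integral_diff_le_tv_simple:
  fixes s :: "'a \<Rightarrow> real"
  assumes Q: "finite_measure Q1" "finite_measure Q2" "sets Q1 = sets Q2"
    and s: "simple_function Q1 s" "\<And>x. x \<in> space Q1 \<Longrightarrow> \<bar>s x\<bar> \<le> M" and M: "0 \<le> M"
  shows "\<bar>(\<integral>x. s x \<partial>Q1) - (\<integral>x. s x \<partial>Q2)\<bar> \<le> M * tv_norm Q1 (\<lambda>E. measure Q1 E - measure Q2 E)"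
proof -
  interpret A: finite_measure Q1 by fact
  interpret B: finite_measure Q2 by fact
  have sp: "space Q1 = space Q2" using Q(3) by (rule sets_eq_imp_space_eq)
  define V where "V = s ` space Q1"
  define E where "E y = {x \<in> space Q1. s x = y}" for y
  have fin: "finite V" using s(1) by (simp add: V_def simple_function_def)
  have s2: "simple_function Q2 s" using s(1) Q(3) sp by (simp add: simple_function_def)
  have E_meas: "E y \<in> sets Q1" for y
    using simple_functionD(2)[OF s(1), of "{y}"] by (simp add: E_def vimage_def Int_def conj_commute)
  have i1: "(\<integral>x. s x \<partial>Q1) = (\<Sum>y\<in>V. measure Q1 (E y) * y)"
    by (subst simple_bochner_integrable_eq_integral[symmetric])
       (auto simp: simple_bochner_integrable.simps s(1) simple_bochner_integral_def V_def E_def)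
  have i2: "(\<integral>x. s x \<partial>Q2) = (\<Sum>y\<in>V. measure Q2 (E y) * y)"
    by (subst simple_bochner_integrable_eq_integral[symmetric])
       (auto simp: simple_bochner_integrable.simps s2 simple_bochner_integral_def V_def E_def sp)
  \<comment> \<open>\<open>V\<close> contains attained values only, so the level sets are nonempty
    and distinct values give distinct sets.\<close>
  have inj: "inj_on E V"
    by (auto simp: inj_on_def E_def V_def)
  have "\<bar>(\<integral>x. s x \<partial>Q1) - (\<integral>x. s x \<partial>Q2)\<bar> = \<bar>\<Sum>y\<in>V. (measure Q1 (E y) - measure Q2 (E y)) * y\<bar>"
    by (simp add: i1 i2 sum_subtractf left_diff_distrib)
  also have "\<dots> \<le> (\<Sum>y\<in>V. \<bar>(measure Q1 (E y) - measure Q2 (E y)) * y\<bar>)" by (rule sum_abs)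
  also have "\<dots> \<le> (\<Sum>y\<in>V. M * \<bar>measure Q1 (E y) - measure Q2 (E y)\<bar>)"
  proof (rule sum_mono)
    fix y assume "y \<in> V"
    then have "\<bar>y\<bar> \<le> M" using s(2) by (auto simp: V_def)
    then show "\<bar>(measure Q1 (E y) - measure Q2 (E y)) * y\<bar> \<le> M * \<bar>measure Q1 (E y) - measure Q2 (E y)\<bar>"
      by (simp add: abs_mult mult.commute mult_right_mono)
  qed
  also have "\<dots> = M * (\<Sum>F\<in>E ` V. \<bar>measure Q1 F - measure Q2 F\<bar>)"
    by (simp add: sum.reindex[OF inj] sum_distrib_left)
  also have "\<dots> \<le> M * tv_norm Q1 (\<lambda>E. measure Q1 E - measure Q2 E)"
  proof (intro mult_left_mono tv_norm_upper Q M)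
    show "partition_on (space Q1) (E ` V)"
      by (auto simp: partition_on_def disjoint_def E_def V_def)
  qed (use fin E_meas in auto)
  finally show ?thesis .
qed

text \<open>\<open>g\<close> is rounded down to multiples of \<open>d\<close>; boundedness leaves
  finitely many values. Rounding costs \<open>d\<close> times the two masses and raises the bound
  \<open>M\<close> by \<open>d\<close>, and \<open>d\<close> tends to 0.\<close>

lemma integral_diff_le_tv:
  fixes g :: "'a \<Rightarrow> real"
  assumes Q: "finite_measure Q1" "finite_measure Q2" "sets Q1 = sets Q2"
    and g: "g \<in> borel_measurable Q1" "\<And>x. x \<in> space Q1 \<Longrightarrow> \<bar>g x\<bar> \<le> M" and M: "0 \<le> M"
  shows "\<bar>(\<integral>x. g x \<partial>Q1) - (\<integral>x. g x \<partial>Q2)\<bar> \<le> M * tv_norm Q1 (\<lambda>E. measure Q1 E - measure Q2 E)"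
proof -
  interpret A: finite_measure Q1 by fact
  interpret B: finite_measure Q2 by fact
  have sp: "space Q1 = space Q2" using Q(3) by (rule sets_eq_imp_space_eq)
  have g2: "g \<in> borel_measurable Q2" using g(1) measurable_cong_sets[OF Q(3) refl] by blast
  let ?tv = "tv_norm Q1 (\<lambda>E. measure Q1 E - measure Q2 E)"
  let ?m = "measure Q1 (space Q1) + measure Q2 (space Q2)"
  have step: "0 \<le> (M * ?tv - \<bar>(\<integral>x. g x \<partial>Q1) - (\<integral>x. g x \<partial>Q2)\<bar>) + d * (?tv + ?m)" if d: "0 < d" for d
  proof -
    define s where "s x = d * real_of_int \<lfloor>g x / d\<rfloor>" for x
    have sg: "\<bar>s x - g x\<bar> \<le> d" for x
    proof -
      have "d * (real_of_int \<lfloor>g x / d\<rfloor>) \<le> d * (g x / d)" "d * (g x / d) \<le> d * (real_of_int \<lfloor>g x / d\<rfloor> + 1)"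
        using d by (intro mult_left_mono; linarith)+
      then show ?thesis using d by (simp add: s_def abs_le_iff algebra_simps)
    qed
    have s_bd: "\<bar>s x\<bar> \<le> M + d" if "x \<in> space Q1" for x
      using sg[of x] g(2)[OF that] by linarith
    have s_meas: "s \<in> borel_measurable Q1" "s \<in> borel_measurable Q2"
      unfolding s_def using g(1) g2 by measurable
    have "simple_function Q1 s"
    proof (rule simple_function_borel_measurable[OF s_meas(1)])
      have "s ` space Q1 \<subseteq> (\<lambda>j. d * real_of_int j) ` {\<lfloor>- M / d\<rfloor>..\<lfloor>M / d\<rfloor>}"
      proof
        fix y assume "y \<in> s ` space Q1"
        then obtain x where x: "x \<in> space Q1" "y = s x" by auto
        have "- M \<le> g x" "g x \<le> M" using g(2)[OF x(1)] by auto
        then have "- M / d \<le> g x / d" "g x / d \<le> M / d"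
          using d by (blast intro: divide_right_mono less_imp_le)+
        then have "\<lfloor>g x / d\<rfloor> \<in> {\<lfloor>- M / d\<rfloor>..\<lfloor>M / d\<rfloor>}" by (auto intro: floor_mono)
        then show "y \<in> (\<lambda>j. d * real_of_int j) ` {\<lfloor>- M / d\<rfloor>..\<lfloor>M / d\<rfloor>}"
          unfolding x(2) s_def by blast
      qed
      then show "finite (s ` space Q1)" by (rule finite_subset) simp
    qed
    then have s_tv: "\<bar>(\<integral>x. s x \<partial>Q1) - (\<integral>x. s x \<partial>Q2)\<bar> \<le> (M + d) * ?tv"
      using s_bd M d by (intro integral_diff_le_tv_simple Q) auto
    have approx: "\<bar>(\<integral>x. s x \<partial>Q) - (\<integral>x. g x \<partial>Q)\<bar> \<le> d * measure Q (space Q)"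
      if "finite_measure Q" "space Q = space Q1" and m: "s \<in> borel_measurable Q" "g \<in> borel_measurable Q" for Q
    proof -
      interpret C: finite_measure Q by fact
      have int: "integrable Q s" "integrable Q g"
      proof -
        show "integrable Q s"
          by (rule C.integrable_const_bound[where B="M + d"]) (use s_bd m that(2) in \<open>auto intro!: AE_I2\<close>)
        show "integrable Q g"
          by (rule C.integrable_const_bound[where B=M]) (use g(2) m that(2) in \<open>auto intro!: AE_I2\<close>)
      qed
      have "\<bar>\<integral>x. s x - g x \<partial>Q\<bar> \<le> (\<integral>x. \<bar>s x - g x\<bar> \<partial>Q)" by (rule integral_abs_bound)
      also have "\<dots> \<le> (\<integral>x. d \<partial>Q)" using int sg by (intro integral_mono) auto
      finally show ?thesis using int by (simp add: mult.commute)
    qed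
    show ?thesis
      using s_tv approx[OF Q(1) refl s_meas(1) g(1)] approx[OF Q(2) sp[symmetric] s_meas(2) g2]
      by (simp add: algebra_simps)
  qed
  have "0 \<le> M * ?tv - \<bar>(\<integral>x. g x \<partial>Q1) - (\<integral>x. g x \<partial>Q2)\<bar>"
    by (rule nonneg_of_small_steps, rule step)
  then show ?thesis by simp
qed

text \<open>Each variational inequality is tested at the other minimizer. In the sum the risks
  combine to the integral of one function, the loss difference, under \<open>N2\<close> and
  \<open>N1\<close>. That function is bounded by a multiple of the RKHS norm of
  \<open>f1 - f2\<close>, so one power of the norm cancels.\<close>

lemma svm_measure_stability:
  assumes p1: "svm_problem S k H ip K N1 \<pi> \<psi> c l" and p2: "svm_problem S k H ip K N2 \<pi> \<psi> c l"
    and N: "sets N1 = sets N2" "space N1 \<noteq> {}"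
    and f1: "svm_problem.minimizer H ip N1 \<pi> \<psi> l f1"
    and f2: "svm_problem.minimizer H ip N2 \<pi> \<psi> l f2"
    and x: "x \<in> S"
  shows "\<bar>f1 x - f2 x\<bar> \<le> c * (K\<^sup>2 / l) * tv_norm N1 (\<lambda>E. measure N1 E - measure N2 E)"
proof -
  interpret A: svm_problem S k H ip K N1 \<pi> \<psi> c l by fact
  interpret B: svm_problem S k H ip K N2 \<pi> \<psi> c l by fact
  let ?u = "A.comb 1 f1 (-1) f2"
  let ?tv = "tv_norm N1 (\<lambda>E. measure N1 E - measure N2 E)"
  have H12: "f1 \<in> H" "f2 \<in> H" using f1 f2 by (simp_all add: A.minimizer_def B.minimizer_def)
  have u: "?u \<in> H" by (intro A.comb_in H12)
  have tv: "0 \<le> ?tv"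
    by (rule tv_norm_nonneg[OF A.finite_measure_axioms B.finite_measure_axioms N])
  have "2 * l * (fun_norm ip ?u)\<^sup>2 \<le> A.risk f2 - A.risk f1 + (B.risk f1 - B.risk f2)"
    using A.minimizer_variational[OF f1 H12(2)] B.minimizer_variational[OF f2 H12(1)] H12
    by (simp add: A.nrm_sq A.ip_comb A.ip_sym[of f2 f1] algebra_simps)
  also have "\<dots> = (\<integral>z. \<psi> z (f2 (\<pi> z)) - \<psi> z (f1 (\<pi> z)) \<partial>N1) - (\<integral>z. \<psi> z (f2 (\<pi> z)) - \<psi> z (f1 (\<pi> z)) \<partial>N2)"
    using A.risk_diff[OF H12(2,1)] B.risk_diff[OF H12(2,1)] by simp
  also have "\<dots> \<le> (c * (K * fun_norm ip ?u)) * ?tv"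
  proof (rule order_trans[OF abs_ge_self integral_diff_le_tv])
    show "(\<lambda>z. \<psi> z (f2 (\<pi> z)) - \<psi> z (f1 (\<pi> z))) \<in> borel_measurable N1"
      using A.bm_loss_diff[OF H12(2,1)] by (simp add: A.bm_def)
    fix z assume z: "z \<in> space N1"
    have "\<bar>\<psi> z (f2 (\<pi> z)) - \<psi> z (f1 (\<pi> z))\<bar> \<le> c * \<bar>f1 (\<pi> z) - f2 (\<pi> z)\<bar>"
      using A.\<psi>_lip[OF z, of "f2 (\<pi> z)" "f1 (\<pi> z)"] by (simp add: abs_minus_commute)
    also have "\<dots> \<le> c * (K * fun_norm ip ?u)"
      using A.abs_eval_le[OF u A.\<pi>_in[OF z]] A.\<pi>_in[OF z]
      by (intro mult_left_mono A.c_nonneg) (simp add: A.comb_apply)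
    finally show "\<bar>\<psi> z (f2 (\<pi> z)) - \<psi> z (f1 (\<pi> z))\<bar> \<le> c * (K * fun_norm ip ?u)" .
  qed (use A.finite_measure_axioms B.finite_measure_axioms N A.c_nonneg A.K_nonneg A.nrm_nonneg[OF u] in auto)
  finally have "fun_norm ip ?u * (2 * l * fun_norm ip ?u) \<le> fun_norm ip ?u * (c * K * ?tv)"
    by (simp add: power2_eq_square mult_ac)
  then have le: "2 * l * fun_norm ip ?u \<le> c * K * ?tv"
    using A.nrm_nonneg[OF u] A.c_nonneg A.K_nonneg tv
    by (cases "fun_norm ip ?u = 0") (simp_all add: mult_le_cancel_left)
  \<comment> \<open>The bound \<open>le\<close> is sharper by a factor 2, which is given up
    here.\<close>
  have "0 \<le> l * fun_norm ip ?u" using A.l_pos A.nrm_nonneg[OF u] by simp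
  then have "l * fun_norm ip ?u \<le> c * K * ?tv" using le by linarith
  then have "K * (l * fun_norm ip ?u) \<le> K * (c * K * ?tv)" by (intro mult_left_mono A.K_nonneg)
  then have "K * fun_norm ip ?u \<le> c * (K\<^sup>2 / l) * ?tv"
    using A.l_pos by (simp add: field_simps power2_eq_square)
  then show ?thesis using A.abs_eval_le[OF u x] x by (simp add: A.comb_apply)
qed

lemma le_of_quadratic_bound:
  fixes E a b :: real
  assumes "E\<^sup>2 \<le> a * E + b" "0 \<le> a" "0 \<le> b" "0 \<le> E"
  shows "E \<le> a + sqrt b"
proof (rule ccontr)
  assume "\<not> E \<le> a + sqrt b"
  then have "sqrt b < E - a" "sqrt b < E" using assms(2) by auto
  then have "sqrt b * sqrt b < (E - a) * E"
    by (intro mult_strict_mono') (use assms in auto)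
  then show False using assms by (simp add: power2_eq_square algebra_simps)
qed

text \<open>Only the difference of the two kernels is estimated in the \<open>L\<^sub>1\<close> norm; the part of the defect that comes
  from different regularization is a multiple of the norm \<open>E\<close> of the representer of \<open>h\<^sub>1 - h\<^sub>2\<close>,
  which keeps the final bound linear in \<open>\<bar>1 / \<mu>\<^sub>1 - 1 / \<mu>\<^sub>2\<bar>\<close>.\<close>

lemma kernel_comparison:
  fixes N :: "'z measure" and u1 u2 h1 h2 r1 r2 :: "'z \<Rightarrow> real"
  assumes A: "rkhs_measure S1 k1 H1 ip1 K N \<pi>" and B: "rkhs_measure S2 k2 H2 ip2 K N \<pi>"
    and h1: "h1 \<in> borel_measurable N" "\<And>z. z \<in> space N \<Longrightarrow> \<bar>h1 z\<bar> \<le> c"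
    and h2: "h2 \<in> borel_measurable N" "\<And>z. z \<in> space N \<Longrightarrow> \<bar>h2 z\<bar> \<le> c"
    and c: "0 \<le> c" and \<mu>: "0 < \<mu>1" "0 < \<mu>2" and R: "0 \<le> R1" "0 \<le> R2"
    and u1: "\<And>z. z \<in> space N \<Longrightarrow> \<mu>1 * u1 z = - (\<integral>z'. h1 z' * k1 (\<pi> z') (\<pi> z) \<partial>N) - r1 z"
    and u2: "\<And>z. z \<in> space N \<Longrightarrow> \<mu>2 * u2 z = - (\<integral>z'. h2 z' * k2 (\<pi> z') (\<pi> z) \<partial>N) - r2 z"
    and r1: "\<And>z. z \<in> space N \<Longrightarrow> \<bar>r1 z\<bar> \<le> R1" and r2: "\<And>z. z \<in> space N \<Longrightarrow> \<bar>r2 z\<bar> \<le> R2"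
    and mono: "\<And>z. z \<in> space N \<Longrightarrow> 0 \<le> (h1 z - h2 z) * (u1 z - u2 z)"
  defines "p \<equiv> measure N (space N)"
    and "D \<equiv> \<integral>z. (\<integral>z'. \<bar>k1 (\<pi> z') (\<pi> z) - k2 (\<pi> z') (\<pi> z)\<bar> \<partial>N) \<partial>N"
  shows "(\<integral>z. \<bar>u1 z - u2 z\<bar> \<partial>N) \<le> 2 * c * K\<^sup>2 * p\<^sup>2 * \<bar>1 / \<mu>1 - 1 / \<mu>2\<bar> + c * D / \<mu>2 + p * (R1 / \<mu>1 + R2 / \<mu>2)
    + K * p / \<mu>1 * sqrt (\<mu>1 * (2 * c\<^sup>2 * D / \<mu>2 + 2 * c * p * (R1 / \<mu>1 + R2 / \<mu>2)))"
proof -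
  interpret A: rkhs_measure S1 k1 H1 ip1 K N \<pi> by fact
  interpret B: rkhs_measure S2 k2 H2 ip2 K N \<pi> by fact
  define w where "w z = h1 z - h2 z" for z
  have bm1: "A.bm h1" and bm2: "A.bm h2" using h1 h2 by (auto intro: A.bm_I)
  have bmw: "A.bm w" unfolding w_def using bm1 bm2 by (rule A.bm_diff)
  have w_le: "\<bar>w z\<bar> \<le> 2 * c" if "z \<in> space N" for z
    using h1(2)[OF that] h2(2)[OF that] by (simp add: w_def)
  \<comment> \<open>With K_i the i-th kernel operator, \<open>G\<close> is K_1 w and
    \<open>G2\<close> is K_1 h_2. The splitting behind the proof is K_1 h_1 / mu_1 - K_2 h_2 / mu_2
    = K_1 w / mu_1 + t K_1 h_2 + (K_1 - K_2) h_2 / mu_2; only the last term involves the second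
    kernel.\<close>
  define G where "G = A.rep w"
  define G2 where "G2 = A.rep h2"
  define E where "E = A.nrm G"
  define \<delta> where "\<delta> z = (\<integral>z'. \<bar>k1 (\<pi> z') (\<pi> z) - k2 (\<pi> z') (\<pi> z)\<bar> \<partial>N)" for z
  define t where "t = 1 / \<mu>1 - 1 / \<mu>2"
  define R where "R = R1 / \<mu>1 + R2 / \<mu>2"
  have GH: "G \<in> H1" and G2H: "G2 \<in> H1" unfolding G_def G2_def by (intro A.rep_in bmw bm2)+
  have E: "0 \<le> E" unfolding E_def by (rule A.nrm_nonneg[OF GH])
  have p: "0 \<le> p" by (simp add: p_def)
  have RR: "0 \<le> R" using R \<mu> by (simp add: R_def)
  have k_meas: "(\<lambda>z'. k1 (\<pi> z') (\<pi> z)) \<in> borel_measurable N" "(\<lambda>z'. k2 (\<pi> z') (\<pi> z)) \<in> borel_measurable N"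
    if "z \<in> space N" for z
    using that A.\<pi>_in B.\<pi>_in
    by (auto intro!: A.k_measurable_pair B.k_measurable_pair A.\<pi>_meas B.\<pi>_meas simp: space_restrict_space)
  have bmk: "A.bm (\<lambda>z'. k1 (\<pi> z') (\<pi> z))" "A.bm (\<lambda>z'. k2 (\<pi> z') (\<pi> z))" if "z \<in> space N" for z
    using that k_meas A.\<pi>_in B.\<pi>_in by (auto intro!: A.bm_I A.abs_k_le B.abs_k_le)
  have \<delta>_meas: "\<delta> \<in> borel_measurable N"
  proof -
    have "(\<lambda>(z, z'). \<bar>k1 (\<pi> z') (\<pi> z) - k2 (\<pi> z') (\<pi> z)\<bar>) \<in> borel_measurable (N \<Otimes>\<^sub>M N)"
      unfolding case_prod_beta
      by (intro borel_measurable_abs borel_measurable_diff A.k_measurable_pair B.k_measurable_pair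
          measurable_compose[OF measurable_snd A.\<pi>_meas] measurable_compose[OF measurable_fst A.\<pi>_meas]
          measurable_compose[OF measurable_snd B.\<pi>_meas] measurable_compose[OF measurable_fst B.\<pi>_meas])
    from A.borel_measurable_lebesgue_integral[OF this] show ?thesis by (simp add: \<delta>_def[abs_def])
  qed
  have \<delta>_nonneg: "0 \<le> \<delta> z" for z unfolding \<delta>_def by simp
  have \<delta>_int: "integrable N \<delta>"
  proof (rule A.integrable_bounded[OF \<delta>_meas])
    fix z assume z: "z \<in> space N"
    show "\<bar>\<delta> z\<bar> \<le> (2 * K\<^sup>2) * p"
      unfolding \<delta>_def p_def
    proof (rule A.abs_integral_le)
      fix z' assume z': "z' \<in> space N"
      show "\<bar>\<bar>k1 (\<pi> z') (\<pi> z) - k2 (\<pi> z') (\<pi> z)\<bar>\<bar> \<le> 2 * K\<^sup>2"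
        using A.abs_k_le[OF A.\<pi>_in[OF z'] A.\<pi>_in[OF z]] B.abs_k_le[OF B.\<pi>_in[OF z'] B.\<pi>_in[OF z]] by simp
    qed simp
  qed
  have D: "D = (\<integral>z. \<delta> z \<partial>N)" by (simp add: D_def \<delta>_def)
  then have D_nonneg: "0 \<le> D" by (simp add: \<delta>_nonneg)
  have decomp: "\<bar>u1 z - u2 z + (1 / \<mu>1) * G (\<pi> z) + t * G2 (\<pi> z)\<bar> \<le> c / \<mu>2 * \<delta> z + R" if z: "z \<in> space N" for z
  proof -
    define I where "I = (\<integral>z'. h2 z' * k2 (\<pi> z') (\<pi> z) \<partial>N)"
    have G_val: "G (\<pi> z) = (\<integral>z'. h1 z' * k1 (\<pi> z') (\<pi> z) \<partial>N) - G2 (\<pi> z)"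
    proof -
      have "G (\<pi> z) = (\<integral>z'. w z' * k1 (\<pi> z') (\<pi> z) \<partial>N)"
        unfolding G_def by (rule A.rep_apply[OF bmw A.\<pi>_in[OF z]])
      also have "\<dots> = (\<integral>z'. h1 z' * k1 (\<pi> z') (\<pi> z) \<partial>N) - (\<integral>z'. h2 z' * k1 (\<pi> z') (\<pi> z) \<partial>N)"
        unfolding w_def left_diff_distrib
        by (intro Bochner_Integration.integral_diff A.bm_integrable A.bm_mult bm1 bm2 bmk z)
      also have "(\<integral>z'. h2 z' * k1 (\<pi> z') (\<pi> z) \<partial>N) = G2 (\<pi> z)"
        unfolding G2_def by (rule A.rep_apply[OF bm2 A.\<pi>_in[OF z], symmetric])
      finally show ?thesis .
    qed
    have "I - G2 (\<pi> z) = (\<integral>z'. h2 z' * k2 (\<pi> z') (\<pi> z) - h2 z' * k1 (\<pi> z') (\<pi> z) \<partial>N)"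
      unfolding G2_def A.rep_apply[OF bm2 A.\<pi>_in[OF z]] I_def
      by (intro Bochner_Integration.integral_diff[symmetric] A.bm_integrable A.bm_mult bm2 bmk z)
    also have "\<bar>\<dots>\<bar> \<le> (\<integral>z'. \<bar>h2 z' * k2 (\<pi> z') (\<pi> z) - h2 z' * k1 (\<pi> z') (\<pi> z)\<bar> \<partial>N)"
      by (rule integral_abs_bound)
    also have "\<dots> \<le> (\<integral>z'. c * \<bar>k1 (\<pi> z') (\<pi> z) - k2 (\<pi> z') (\<pi> z)\<bar> \<partial>N)"
    proof (rule integral_mono)
      fix z' assume z': "z' \<in> space N"
      have "\<bar>h2 z' * k2 (\<pi> z') (\<pi> z) - h2 z' * k1 (\<pi> z') (\<pi> z)\<bar> = \<bar>h2 z'\<bar> * \<bar>k1 (\<pi> z') (\<pi> z) - k2 (\<pi> z') (\<pi> z)\<bar>"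
        by (simp only: abs_mult[symmetric] right_diff_distrib abs_minus_commute[of "h2 z' * k2 (\<pi> z') (\<pi> z)"])
      then show "\<bar>h2 z' * k2 (\<pi> z') (\<pi> z) - h2 z' * k1 (\<pi> z') (\<pi> z)\<bar> \<le> c * \<bar>k1 (\<pi> z') (\<pi> z) - k2 (\<pi> z') (\<pi> z)\<bar>"
        using h2(2)[OF z'] by (simp add: mult_right_mono)
    qed (intro integrable_mult_right integrable_abs A.bm_integrable A.bm_diff A.bm_mult bm2 bmk z)+
    finally have I: "\<bar>I - G2 (\<pi> z)\<bar> \<le> c * \<delta> z" by (simp add: \<delta>_def)
    have "u1 z = - (1 / \<mu>1) * (G (\<pi> z) + G2 (\<pi> z)) - r1 z / \<mu>1"
      using u1[OF z] G_val \<mu> by (simp add: field_simps)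
    moreover have "u2 z = - (1 / \<mu>2) * I - r2 z / \<mu>2"
      using u2[OF z] \<mu> by (simp add: field_simps I_def)
    ultimately have "u1 z - u2 z + (1 / \<mu>1) * G (\<pi> z) + t * G2 (\<pi> z)
        = (1 / \<mu>2) * (I - G2 (\<pi> z)) - r1 z / \<mu>1 + r2 z / \<mu>2"
      by (simp add: t_def algebra_simps)
    moreover have "\<bar>(1 / \<mu>2) * (I - G2 (\<pi> z))\<bar> \<le> (1 / \<mu>2) * (c * \<delta> z)"
      using I \<mu> unfolding abs_mult by (intro mult_mono) auto
    moreover have "\<bar>r1 z / \<mu>1\<bar> \<le> R1 / \<mu>1" "\<bar>r2 z / \<mu>2\<bar> \<le> R2 / \<mu>2"
      using r1[OF z] r2[OF z] \<mu> by (simp_all add: abs_divide divide_right_mono)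
    moreover have "(1 / \<mu>2) * (c * \<delta> z) = c / \<mu>2 * \<delta> z" by simp
    ultimately show ?thesis unfolding R_def by linarith
  qed
  have G2_le: "A.nrm G2 \<le> c * K * p"
    unfolding G2_def p_def by (rule A.nrm_rep_le[OF bm2 h2(2) c])
  \<comment> \<open>The decomposition is multiplied by \<open>w\<close> and integrated. The product
    of \<open>w\<close> with \<open>u1 - u2\<close> is nonnegative by \<open>mono\<close>, so
    \<open>E\<^sup>2 / \<mu>1\<close> is bounded by the other terms; the factors
    \<open>2 * c\<close> come from the bound on \<open>w\<close>.\<close>
  have energy: "E\<^sup>2 \<le> (\<mu>1 * \<bar>t\<bar> * (c * K * p)) * E + \<mu>1 * (2 * c\<^sup>2 * D / \<mu>2 + 2 * c * p * R)"
  proof -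
    have "0 \<le> (\<integral>z. - (1 / \<mu>1) * (w z * G (\<pi> z)) - t * (w z * G2 (\<pi> z)) + 2 * c * (c / \<mu>2) * \<delta> z + 2 * c * R \<partial>N)"
    proof (rule Bochner_Integration.integral_nonneg)
      fix z assume z: "z \<in> space N"
      let ?d = "u1 z - u2 z + (1 / \<mu>1) * G (\<pi> z) + t * G2 (\<pi> z)"
      have "w z * ?d \<le> \<bar>w z\<bar> * \<bar>?d\<bar>" by (rule order_trans[OF abs_ge_self]) (simp only: abs_mult order_refl)
      also have "\<dots> \<le> (2 * c) * (c / \<mu>2 * \<delta> z + R)"
        using w_le[OF z] decomp[OF z] c by (intro mult_mono) auto
      finally have "w z * ?d \<le> (2 * c) * (c / \<mu>2 * \<delta> z + R)" .
      moreover have "0 \<le> w z * (u1 z - u2 z)" using mono[OF z] by (simp add: w_def)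
      ultimately show "0 \<le> - (1 / \<mu>1) * (w z * G (\<pi> z)) - t * (w z * G2 (\<pi> z)) + 2 * c * (c / \<mu>2) * \<delta> z + 2 * c * R"
        by (simp add: algebra_simps)
    qed
    also have "\<dots> = - (1 / \<mu>1) * (\<integral>z. w z * G (\<pi> z) \<partial>N) - t * (\<integral>z. w z * G2 (\<pi> z) \<partial>N)
        + 2 * c * (c / \<mu>2) * D + 2 * c * R * p"
      unfolding D p_def
      by (simp add: A.bm_integrable A.bm_mult bmw A.bm_H GH G2H \<delta>_int mult.commute[of "2 * c * R"])
    also have "(\<integral>z. w z * G (\<pi> z) \<partial>N) = E\<^sup>2"
      unfolding E_def A.nrm_sq[OF GH] using A.ip_rep[OF bmw GH] by (simp add: G_def)
    also have "(\<integral>z. w z * G2 (\<pi> z) \<partial>N) = ip1 G G2"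
      using A.ip_rep[OF bmw G2H] by (simp add: G_def)
    finally have "(1 / \<mu>1) * E\<^sup>2 \<le> - t * ip1 G G2 + 2 * c * (c / \<mu>2) * D + 2 * c * R * p" by simp
    moreover have "- t * ip1 G G2 \<le> \<bar>t\<bar> * (E * (c * K * p))"
    proof -
      have "- t * ip1 G G2 \<le> \<bar>t\<bar> * \<bar>ip1 G G2\<bar>" by (rule order_trans[OF abs_ge_self]) (simp add: abs_mult)
      also have "\<dots> \<le> \<bar>t\<bar> * (E * A.nrm G2)"
        unfolding E_def by (intro mult_left_mono A.cauchy_schwarz GH G2H) simp
      also have "\<dots> \<le> \<bar>t\<bar> * (E * (c * K * p))" by (intro mult_left_mono G2_le E) simp
      finally show ?thesis .
    qed
    ultimately have "(1 / \<mu>1) * E\<^sup>2 \<le> \<bar>t\<bar> * (E * (c * K * p)) + 2 * c * (c / \<mu>2) * D + 2 * c * R * p" by linarith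
    then have "\<mu>1 * ((1 / \<mu>1) * E\<^sup>2) \<le> \<mu>1 * (\<bar>t\<bar> * (E * (c * K * p)) + 2 * c * (c / \<mu>2) * D + 2 * c * R * p)"
      using \<mu> by (intro mult_left_mono) auto
    then show ?thesis using \<mu> by (simp add: algebra_simps power2_eq_square)
  qed
  define Z where "Z = sqrt (\<mu>1 * (2 * c\<^sup>2 * D / \<mu>2 + 2 * c * p * R))"
  have E_le: "E \<le> \<mu>1 * \<bar>t\<bar> * (c * K * p) + Z"
    unfolding Z_def using \<mu> c p RR D_nonneg A.K_nonneg E
    by (intro le_of_quadratic_bound[OF energy]) auto
  \<comment> \<open>Evaluation in the first RKHS turns the energy into a uniform bound for
    \<open>G\<close>; in the resulting majorant only \<open>\<delta>\<close> varies with the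
    point.\<close>
  have "(\<integral>z. \<bar>u1 z - u2 z\<bar> \<partial>N) \<le> (\<integral>z. (1 / \<mu>1) * (K * E) + \<bar>t\<bar> * (K * (c * K * p)) + R + c / \<mu>2 * \<delta> z \<partial>N)"
  proof (rule integral_mono')
    show "integrable N (\<lambda>z. (1 / \<mu>1) * (K * E) + \<bar>t\<bar> * (K * (c * K * p)) + R + c / \<mu>2 * \<delta> z)"
      using \<delta>_int by simp
    fix z assume z: "z \<in> space N"
    have "\<bar>G (\<pi> z)\<bar> \<le> K * E" unfolding E_def by (rule A.abs_eval_le[OF GH A.\<pi>_in[OF z]])
    then have "\<bar>(1 / \<mu>1) * G (\<pi> z)\<bar> \<le> (1 / \<mu>1) * (K * E)"
      unfolding abs_mult using \<mu> by (intro mult_mono) auto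
    moreover have "\<bar>G2 (\<pi> z)\<bar> \<le> K * (c * K * p)"
      using A.abs_eval_le[OF G2H A.\<pi>_in[OF z]] mult_left_mono[OF G2_le A.K_nonneg] by linarith
    then have "\<bar>t * G2 (\<pi> z)\<bar> \<le> \<bar>t\<bar> * (K * (c * K * p))"
      unfolding abs_mult by (intro mult_left_mono) auto
    ultimately show "\<bar>u1 z - u2 z\<bar> \<le> (1 / \<mu>1) * (K * E) + \<bar>t\<bar> * (K * (c * K * p)) + R + c / \<mu>2 * \<delta> z"
      using decomp[OF z] by linarith
    then show "0 \<le> (1 / \<mu>1) * (K * E) + \<bar>t\<bar> * (K * (c * K * p)) + R + c / \<mu>2 * \<delta> z" by linarith
  qed
  also have "\<dots> = p * ((1 / \<mu>1) * (K * E) + \<bar>t\<bar> * (K * (c * K * p)) + R) + c / \<mu>2 * D"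
    unfolding D p_def using \<delta>_int by (subst Bochner_Integration.integral_add) auto
  also have "\<dots> \<le> p * ((1 / \<mu>1) * (K * (\<mu>1 * \<bar>t\<bar> * (c * K * p) + Z)) + \<bar>t\<bar> * (K * (c * K * p)) + R) + c / \<mu>2 * D"
    using \<mu> E_le A.K_nonneg by (intro add_right_mono mult_left_mono p) auto
  \<comment> \<open>The term with \<open>\<bar>t\<bar>\<close> occurs twice, once directly and once
    through the bound on \<open>E\<close>; hence the factor 2.\<close>
  also have "\<dots> = 2 * c * K\<^sup>2 * p\<^sup>2 * \<bar>t\<bar> + c * D / \<mu>2 + p * R + K * p / \<mu>1 * Z"
    using \<mu> by (simp add: field_simps power2_eq_square)
  finally show ?thesis by (simp only: Z_def t_def R_def)
qed

section \<open>Arithmetic that turns the comparison into the stated constants\<close>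

lemma mult_sqrt_le:
  fixes a b X Y :: real
  assumes "0 \<le> a" "0 \<le> b" "a\<^sup>2 * X \<le> b\<^sup>2 * Y"
  shows "a * sqrt X \<le> b * sqrt Y"
  using real_sqrt_le_mono[OF assms(3)] assms(1,2) by (simp add: real_sqrt_mult)

text \<open>Writing \<open>p1 * l1 - p2 * l2\<close> as
  \<open>p1 * (l1 - l2) + l2 * (p1 - p2)\<close> separates the change of the parameter from the
  change of the cell mass; the latter becomes the first summand of
  \<open>regionalization_dist\<close>.\<close>

lemma weighted_regularization_diff:
  fixes p p1 p2 l1 l2 \<tau> \<rho> :: real
  assumes p: "0 < p" "p \<le> p1" "p \<le> p2" and l: "0 < \<tau>" "\<tau> \<le> l1" "\<tau> \<le> l2" and \<rho>: "p1 \<le> \<rho>"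
  shows "2 * p\<^sup>2 * \<bar>1 / (2 * l1 * p1) - 1 / (2 * l2 * p2)\<bar>
    \<le> \<rho> / \<tau>\<^sup>2 * \<bar>l1 - l2\<bar> + \<bar>p1 - p2\<bar> / \<tau>"
proof -
  have pos: "0 < p1" "0 < p2" "0 < l1" "0 < l2" using p l by auto
  have "1 / (2 * l1 * p1) - 1 / (2 * l2 * p2) = (p2 * l2 - p1 * l1) / (2 * (l1 * l2) * (p1 * p2))"
    using pos by (simp add: field_simps)
  also have "\<bar>\<dots>\<bar> = \<bar>p1 * l1 - p2 * l2\<bar> / (2 * (l1 * l2) * (p1 * p2))"
    using pos by (simp add: abs_divide abs_mult abs_minus_commute)
  finally have "2 * p\<^sup>2 * \<bar>1 / (2 * l1 * p1) - 1 / (2 * l2 * p2)\<bar>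
      = (p\<^sup>2 / (p1 * p2)) * (\<bar>p1 * l1 - p2 * l2\<bar> / (l1 * l2))"
    by simp
  also have "\<dots> \<le> 1 * (\<bar>p1 * l1 - p2 * l2\<bar> / (l1 * l2))"
  proof (rule mult_right_mono)
    have "p\<^sup>2 \<le> p1 * p2" unfolding power2_eq_square using p by (intro mult_mono) auto
    then show "p\<^sup>2 / (p1 * p2) \<le> 1" using pos by (simp add: divide_le_eq_1)
  qed (use pos in simp)
  also have "\<dots> \<le> (p1 * \<bar>l1 - l2\<bar> + l2 * \<bar>p1 - p2\<bar>) / (l1 * l2)"
  proof -
    have "p1 * l1 - p2 * l2 = p1 * (l1 - l2) + l2 * (p1 - p2)" by (simp add: algebra_simps)
    then have "\<bar>p1 * l1 - p2 * l2\<bar> \<le> p1 * \<bar>l1 - l2\<bar> + l2 * \<bar>p1 - p2\<bar>"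
      using abs_triangle_ineq[of "p1 * (l1 - l2)" "l2 * (p1 - p2)"] pos by (simp add: abs_mult)
    then show ?thesis using pos by (simp add: divide_right_mono)
  qed
  also have "\<dots> = p1 * \<bar>l1 - l2\<bar> / (l1 * l2) + \<bar>p1 - p2\<bar> / l1"
    using pos by (simp add: field_simps)
  also have "\<dots> \<le> \<rho> * \<bar>l1 - l2\<bar> / \<tau>\<^sup>2 + \<bar>p1 - p2\<bar> / \<tau>"
  proof (intro add_mono frac_le mult_right_mono)
    show "\<tau>\<^sup>2 \<le> l1 * l2" unfolding power2_eq_square using l by (intro mult_mono) auto
  qed (use \<rho> pos l in auto)
  finally show ?thesis by simp
qed

text \<open>With \<open>q = p / p1\<close> the quantity \<open>p * (p1 - p) / p1\<close> equals
  \<open>p1 * q * (1 - q)\<close>: the part of the cell outside the intersection is the source of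
  the summand \<open>1 / 2 * q * (1 - q)\<close>.\<close>

lemma cell_remainder_le:
  fixes p p1 \<rho> l1 \<tau> :: real
  assumes p: "0 < p" "p \<le> p1" "p1 \<le> \<rho>" and l: "0 < \<tau>" "\<tau> \<le> l1"
  shows "p * ((p1 - p) / (2 * l1 * p1)) \<le> \<rho> / \<tau> * (1 / 2 * (p / p1) * (1 - p / p1))"
proof -
  have "p * ((p1 - p) / (2 * l1 * p1)) = (p1 / l1) * (1 / 2 * (p / p1) * (1 - p / p1))"
    using p l by (simp add: field_simps)
  also have "\<dots> \<le> (\<rho> / \<tau>) * (1 / 2 * (p / p1) * (1 - p / p1))"
    using p l by (intro mult_right_mono frac_le mult_nonneg_nonneg) auto
  finally show ?thesis .
qed

text \<open>\<open>p\<close> is the mass of the intersection, \<open>p1\<close> and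
  \<open>p2\<close> are those of the cells, and \<open>R1\<close>, \<open>R2\<close> bound what the
  cells contribute outside it. \<open>D\<close> is \<open>p\<^sup>2 * d\<close> because
  \<open>d\<close> refers to normalized measures. Subadditivity splits the root into three, one for
  the kernel distance and one for each remainder.\<close>

lemma comparison_bound_le:
  fixes p p1 p2 l1 l2 c K d :: real
  assumes p: "0 < p" "p \<le> p1" "p \<le> p2" and l: "0 < l1" "0 < l2" and c: "0 \<le> c" and K: "0 \<le> K" and d: "0 \<le> d"
  defines "\<mu>1 \<equiv> 2 * l1 * p1" and "\<mu>2 \<equiv> 2 * l2 * p2"
    and "R1 \<equiv> c * K\<^sup>2 * (p1 - p)" and "R2 \<equiv> c * K\<^sup>2 * (p2 - p)" and "D \<equiv> p\<^sup>2 * d"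
    and "\<tau> \<equiv> min l1 l2" and "\<rho> \<equiv> max p1 p2" and "q1 \<equiv> p / p1" and "q2 \<equiv> p / p2"
  shows "2 * c * K\<^sup>2 * p\<^sup>2 * \<bar>1 / \<mu>1 - 1 / \<mu>2\<bar> + c * D / \<mu>2 + p * (R1 / \<mu>1 + R2 / \<mu>2)
      + K * p / \<mu>1 * sqrt (\<mu>1 * (2 * c\<^sup>2 * D / \<mu>2 + 2 * c * p * (R1 / \<mu>1 + R2 / \<mu>2)))
    \<le> c * (\<rho> * (K\<^sup>2 / \<tau>\<^sup>2) * \<bar>l1 - l2\<bar> + p * (1 / (2 * \<tau>) * d + K / \<tau> * sqrt d)
      + \<rho> * (K\<^sup>2 / \<tau>) * (\<bar>p1 - p2\<bar> / \<rho>
        + ((1 / 2 * q1 * (1 - q1) + sqrt (q1 * (1 - q1))) + (1 / 2 * q2 * (1 - q2) + sqrt (q2 * (1 - q2))))))"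
    (is "?lhs \<le> ?rhs")
proof -
  have pos: "0 < p1" "0 < p2" "0 < \<tau>" "\<tau> \<le> l1" "\<tau> \<le> l2" "0 < \<rho>" "p1 \<le> \<rho>" "p2 \<le> \<rho>" "p \<le> \<rho>"
    using p l by (auto simp: \<tau>_def \<rho>_def)
  have \<mu>: "0 < \<mu>1" "0 < \<mu>2" using pos l by (simp_all add: \<mu>1_def \<mu>2_def)
  have "\<tau>\<^sup>2 \<le> l1 * l2" "\<tau>\<^sup>2 \<le> l1 * l1" unfolding power2_eq_square using pos by (auto intro!: mult_mono)
  moreover have "0 < l1 * l2" "0 < l1 * l1" using l by simp_all
  ultimately have \<tau>2: "\<tau>\<^sup>2 \<le> 2 * (l1 * l2)" "\<tau>\<^sup>2 \<le> 2 * (l1 * l1)" by linarith+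
  have p2: "p\<^sup>2 \<le> p1 * p2" "p\<^sup>2 \<le> \<rho>\<^sup>2" unfolding power2_eq_square using p pos by (auto intro!: mult_mono)
  have R: "0 \<le> R1" "0 \<le> R2" using p c by (simp_all add: R1_def R2_def)
  have t1: "2 * c * K\<^sup>2 * p\<^sup>2 * \<bar>1 / \<mu>1 - 1 / \<mu>2\<bar> \<le> c * (\<rho> * (K\<^sup>2 / \<tau>\<^sup>2) * \<bar>l1 - l2\<bar> + \<rho> * (K\<^sup>2 / \<tau>) * (\<bar>p1 - p2\<bar> / \<rho>))"
  proof -
    have "2 * c * K\<^sup>2 * p\<^sup>2 * \<bar>1 / \<mu>1 - 1 / \<mu>2\<bar> = (c * K\<^sup>2) * (2 * p\<^sup>2 * \<bar>1 / \<mu>1 - 1 / \<mu>2\<bar>)" by simp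
    also have "\<dots> \<le> (c * K\<^sup>2) * (\<rho> / \<tau>\<^sup>2 * \<bar>l1 - l2\<bar> + \<bar>p1 - p2\<bar> / \<tau>)"
      unfolding \<mu>1_def \<mu>2_def using c
      by (intro mult_left_mono weighted_regularization_diff p pos) auto
    also have "\<dots> = c * (\<rho> * (K\<^sup>2 / \<tau>\<^sup>2) * \<bar>l1 - l2\<bar> + \<rho> * (K\<^sup>2 / \<tau>) * (\<bar>p1 - p2\<bar> / \<rho>))"
      using pos by (simp add: field_simps)
    finally show ?thesis .
  qed
  have t2: "c * D / \<mu>2 \<le> c * (p * (1 / (2 * \<tau>) * d))"
  proof -
    have "c * D / \<mu>2 = (c * p * d / 2) * ((p / p2) / l2)"
      using pos l by (simp add: D_def \<mu>2_def power2_eq_square field_simps)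
    also have "\<dots> \<le> (c * p * d / 2) * (1 / \<tau>)"
      using c p d pos by (intro mult_left_mono frac_le) auto
    finally show ?thesis by (simp add: mult_ac)
  qed
  have t3: "p * (R1 / \<mu>1) \<le> c * (\<rho> * (K\<^sup>2 / \<tau>) * (1 / 2 * q1 * (1 - q1)))"
  proof -
    have "p * (R1 / \<mu>1) = (c * K\<^sup>2) * (p * ((p1 - p) / (2 * l1 * p1)))" by (simp add: R1_def \<mu>1_def)
    also have "\<dots> \<le> (c * K\<^sup>2) * (\<rho> / \<tau> * (1 / 2 * q1 * (1 - q1)))"
      unfolding q1_def using c by (intro mult_left_mono cell_remainder_le p pos) auto
    finally show ?thesis by (simp add: mult_ac)
  qed
  have t4: "p * (R2 / \<mu>2) \<le> c * (\<rho> * (K\<^sup>2 / \<tau>) * (1 / 2 * q2 * (1 - q2)))"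
  proof -
    have "p * (R2 / \<mu>2) = (c * K\<^sup>2) * (p * ((p2 - p) / (2 * l2 * p2)))" by (simp add: R2_def \<mu>2_def)
    also have "\<dots> \<le> (c * K\<^sup>2) * (\<rho> / \<tau> * (1 / 2 * q2 * (1 - q2)))"
      unfolding q2_def using c by (intro mult_left_mono cell_remainder_le p pos) auto
    finally show ?thesis by (simp add: mult_ac)
  qed
  define a where "a = K * p / \<mu>1"
  have a: "0 \<le> a" using K p \<mu> by (simp add: a_def)
  have s1: "a * sqrt (\<mu>1 * (2 * c\<^sup>2 * D / \<mu>2)) \<le> (c * (p * (K / \<tau>))) * sqrt d"
  proof (rule mult_sqrt_le[OF a])
    have "a\<^sup>2 * (\<mu>1 * (2 * c\<^sup>2 * D / \<mu>2)) = (c\<^sup>2 * p\<^sup>2 * K\<^sup>2 * d) * (p\<^sup>2 / (p1 * p2) * (1 / (2 * (l1 * l2))))"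
      using pos l by (simp add: a_def \<mu>1_def \<mu>2_def D_def field_simps power2_eq_square)
    also have "\<dots> \<le> (c\<^sup>2 * p\<^sup>2 * K\<^sup>2 * d) * (1 * (1 / \<tau>\<^sup>2))"
      using p2 \<tau>2 pos l d by (intro mult_left_mono mult_mono frac_le) (auto simp: divide_le_eq_1)
    finally show "a\<^sup>2 * (\<mu>1 * (2 * c\<^sup>2 * D / \<mu>2)) \<le> (c * (p * (K / \<tau>)))\<^sup>2 * d"
      by (simp add: power_mult_distrib power_divide mult_ac)
  qed (use c p K pos in simp)
  have s2: "a * sqrt (\<mu>1 * (2 * c * p * (R1 / \<mu>1))) \<le> (c * (\<rho> * (K\<^sup>2 / \<tau>))) * sqrt (q1 * (1 - q1))"
  proof (rule mult_sqrt_le[OF a])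
    have "a\<^sup>2 * (\<mu>1 * (2 * c * p * (R1 / \<mu>1))) = (c\<^sup>2 * K^4 * (q1 * (1 - q1))) * (p\<^sup>2 * (1 / (2 * (l1 * l1))))"
      using pos l by (simp add: a_def \<mu>1_def R1_def q1_def field_simps power2_eq_square power4_eq_xxxx)
    also have "\<dots> \<le> (c\<^sup>2 * K^4 * (q1 * (1 - q1))) * (\<rho>\<^sup>2 * (1 / \<tau>\<^sup>2))"
      using p2 \<tau>2 pos l p by (intro mult_left_mono mult_mono frac_le) (auto simp: q1_def)
    finally show "a\<^sup>2 * (\<mu>1 * (2 * c * p * (R1 / \<mu>1))) \<le> (c * (\<rho> * (K\<^sup>2 / \<tau>)))\<^sup>2 * (q1 * (1 - q1))"
      by (simp add: power_mult_distrib power_divide mult_ac flip: power_mult)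
  qed (use c K pos in simp)
  \<comment> \<open>The energy is taken in the first RKHS, so \<open>\<mu>1\<close> weights the
    second remainder too. The masses group as \<open>p / p1\<close>, at most 1, and
    \<open>p * p2\<close>, at most \<open>\<rho> * \<rho>\<close>, since \<open>p2 / p1\<close>
    alone has no bound.\<close>
  have s3: "a * sqrt (\<mu>1 * (2 * c * p * (R2 / \<mu>2))) \<le> (c * (\<rho> * (K\<^sup>2 / \<tau>))) * sqrt (q2 * (1 - q2))"
  proof (rule mult_sqrt_le[OF a])
    have "a\<^sup>2 * (\<mu>1 * (2 * c * p * (R2 / \<mu>2)))
        = (c\<^sup>2 * K^4 * (q2 * (1 - q2))) * ((p / p1) * (p * p2) * (1 / (2 * (l1 * l2))))"
      using pos l by (simp add: a_def \<mu>1_def \<mu>2_def R2_def q2_def field_simps power2_eq_square power4_eq_xxxx)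
    also have "\<dots> \<le> (c\<^sup>2 * K^4 * (q2 * (1 - q2))) * (1 * (\<rho> * \<rho>) * (1 / \<tau>\<^sup>2))"
      using p2 \<tau>2 pos l p by (intro mult_left_mono mult_mono frac_le) (auto simp: q2_def)
    finally show "a\<^sup>2 * (\<mu>1 * (2 * c * p * (R2 / \<mu>2))) \<le> (c * (\<rho> * (K\<^sup>2 / \<tau>)))\<^sup>2 * (q2 * (1 - q2))"
      by (simp add: power_mult_distrib power_divide mult_ac power2_eq_square[of \<rho>] flip: power_mult)
  qed (use c K pos in simp)
  have "a * sqrt (\<mu>1 * (2 * c\<^sup>2 * D / \<mu>2 + 2 * c * p * (R1 / \<mu>1 + R2 / \<mu>2)))
      = a * sqrt (\<mu>1 * (2 * c\<^sup>2 * D / \<mu>2) + (\<mu>1 * (2 * c * p * (R1 / \<mu>1)) + \<mu>1 * (2 * c * p * (R2 / \<mu>2))))"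
    by (simp add: algebra_simps)
  also have "\<dots> \<le> a * (sqrt (\<mu>1 * (2 * c\<^sup>2 * D / \<mu>2)) + (sqrt (\<mu>1 * (2 * c * p * (R1 / \<mu>1))) + sqrt (\<mu>1 * (2 * c * p * (R2 / \<mu>2)))))"
  proof (rule mult_left_mono[OF _ a])
    have nn: "0 \<le> \<mu>1 * (2 * c\<^sup>2 * D / \<mu>2)" "0 \<le> \<mu>1 * (2 * c * p * (R1 / \<mu>1))" "0 \<le> \<mu>1 * (2 * c * p * (R2 / \<mu>2))"
      using \<mu> c p R d by (simp_all add: D_def)
    show "sqrt (\<mu>1 * (2 * c\<^sup>2 * D / \<mu>2) + (\<mu>1 * (2 * c * p * (R1 / \<mu>1)) + \<mu>1 * (2 * c * p * (R2 / \<mu>2))))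
      \<le> sqrt (\<mu>1 * (2 * c\<^sup>2 * D / \<mu>2)) + (sqrt (\<mu>1 * (2 * c * p * (R1 / \<mu>1))) + sqrt (\<mu>1 * (2 * c * p * (R2 / \<mu>2))))"
      by (rule order_trans[OF sqrt_add_le_add_sqrt[OF nn(1) add_nonneg_nonneg[OF nn(2,3)]]])
        (rule add_left_mono[OF sqrt_add_le_add_sqrt[OF nn(2,3)]])
  qed
  finally have s: "a * sqrt (\<mu>1 * (2 * c\<^sup>2 * D / \<mu>2 + 2 * c * p * (R1 / \<mu>1 + R2 / \<mu>2)))
      \<le> (c * (p * (K / \<tau>))) * sqrt d + ((c * (\<rho> * (K\<^sup>2 / \<tau>))) * sqrt (q1 * (1 - q1)) + (c * (\<rho> * (K\<^sup>2 / \<tau>))) * sqrt (q2 * (1 - q2)))"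
    using s1 s2 s3 unfolding distrib_left by linarith
  have "?lhs \<le> c * (\<rho> * (K\<^sup>2 / \<tau>\<^sup>2) * \<bar>l1 - l2\<bar> + \<rho> * (K\<^sup>2 / \<tau>) * (\<bar>p1 - p2\<bar> / \<rho>)) + c * (p * (1 / (2 * \<tau>) * d))
    + (c * (\<rho> * (K\<^sup>2 / \<tau>) * (1 / 2 * q1 * (1 - q1))) + c * (\<rho> * (K\<^sup>2 / \<tau>) * (1 / 2 * q2 * (1 - q2))))
    + ((c * (p * (K / \<tau>))) * sqrt d + ((c * (\<rho> * (K\<^sup>2 / \<tau>))) * sqrt (q1 * (1 - q1)) + (c * (\<rho> * (K\<^sup>2 / \<tau>))) * sqrt (q2 * (1 - q2))))"
    unfolding distrib_left[of p] a_def[symmetric] by (intro add_mono t1 t2 t3 t4 s)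
  also have "\<dots> = ?rhs" by (simp only: distrib_left mult.assoc add_ac)
  finally show ?thesis .
qed

section \<open>Local probability measures\<close>

lemma rkhsI:
  assumes "is_rkhs S k H ip" "kernel_on S k" "bounded_kernel S k" "measurable_kernel S k"
    and "S \<noteq> {}" "kernel_norm S k \<le> K"
  shows "rkhs S k H ip K"
proof -
  have sqrt_le: "sqrt (k x x) \<le> K" if "x \<in> S" for x
    using assms(3,6) that cSUP_upper[of x S "\<lambda>x. sqrt (k x x)"]
    by (force simp: kernel_norm_def bounded_kernel_def)
  \<comment> \<open>The kernel condition for a single point, \<open>n = 1\<close>, with coefficient
    1.\<close>
  have nonneg: "0 \<le> k x x" if "x \<in> S" for x
    using assms(2)[unfolded kernel_on_def, THEN conjunct2, THEN spec[of _ 1], THEN spec[of _ "\<lambda>_. x"],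
        THEN spec[of _ "\<lambda>_. 1"]] that by simp
  show ?thesis
  proof
    show "k x x \<le> K\<^sup>2" if "x \<in> S" for x
      using power_mono[OF sqrt_le[OF that], of 2] nonneg[OF that] by simp
    obtain x where "x \<in> S" using assms(5) by auto
    then show "0 \<le> K" using order_trans[OF real_sqrt_ge_zero[OF nonneg] sqrt_le] by blast
  qed (use assms in auto)
qed

locale svm_setting = prob_space P for P :: "('x::polish_space \<times> real) measure" +
  fixes Y :: "real set" and L :: "'x \<Rightarrow> real \<Rightarrow> real \<Rightarrow> real" and c :: real
  assumes sets_P: "sets P = sets (restrict_space borel (UNIV \<times> Y))"
    and L: "loss_function Y L" "convex_loss Y L"
    and L_lip: "\<And>x y s t. y \<in> Y \<Longrightarrow> \<bar>L x y s - L x y t\<bar> \<le> c * \<bar>s - t\<bar>"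
    and c0: "0 \<le> c"
begin

abbreviation \<psi> :: "'x \<times> real \<Rightarrow> real \<Rightarrow> real" where "\<psi> z \<equiv> L (fst z) (snd z)"

abbreviation PS :: "'x set \<Rightarrow> real" where "PS S \<equiv> measure P (S \<times> Y)"

text \<open>Unnormalized restrictions add up over disjoint cells, unlike the local probability
  measures.\<close>

abbreviation RS :: "'x set \<Rightarrow> ('x \<times> real) measure" where "RS S \<equiv> restrict_space P (S \<times> Y)"

lemma space_P: "space P = UNIV \<times> Y"
  using sets_eq_imp_space_eq[OF sets_P] by (simp add: space_restrict_space)

lemma cylinder_sets:
  assumes "S \<in> sets borel"
  shows "S \<times> Y \<in> sets P"
proof -
  have "S \<times> UNIV \<in> sets (borel :: ('x \<times> real) measure)"
    unfolding borel_prod[symmetric] using assms by (intro pair_measureI) auto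
  then have "(UNIV \<times> Y) \<inter> (S \<times> UNIV) \<in> sets (restrict_space borel (UNIV \<times> Y))"
    unfolding sets_restrict_space by (intro imageI)
  moreover have "(UNIV \<times> Y) \<inter> (S \<times> UNIV) = S \<times> Y" by auto
  ultimately show ?thesis by (simp add: sets_P)
qed

lemma cylinder_Int: "S \<in> sets borel \<Longrightarrow> S \<times> Y \<inter> space P \<in> sets P"
  using cylinder_sets by auto

lemma space_RS: "space (RS S) = S \<times> Y"
  by (auto simp: space_restrict_space space_P)

lemma finite_RS: "S \<in> sets borel \<Longrightarrow> finite_measure (RS S)"
  using cylinder_sets by (intro finite_measure_restrict_space finite_measure_axioms)

lemma measure_RS: "S \<in> sets borel \<Longrightarrow> measure (RS S) (space (RS S)) = PS S"
  unfolding space_RS using cylinder_sets by (simp add: measure_restrict_space space_P)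

lemma measurable_P_cong: "measurable P M = measurable (restrict_space borel (UNIV \<times> Y)) M"
  by (rule measurable_cong_sets[OF sets_P refl])

lemma measurable_P: "f \<in> borel \<rightarrow>\<^sub>M M \<Longrightarrow> f \<in> P \<rightarrow>\<^sub>M M"
  unfolding measurable_P_cong by (rule measurable_restrict_space1)

lemma fst_P: "fst \<in> P \<rightarrow>\<^sub>M borel"
  by (rule measurable_P) (simp add: borel_prod[symmetric])

lemma snd_P: "snd \<in> P \<rightarrow>\<^sub>M borel"
  by (rule measurable_P) (simp add: borel_prod[symmetric])

lemma fst_RS: "T \<subseteq> S \<Longrightarrow> fst \<in> RS T \<rightarrow>\<^sub>M restrict_space borel S"
  using measurable_restrict_space1[OF fst_P, of "T \<times> Y"]
  by (auto simp: measurable_restrict_space2_iff space_P space_restrict_space)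

lemma loss_measurable:
  assumes "v \<in> borel_measurable (RS S)"
  shows "(\<lambda>z. \<psi> z (v z)) \<in> borel_measurable (RS S)"
proof -
  have "(\<lambda>z. (fst z, snd z, v z)) \<in> RS S \<rightarrow>\<^sub>M borel"
    unfolding borel_prod[symmetric]
    by (intro measurable_Pair measurable_restrict_space1 fst_P snd_P assms)
  then have "(\<lambda>z. (fst z, snd z, v z)) \<in> RS S \<rightarrow>\<^sub>M restrict_space borel (UNIV \<times> Y \<times> UNIV)"
    by (intro measurable_restrict_space2) (auto simp: space_RS)
  from measurable_compose[OF this, of "\<lambda>(x, y, t). L x y t" borel] L(1) show ?thesis
    by (simp add: loss_function_def)
qed

text \<open>As a density with a real constant, the scaled measure becomes accessible to
  \<open>integral_density\<close>.\<close>

lemma local_measure_eq: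
  assumes "0 < PS S"
  shows "local_measure P Y S = density (RS S) (\<lambda>_. ennreal (1 / PS S))"
proof -
  have "1 / emeasure P (S \<times> Y) = ennreal (1 / PS S)"
    using assms by (simp add: emeasure_eq_measure divide_ennreal[symmetric] ennreal_1)
  then show ?thesis
    unfolding local_measure_def
    by (intro measure_eqI) (simp_all add: emeasure_density_const)
qed

lemma
  assumes "0 < PS S"
  shows sets_local: "sets (local_measure P Y S) = sets (RS S)"
    and space_local: "space (local_measure P Y S) = S \<times> Y"
  by (simp_all add: local_measure_eq[OF assms] space_RS)

lemma measurable_local: "0 < PS S \<Longrightarrow> measurable (local_measure P Y S) M = measurable (RS S) M"
  by (intro measurable_cong_sets sets_local refl)

lemma integral_local:
  fixes g :: "'x \<times> real \<Rightarrow> real"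
  assumes "0 < PS S" "g \<in> borel_measurable (RS S)"
  shows "(\<integral>z. g z \<partial>local_measure P Y S) = (1 / PS S) * (\<integral>z. g z \<partial>RS S)"
  unfolding local_measure_eq[OF assms(1)] using assms by (subst integral_density) auto

lemma prob_local:
  assumes "0 < PS S" "S \<in> sets borel"
  shows "prob_space (local_measure P Y S)"
proof
  have "emeasure (local_measure P Y S) (space (local_measure P Y S))
      = ennreal (1 / PS S) * emeasure (RS S) (space (RS S))"
    unfolding local_measure_eq[OF assms(1)] by (simp add: emeasure_density_const)
  also have "\<dots> = ennreal (1 / PS S) * ennreal (PS S)"
    using measure_RS[OF assms(2)] finite_measure.emeasure_eq_measure[OF finite_RS[OF assms(2)]] by simp
  also have "\<dots> = 1" using assms(1) by (simp flip: ennreal_mult)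
  finally show "emeasure (local_measure P Y S) (space (local_measure P Y S)) = 1" .
qed

lemma local_problem:
  assumes r: "rkhs S k H ip K" and S: "S \<in> sets borel" "0 < PS S" and l: "0 < l"
  shows "svm_problem S k H ip K (local_measure P Y S) fst \<psi> c l"
proof -
  interpret r: rkhs S k H ip K by fact
  interpret Q: prob_space "local_measure P Y S" by (rule prob_local[OF S(2,1)])
  show ?thesis
  proof
    show "fst \<in> local_measure P Y S \<rightarrow>\<^sub>M restrict_space borel S"
      unfolding measurable_local[OF S(2)] by (rule fst_RS) simp
    show "(\<lambda>z. \<psi> z (v z)) \<in> borel_measurable (local_measure P Y S)"
      if "v \<in> borel_measurable (local_measure P Y S)" for v
      using loss_measurable that unfolding measurable_local[OF S(2)] .
    show "convex_on UNIV (\<psi> z)" if "z \<in> space (local_measure P Y S)" for z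
      using L(2) that by (auto simp: space_local[OF S(2)] convex_loss_def)
    show "\<bar>\<psi> z s - \<psi> z t\<bar> \<le> c * \<bar>s - t\<bar>" if "z \<in> space (local_measure P Y S)" for z s t
      using L_lip that by (auto simp: space_local[OF S(2)])
  qed (use c0 l in auto)
qed

text \<open>\<open>svm\<close> is a definite description, so it carries information only once the
  minimizer is known to exist and to be unique.\<close>

lemma svm_minimizer:
  assumes "svm_problem S k H ip K N fst \<psi> c l"
  shows "svm_problem.minimizer H ip N fst \<psi> l (svm L N l H ip)"
proof -
  interpret svm_problem S k H ip K N fst \<psi> c l by fact
  have "is_arg_min (regularized_risk L N l ip) (\<lambda>f. f \<in> H) f \<longleftrightarrow> minimizer f" for f
    by (auto simp: is_arg_min_linorder minimizer_def regularized_risk_def risk_def shifted_loss_def case_prod_beta')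
  moreover obtain f0 where f0: "minimizer f0" using ex_minimizer by blast
  have "minimizer (THE f. minimizer f)"
    by (rule theI[of minimizer, OF f0 svm_unique[OF _ f0]])
  ultimately show ?thesis by (simp add: svm_def)
qed

lemma integral_RS_split:
  fixes g :: "'x \<times> real \<Rightarrow> real"
  assumes T: "T \<subseteq> S" "T \<in> sets borel" "S \<in> sets borel" and g: "integrable (RS S) g"
  shows "(\<integral>z. g z \<partial>RS S) = (\<integral>z. g z \<partial>RS T) + (\<integral>z. g z \<partial>RS (S - T))"
proof -
  have ST: "S - T \<in> sets borel" using T by auto
  have int: "integrable P (\<lambda>z. indicator (S \<times> Y) z *\<^sub>R g z)"
    using g T by (simp add: integrable_restrict_space cylinder_Int)
  have "integrable P (\<lambda>z. indicator (U \<times> Y) z *\<^sub>R g z)" if "U \<subseteq> S" "U \<in> sets borel" for U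
  proof -
    have "(\<lambda>z. indicator (U \<times> Y) z *\<^sub>R (indicator (S \<times> Y) z *\<^sub>R g z)) = (\<lambda>z. indicator (U \<times> Y) z *\<^sub>R g z)"
      using that by (intro ext) (auto split: split_indicator)
    then show ?thesis
      using integrable_mult_indicator[OF cylinder_sets[OF that(2)] int] by simp
  qed
  note int_U = this[OF T(1,2)] this[OF Diff_subset ST]
  have "(\<integral>z. g z \<partial>RS S) = (\<integral>z. indicator (S \<times> Y) z *\<^sub>R g z \<partial>P)"
    by (rule integral_restrict_space[OF cylinder_Int[OF T(3)]])
  also have "\<dots> = (\<integral>z. indicator (T \<times> Y) z *\<^sub>R g z + indicator ((S - T) \<times> Y) z *\<^sub>R g z \<partial>P)"
    using T(1) by (intro Bochner_Integration.integral_cong refl) (auto simp: indicator_def)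
  also have "\<dots> = (\<integral>z. g z \<partial>RS T) + (\<integral>z. g z \<partial>RS (S - T))"
    unfolding integral_restrict_space[OF cylinder_Int[OF T(2)]] integral_restrict_space[OF cylinder_Int[OF ST]]
    by (rule Bochner_Integration.integral_add[OF int_U])
  finally show ?thesis .
qed

lemma PS_Diff: "T \<subseteq> S \<Longrightarrow> T \<in> sets borel \<Longrightarrow> S \<in> sets borel \<Longrightarrow> PS (S - T) = PS S - PS T"
proof -
  assume a: "T \<subseteq> S" "T \<in> sets borel" "S \<in> sets borel"
  have "(S - T) \<times> Y = S \<times> Y - T \<times> Y" by auto
  then show ?thesis using finite_measure_Diff[OF cylinder_sets[OF a(3)] cylinder_sets[OF a(2)]] a(1) by auto
qed

text \<open>The integral equation for the smoothed solution on \<open>S\<close>, read on a subset \<open>T\<close>: the integral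
  over \<open>S - T\<close> is treated as a perturbation.\<close>

lemma smoothed_on_subset:
  assumes r: "rkhs S k H ip K" and T: "T \<subseteq> S" "T \<in> sets borel" "S \<in> sets borel" "0 < PS S"
    and l: "0 < l" and e: "0 < e"
  obtains g r where "g \<in> H"
    and "\<And>x. x \<in> S \<Longrightarrow> \<bar>svm L (local_measure P Y S) l H ip x - g x\<bar> \<le> K * sqrt (c * e / l)"
    and "(\<lambda>z. slope e (\<psi> z) (g (fst z))) \<in> borel_measurable (RS T)"
    and "\<And>z. z \<in> space (RS T) \<Longrightarrow>
      2 * l * PS S * g (fst z) = - (\<integral>z'. slope e (\<psi> z') (g (fst z')) * k (fst z') (fst z) \<partial>RS T) - r z"
    and "\<And>z. z \<in> space (RS T) \<Longrightarrow> \<bar>r z\<bar> \<le> c * K\<^sup>2 * (PS S - PS T)"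
proof -
  interpret A: svm_problem S k H ip K "local_measure P Y S" fst \<psi> c l
    by (rule local_problem[OF r T(3,4) l])
  interpret prob: prob_space "local_measure P Y S" by (rule prob_local[OF T(4,3)])
  let ?f = "svm L (local_measure P Y S) l H ip"
  have f: "A.minimizer ?f" by (rule svm_minimizer[OF A.svm_problem_axioms])
  then have fH: "?f \<in> H" by (simp add: A.minimizer_def)
  obtain g where g: "g \<in> H" "\<And>h. h \<in> H \<Longrightarrow> 2 * l * ip g h = - (\<integral>z. A.pslope e g z * h (fst z) \<partial>local_measure P Y S)"
    using A.ex_smoothed_solution[OF e] by auto
  have ST: "S - T \<in> sets borel" using T by auto
  define s where "s z = slope e (\<psi> z) (g (fst z))" for z
  have s_meas: "s \<in> borel_measurable (RS S)"
    using A.bm_pslope[OF e g(1)] unfolding A.bm_def measurable_local[OF T(4)]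
    by (simp add: A.pslope_def[abs_def] s_def[abs_def])
  have s_le: "\<bar>s z\<bar> \<le> c" if "z \<in> S \<times> Y" for z
    using A.abs_pslope_le[OF e, of z g] that by (simp add: space_local[OF T(4)] A.pslope_def s_def)
  have sk_meas: "(\<lambda>z. s z * k (fst z) x) \<in> borel_measurable (RS S)" if "x \<in> S" for x
    using that by (intro borel_measurable_times s_meas A.k_measurable_pair fst_RS measurable_const)
      (auto simp: space_restrict_space)
  have sk_le: "\<bar>s z * k (fst z) x\<bar> \<le> c * K\<^sup>2" if "x \<in> S" "z \<in> S \<times> Y" for x z
    unfolding abs_mult using that by (intro mult_mono s_le A.abs_k_le c0) auto
  define r where "r z = (\<integral>z'. s z' * k (fst z') (fst z) \<partial>RS (S - T))" for z :: "'x \<times> real"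
  show thesis
  proof (rule that[of g r])
    show "g \<in> H" by fact
    show "\<bar>?f x - g x\<bar> \<le> K * sqrt (c * e / l)" if x: "x \<in> S" for x
    proof -
      have "(fun_dist S ip ?f g)\<^sup>2 \<le> c * e / l"
        using A.smoothed_solution_close[OF e g f] prob.prob_space by simp
      then have "fun_dist S ip ?f g \<le> sqrt (c * e / l)" by (rule real_le_rsqrt)
      then have "K * fun_dist S ip ?f g \<le> K * sqrt (c * e / l)" by (intro mult_left_mono A.K_nonneg)
      then show ?thesis
        using A.abs_eval_le[OF A.comb_in[OF fH g(1), of 1 "-1"] x] x
        by (simp add: A.comb_apply A.fun_dist_comb)
    qed
    have "RS T = restrict_space (RS S) (T \<times> Y)"
      by (subst restrict_restrict_space) (use T cylinder_Int in \<open>auto simp: Int_absorb1 Sigma_mono Int_absorb2\<close>)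
    then show "(\<lambda>z. slope e (\<psi> z) (g (fst z))) \<in> borel_measurable (RS T)"
      using measurable_restrict_space1[OF s_meas, of "T \<times> Y"] by (simp add: s_def[abs_def])
    fix z :: "'x \<times> real" assume "z \<in> space (RS T)"
    then have z: "fst z \<in> S" using T(1) by (auto simp: space_RS)
    \<comment> \<open>Testing with \<open>kx (fst z)\<close> turns the weak equation into an
      integral equation at the point \<open>fst z\<close>.\<close>
    have "2 * l * g (fst z) = - (\<integral>z'. s z' * A.kx (fst z) (fst z') \<partial>local_measure P Y S)"
      using g(2)[OF A.kx_in[OF z]] by (simp add: A.reproducing[OF z g(1)] A.pslope_def s_def)
    also have "(\<integral>z'. s z' * A.kx (fst z) (fst z') \<partial>local_measure P Y S)
        = (\<integral>z'. s z' * k (fst z') (fst z) \<partial>local_measure P Y S)"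
      by (intro Bochner_Integration.integral_cong) (auto simp: A.kx_def space_local[OF T(4)])
    also have "\<dots> = (1 / PS S) * (\<integral>z'. s z' * k (fst z') (fst z) \<partial>RS S)"
      by (rule integral_local[OF T(4) sk_meas[OF z]])
    also have "(\<integral>z'. s z' * k (fst z') (fst z) \<partial>RS S)
        = (\<integral>z'. s z' * k (fst z') (fst z) \<partial>RS T) + r z"
      unfolding r_def
    proof (rule integral_RS_split[OF T(1-3)])
      show "integrable (RS S) (\<lambda>z'. s z' * k (fst z') (fst z))"
        by (rule finite_measure.integrable_const_bound[OF finite_RS[OF T(3)] _ sk_meas[OF z], where B="c * K\<^sup>2"])
          (use sk_le[OF z] in \<open>auto intro!: AE_I2 simp: space_RS\<close>)
    qed
    finally have *: "2 * l * g (fst z) = - ((1 / PS S) * ((\<integral>z'. s z' * k (fst z') (fst z) \<partial>RS T) + r z))" .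
    \<comment> \<open>Multiplying by the mass of \<open>S\<close> removes the normalization, so that
      equations from two different cells refer to the same measure on \<open>T\<close>; the mass
      moves into the coefficient of \<open>g\<close>.\<close>
    have "2 * l * PS S * g (fst z) = PS S * (2 * l * g (fst z))" by simp
    also have "\<dots> = - (\<integral>z'. s z' * k (fst z') (fst z) \<partial>RS T) - r z"
      unfolding * using T(4) by simp
    finally show "2 * l * PS S * g (fst z) = - (\<integral>z'. slope e (\<psi> z') (g (fst z')) * k (fst z') (fst z) \<partial>RS T) - r z"
      by (simp add: s_def)
    have "\<bar>r z\<bar> \<le> (c * K\<^sup>2) * measure (RS (S - T)) (space (RS (S - T)))"
    proof -
      have m: "(\<lambda>z'. s z' * k (fst z') (fst z)) \<in> borel_measurable (RS (S - T))"
      proof -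
        have "RS (S - T) = restrict_space (RS S) ((S - T) \<times> Y)"
          by (subst restrict_restrict_space) (use T ST cylinder_Int in \<open>auto simp: Int_absorb1 Sigma_mono Int_absorb2\<close>)
        then show ?thesis using measurable_restrict_space1[OF sk_meas[OF z]] by simp
      qed
      interpret F: finite_measure "RS (S - T)" by (rule finite_RS[OF ST])
      have "\<bar>r z\<bar> \<le> (\<integral>z'. \<bar>s z' * k (fst z') (fst z)\<bar> \<partial>RS (S - T))"
        unfolding r_def by (rule integral_abs_bound)
      also have "\<dots> \<le> (\<integral>z'. c * K\<^sup>2 \<partial>RS (S - T))"
        using sk_le[OF z] c0 by (intro integral_mono') (auto simp: space_RS)
      finally show ?thesis by (simp add: mult_ac)
    qed
    then show "\<bar>r z\<bar> \<le> c * K\<^sup>2 * (PS S - PS T)"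
      by (simp add: measure_RS[OF ST] PS_Diff[OF T(1-3)])
  qed
qed

end

context svm_setting
begin

lemma rkhs_measure_RS:
  assumes "rkhs S k H ip K" "T \<subseteq> S" "T \<in> sets borel"
  shows "rkhs_measure S k H ip K (RS T) fst"
  using assms fst_RS[OF assms(2)] finite_RS[OF assms(3)]
  by (simp add: rkhs_measure_def rkhs_measure_axioms_def)

text \<open>The normalization on \<open>T\<close> enters once per variable, hence the square.
  \<open>integral_snd\<close> orders the iterated integral so that the inner variable is the first
  kernel argument, as in \<open>rep_apply\<close>.\<close>

lemma kernel_dist_marginal:
  assumes r1: "rkhs S1 k1 H1 ip1 K" and r2: "rkhs S2 k2 H2 ip2 K"
    and T: "T \<subseteq> S1" "T \<subseteq> S2" "T \<in> sets borel" "0 < PS T"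
  defines "M \<equiv> marginal T (local_measure P Y T)"
  shows "(\<integral>z. (\<integral>z'. \<bar>k1 (fst z') (fst z) - k2 (fst z') (fst z)\<bar> \<partial>RS T) \<partial>RS T)
    = (PS T)\<^sup>2 * L1_norm (M \<Otimes>\<^sub>M M) (\<lambda>(x, x'). k1 x x' - k2 x x')"
proof -
  interpret A: rkhs S1 k1 H1 ip1 K by fact
  interpret B: rkhs S2 k2 H2 ip2 K by fact
  let ?B = "restrict_space borel T :: 'x measure"
  let ?Q = "local_measure P Y T"
  define \<kappa> where "\<kappa> x x' = \<bar>k1 x x' - k2 x x'\<bar>" for x x'
  have incl: "(\<lambda>x. x) \<in> ?B \<rightarrow>\<^sub>M restrict_space borel S" if "T \<subseteq> S" for S
    using that by (intro measurable_restrict_space3) auto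
  have fst_Q: "fst \<in> ?Q \<rightarrow>\<^sub>M ?B"
    unfolding measurable_local[OF T(4)] by (rule fst_RS) simp
  interpret Q: prob_space ?Q by (rule prob_local[OF T(4,3)])
  interpret M: prob_space M unfolding M_def marginal_def by (rule Q.prob_space_distr[OF fst_Q])
  interpret MM: pair_prob_space M M ..
  have sets_M: "sets M = sets ?B" and space_M: "space M = T"
    by (simp_all add: M_def marginal_def space_restrict_space)
  have k_pair: "(\<lambda>z. k (f z) (g z)) \<in> borel_measurable N"
    if "f \<in> N \<rightarrow>\<^sub>M ?B" "g \<in> N \<rightarrow>\<^sub>M ?B" "rkhs S k H ip K" "T \<subseteq> S" for f g and N :: "'a measure" and S k H ip
    by (rule rkhs.k_measurable_pair[OF that(3)]; rule measurable_compose[OF _ incl[OF that(4)]]; fact)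
  have \<kappa>_pair: "(\<lambda>z. \<kappa> (f z) (g z)) \<in> borel_measurable N"
    if "f \<in> N \<rightarrow>\<^sub>M ?B" "g \<in> N \<rightarrow>\<^sub>M ?B" for f g and N :: "'a measure"
    unfolding \<kappa>_def
    by (intro borel_measurable_abs borel_measurable_diff k_pair[OF that r1 T(1)] k_pair[OF that r2 T(2)])
  have M_cong: "measurable N M = measurable N ?B" "measurable M N = measurable ?B N" for N :: "'c measure"
    by (rule measurable_cong_sets; simp add: sets_M)+
  have MM_meas: "(\<lambda>z. \<kappa> (fst z) (snd z)) \<in> borel_measurable (M \<Otimes>\<^sub>M M)"
    by (intro \<kappa>_pair) (simp_all flip: M_cong)
  have \<kappa>_le: "\<bar>\<kappa> x x'\<bar> \<le> 2 * K\<^sup>2" if "x \<in> T" "x' \<in> T" for x x'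
  proof -
    have "\<bar>k1 x x'\<bar> \<le> K\<^sup>2" "\<bar>k2 x x'\<bar> \<le> K\<^sup>2"
      using that T by (auto intro!: A.abs_k_le B.abs_k_le)
    then show ?thesis by (simp add: \<kappa>_def)
  qed
  have integral_M: "(\<integral>x. h x \<partial>M) = (\<integral>z. h (fst z) \<partial>?Q)" if "h \<in> borel_measurable ?B" for h :: "'x \<Rightarrow> real"
    unfolding M_def marginal_def by (rule integral_distr[OF fst_Q that])
  have int: "integrable (M \<Otimes>\<^sub>M M) (case_prod \<kappa>)"
    using MM_meas \<kappa>_le
    by (intro MM.P.integrable_const_bound[where B="2 * K\<^sup>2"])
      (auto intro!: AE_I2 simp: case_prod_beta' space_pair_measure space_M)
  have "L1_norm (M \<Otimes>\<^sub>M M) (\<lambda>(x, x'). k1 x x' - k2 x x') = (\<integral>z. case_prod \<kappa> z \<partial>(M \<Otimes>\<^sub>M M))"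
    by (simp add: L1_norm_def \<kappa>_def case_prod_beta')
  also have "\<dots> = (\<integral>x'. (\<integral>x. \<kappa> x x' \<partial>M) \<partial>M)"
    by (rule MM.integral_snd[OF int, symmetric])
  also have "\<dots> = (\<integral>z. (\<integral>x. \<kappa> x (fst z) \<partial>M) \<partial>?Q)"
  proof -
    have "(\<lambda>x'. \<integral>x. \<kappa> x x' \<partial>M) \<in> borel_measurable M"
    proof (rule M.borel_measurable_lebesgue_integral)
      show "(\<lambda>(x', x). \<kappa> x x') \<in> borel_measurable (M \<Otimes>\<^sub>M M)"
        unfolding case_prod_beta' by (intro \<kappa>_pair) (simp_all flip: M_cong)
    qed
    then show ?thesis unfolding M_cong by (rule integral_M)
  qed
  also have "\<dots> = (\<integral>z. (\<integral>z'. \<kappa> (fst z') (fst z) \<partial>?Q) \<partial>?Q)"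
  proof (rule Bochner_Integration.integral_cong[OF refl])
    fix z assume "z \<in> space ?Q"
    then have "fst z \<in> T" by (auto simp: space_local[OF T(4)])
    then have "(\<lambda>x. \<kappa> x (fst z)) \<in> borel_measurable ?B"
      by (intro \<kappa>_pair) (simp_all add: space_restrict_space)
    then show "(\<integral>x. \<kappa> x (fst z) \<partial>M) = (\<integral>z'. \<kappa> (fst z') (fst z) \<partial>?Q)"
      by (rule integral_M)
  qed
  also have "\<dots> = (\<integral>z. (1 / PS T) * (\<integral>z'. \<kappa> (fst z') (fst z) \<partial>RS T) \<partial>?Q)"
  proof (rule Bochner_Integration.integral_cong[OF refl])
    fix z assume "z \<in> space ?Q"
    then have "fst z \<in> T" by (auto simp: space_local[OF T(4)])
    then have "(\<lambda>z'. \<kappa> (fst z') (fst z)) \<in> borel_measurable (RS T)"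
      by (intro \<kappa>_pair fst_RS) (simp_all add: space_restrict_space)
    then show "(\<integral>z'. \<kappa> (fst z') (fst z) \<partial>?Q) = (1 / PS T) * (\<integral>z'. \<kappa> (fst z') (fst z) \<partial>RS T)"
      by (rule integral_local[OF T(4)])
  qed
  also have "\<dots> = (1 / PS T) * (1 / PS T) * (\<integral>z. (\<integral>z'. \<kappa> (fst z') (fst z) \<partial>RS T) \<partial>RS T)"
  proof -
    interpret R: finite_measure "RS T" by (rule finite_RS[OF T(3)])
    have fst_RT: "fst \<in> RS T \<rightarrow>\<^sub>M ?B" by (rule fst_RS) simp
    have "(\<lambda>z. \<integral>z'. \<kappa> (fst z') (fst z) \<partial>RS T) \<in> borel_measurable (RS T)"
    proof (rule R.borel_measurable_lebesgue_integral)
      show "(\<lambda>(z, z'). \<kappa> (fst z') (fst z)) \<in> borel_measurable (RS T \<Otimes>\<^sub>M RS T)"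
        unfolding case_prod_beta'
        by (intro \<kappa>_pair measurable_compose[OF measurable_fst fst_RT] measurable_compose[OF measurable_snd fst_RT])
    qed
    then show ?thesis by (simp add: integral_local[OF T(4)])
  qed
  finally show ?thesis
    using T(4) by (simp add: \<kappa>_def power2_eq_square)
qed

text \<open>The estimate for the smoothed solutions does not depend on the smoothing parameter, so
  it passes to the SVMs themselves.\<close>

lemma cell_comparison:
  assumes r1: "rkhs S1 k1 H1 ip1 K" and r2: "rkhs S2 k2 H2 ip2 K"
    and S: "S1 \<in> sets borel" "S2 \<in> sets borel"
    and T: "T \<subseteq> S1" "T \<subseteq> S2" "T \<in> sets borel" "0 < PS T" and l: "0 < l1" "0 < l2"
  defines "f1 \<equiv> svm L (local_measure P Y S1) l1 H1 ip1" and "f2 \<equiv> svm L (local_measure P Y S2) l2 H2 ip2"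
    and "M \<equiv> marginal T (local_measure P Y T)"
  defines "d \<equiv> L1_norm (M \<Otimes>\<^sub>M M) (\<lambda>(x, x'). k1 x x' - k2 x x')"
    and "\<tau> \<equiv> min l1 l2" and "\<rho> \<equiv> max (PS S1) (PS S2)" and "q1 \<equiv> PS T / PS S1" and "q2 \<equiv> PS T / PS S2"
  shows "(\<integral>z. \<bar>f1 (fst z) - f2 (fst z)\<bar> \<partial>RS T)
    \<le> c * (\<rho> * (K\<^sup>2 / \<tau>\<^sup>2) * \<bar>l1 - l2\<bar> + PS T * (1 / (2 * \<tau>) * d + K / \<tau> * sqrt d)
      + \<rho> * (K\<^sup>2 / \<tau>) * (\<bar>PS S1 - PS S2\<bar> / \<rho>
        + ((1 / 2 * q1 * (1 - q1) + sqrt (q1 * (1 - q1))) + (1 / 2 * q2 * (1 - q2) + sqrt (q2 * (1 - q2))))))"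
    (is "_ \<le> ?rhs")
proof -
  interpret A: rkhs_measure S1 k1 H1 ip1 K "RS T" fst by (rule rkhs_measure_RS[OF r1 T(1,3)])
  interpret B: rkhs_measure S2 k2 H2 ip2 K "RS T" fst by (rule rkhs_measure_RS[OF r2 T(2,3)])
  have p: "PS T \<le> PS S1" "PS T \<le> PS S2"
    using T by (auto intro!: finite_measure_mono cylinder_sets S)
  then have pos: "0 < PS S1" "0 < PS S2" using T(4) by auto
  have mass: "measure (RS T) (space (RS T)) = PS T" by (rule measure_RS[OF T(3)])
  have d: "0 \<le> d" by (simp add: d_def L1_norm_def)
  have fH: "f1 \<in> H1" "f2 \<in> H2"
  proof -
    interpret C: svm_problem S1 k1 H1 ip1 K "local_measure P Y S1" fst \<psi> c l1
      by (rule local_problem[OF r1 S(1) pos(1) l(1)])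
    interpret D: svm_problem S2 k2 H2 ip2 K "local_measure P Y S2" fst \<psi> c l2
      by (rule local_problem[OF r2 S(2) pos(2) l(2)])
    show "f1 \<in> H1" "f2 \<in> H2"
      using svm_minimizer[OF C.svm_problem_axioms] svm_minimizer[OF D.svm_problem_axioms]
      by (simp_all add: f1_def f2_def C.minimizer_def D.minimizer_def)
  qed
  define C where "C = PS T * (K * (sqrt (c / l1) + sqrt (c / l2)))"
  \<comment> \<open>Smoothing with parameter \<open>s\<^sup>2\<close> moves the solutions by order
    \<open>s\<close>; \<open>C\<close> is the mass of \<open>T\<close> times the two displacements
    per unit of \<open>s\<close>, and letting \<open>s\<close> tend to 0 removes this error.\<close>
  have "0 \<le> ?rhs - (\<integral>z. \<bar>f1 (fst z) - f2 (fst z)\<bar> \<partial>RS T)"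
  proof (rule nonneg_of_small_steps[where b=C])
    fix s :: real assume s: "0 < s" "s < 1"
    then have e: "0 < s\<^sup>2" by simp
    obtain g1 r1' where g1: "g1 \<in> H1"
      "\<And>x. x \<in> S1 \<Longrightarrow> \<bar>f1 x - g1 x\<bar> \<le> K * sqrt (c * s\<^sup>2 / l1)"
      "(\<lambda>z. slope (s\<^sup>2) (\<psi> z) (g1 (fst z))) \<in> borel_measurable (RS T)"
      "\<And>z. z \<in> space (RS T) \<Longrightarrow>
        2 * l1 * PS S1 * g1 (fst z) = - (\<integral>z'. slope (s\<^sup>2) (\<psi> z') (g1 (fst z')) * k1 (fst z') (fst z) \<partial>RS T) - r1' z"
      "\<And>z. z \<in> space (RS T) \<Longrightarrow> \<bar>r1' z\<bar> \<le> c * K\<^sup>2 * (PS S1 - PS T)"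
      unfolding f1_def using smoothed_on_subset[OF r1 T(1,3) S(1) pos(1) l(1) e] by blast
    obtain g2 r2' where g2: "g2 \<in> H2"
      "\<And>x. x \<in> S2 \<Longrightarrow> \<bar>f2 x - g2 x\<bar> \<le> K * sqrt (c * s\<^sup>2 / l2)"
      "(\<lambda>z. slope (s\<^sup>2) (\<psi> z) (g2 (fst z))) \<in> borel_measurable (RS T)"
      "\<And>z. z \<in> space (RS T) \<Longrightarrow>
        2 * l2 * PS S2 * g2 (fst z) = - (\<integral>z'. slope (s\<^sup>2) (\<psi> z') (g2 (fst z')) * k2 (fst z') (fst z) \<partial>RS T) - r2' z"
      "\<And>z. z \<in> space (RS T) \<Longrightarrow> \<bar>r2' z\<bar> \<le> c * K\<^sup>2 * (PS S2 - PS T)"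
      unfolding f2_def using smoothed_on_subset[OF r2 T(2,3) S(2) pos(2) l(2) e] by blast
    have slope_le: "\<bar>slope (s\<^sup>2) (\<psi> z) t\<bar> \<le> c" if "z \<in> space (RS T)" for z t
      using that L_lip by (intro abs_slope_le e) (auto simp: space_RS)
    have mono: "0 \<le> (slope (s\<^sup>2) (\<psi> z) a - slope (s\<^sup>2) (\<psi> z) b) * (a - b)" if "z \<in> space (RS T)" for z a b
      using that L(2) by (intro slope_monotone_mult e) (auto simp: space_RS convex_loss_def)
    have "(\<integral>z. \<bar>g1 (fst z) - g2 (fst z)\<bar> \<partial>RS T) \<le> ?rhs"
      using kernel_comparison[OF A.rkhs_measure_axioms B.rkhs_measure_axioms g1(3) slope_le g2(3) slope_le c0
          _ _ _ _ g1(4) g2(4) g1(5) g2(5) mono]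
        comparison_bound_le[OF T(4) p l c0 A.K_nonneg d]
      unfolding mass kernel_dist_marginal[OF r1 r2 T] d_def[symmetric] M_def[symmetric]
        \<tau>_def[symmetric] \<rho>_def[symmetric] q1_def[symmetric] q2_def[symmetric]
      using l pos p c0 by simp
    moreover have "(\<integral>z. \<bar>f1 (fst z) - f2 (fst z)\<bar> \<partial>RS T)
      \<le> (\<integral>z. \<bar>g1 (fst z) - g2 (fst z)\<bar> + s * (K * (sqrt (c / l1) + sqrt (c / l2))) \<partial>RS T)"
    proof (rule integral_mono')
      \<comment> \<open>\<open>bm\<close> depends on the measure alone, so members of
        \<open>H2\<close> are admissible weights in the first space too.\<close>
      have "A.bm (\<lambda>z. g2 (fst z))" using B.bm_H[OF g2(1)] by (simp add: A.bm_def B.bm_def)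
      then show "integrable (RS T) (\<lambda>z. \<bar>g1 (fst z) - g2 (fst z)\<bar> + s * (K * (sqrt (c / l1) + sqrt (c / l2))))"
        using A.bm_integrable[OF A.bm_diff[OF A.bm_H[OF g1(1)]]] by simp
      fix z assume z: "z \<in> space (RS T)"
      have "\<bar>f1 (fst z) - g1 (fst z)\<bar> \<le> s * (K * sqrt (c / l1))" "\<bar>f2 (fst z) - g2 (fst z)\<bar> \<le> s * (K * sqrt (c / l2))"
        using g1(2)[OF A.\<pi>_in[OF z]] g2(2)[OF B.\<pi>_in[OF z]] s
        by (simp_all add: real_sqrt_mult real_sqrt_divide mult_ac)
      then show "\<bar>f1 (fst z) - f2 (fst z)\<bar> \<le> \<bar>g1 (fst z) - g2 (fst z)\<bar> + s * (K * (sqrt (c / l1) + sqrt (c / l2)))"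
        by (simp add: distrib_left)
      then show "0 \<le> \<bar>g1 (fst z) - g2 (fst z)\<bar> + s * (K * (sqrt (c / l1) + sqrt (c / l2)))" by linarith
    qed
    moreover have "(\<integral>z. \<bar>g1 (fst z) - g2 (fst z)\<bar> + s * (K * (sqrt (c / l1) + sqrt (c / l2))) \<partial>RS T)
      = (\<integral>z. \<bar>g1 (fst z) - g2 (fst z)\<bar> \<partial>RS T) + s * C"
    proof -
      have "A.bm (\<lambda>z. g2 (fst z))" using B.bm_H[OF g2(1)] by (simp add: A.bm_def B.bm_def)
      from A.bm_integrable[OF A.bm_diff[OF A.bm_H[OF g1(1)] this]]
      show ?thesis by (simp add: mass C_def)
    qed
    ultimately show "0 \<le> ?rhs - (\<integral>z. \<bar>f1 (fst z) - f2 (fst z)\<bar> \<partial>RS T) + s * C" by linarith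
  qed
  then show ?thesis by simp
qed

end

text \<open>The infimum is itself a Lipschitz constant: every difference quotient is a lower bound
  of the nonempty set of admissible constants.\<close>

lemma lipschitz_const_bound:
  assumes "lipschitz_loss Y L"
  shows "0 \<le> lipschitz_const Y L"
    and "y \<in> Y \<Longrightarrow> \<bar>L x y s - L x y t\<bar> \<le> lipschitz_const Y L * \<bar>s - t\<bar>"
proof -
  let ?C = "{c. 0 \<le> c \<and> (\<forall>x. \<forall>y\<in>Y. c-lipschitz_on UNIV (L x y))}"
  have ne: "?C \<noteq> {}" using assms by (auto simp: lipschitz_loss_def)
  show "0 \<le> lipschitz_const Y L"
    unfolding lipschitz_const_def by (rule cInf_greatest[OF ne]) simp
  assume y: "y \<in> Y"
  show "\<bar>L x y s - L x y t\<bar> \<le> lipschitz_const Y L * \<bar>s - t\<bar>"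
  proof (cases "s = t")
    case False
    have "\<bar>L x y s - L x y t\<bar> / \<bar>s - t\<bar> \<le> lipschitz_const Y L"
      unfolding lipschitz_const_def
    proof (rule cInf_greatest[OF ne])
      fix c assume "c \<in> ?C"
      then have "\<bar>L x y s - L x y t\<bar> \<le> c * \<bar>s - t\<bar>"
        using y lipschitz_onD[of c UNIV "L x y" s t] by (simp add: dist_real_def)
      then show "\<bar>L x y s - L x y t\<bar> / \<bar>s - t\<bar> \<le> c" using False by (simp add: pos_divide_le_eq)
    qed
    then show ?thesis using False by (simp add: pos_divide_le_eq)
  qed simp
qed

lemma cell_index_eq:
  assumes "disjoint_family_on X {1..A}" "a \<in> {1..A}" "T \<subseteq> X a" "T \<noteq> {}"
  shows "cell_index A X T = a"
  unfolding cell_index_def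
proof (rule the_equality)
  fix a' assume "a' \<in> {1..A} \<and> T \<subseteq> X a'"
  then show "a' = a" using assms unfolding disjoint_family_on_def by blast
qed (use assms in auto)

lemma sum_zero_extension:
  fixes A :: nat
  assumes "disjoint_family_on X {1..A}" "a \<in> {1..A}" "x \<in> X a"
  shows "(\<Sum>a'=1..A. zero_extension (X a') (g a') x) = g a x"
proof -
  have "(\<Sum>a'=1..A. zero_extension (X a') (g a') x) = (\<Sum>a'=1..A. if a' = a then g a x else 0)"
  proof (intro sum.cong refl)
    fix a' assume "a' \<in> {1..A}"
    then have "a' = a \<or> x \<notin> X a'" using assms unfolding disjoint_family_on_def by blast
    then show "zero_extension (X a') (g a') x = (if a' = a then g a x else 0)"
      using assms(3) by (auto simp: zero_extension_def)
  qed
  also have "\<dots> = g a x" using assms(2) by simp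
  finally show ?thesis .
qed

context svm_setting
begin

lemma marginal_UNIV: "marginal UNIV P = distr P borel fst"
  unfolding marginal_def by (intro distr_cong) (simp_all add: sets_restrict_space)

lemma measure_marginal: "S \<in> sets borel \<Longrightarrow> measure (marginal UNIV P) S = PS S"
proof -
  assume "S \<in> sets borel"
  moreover have "fst -` S \<inter> space P = S \<times> Y" by (auto simp: space_P)
  ultimately show ?thesis by (simp add: marginal_UNIV measure_distr fst_P)
qed

lemma svm_in:
  assumes "rkhs S k H ip K" "S \<in> sets borel" "0 < PS S" "0 < l"
  shows "svm L (local_measure P Y S) l H ip \<in> H"
proof -
  interpret A: svm_problem S k H ip K "local_measure P Y S" fst \<psi> c l
    by (rule local_problem[OF assms])
  show ?thesis using svm_minimizer[OF A.svm_problem_axioms] by (simp add: A.minimizer_def)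
qed

lemma integrable_zero_extension:
  assumes r: "rkhs S k H ip K" and S: "S \<in> sets borel" and f: "f \<in> H"
  shows "integrable (marginal UNIV P) (zero_extension S f)"
proof -
  interpret rkhs S k H ip K by fact
  interpret M: prob_space "marginal UNIV P"
    unfolding marginal_UNIV by (rule prob_space_distr[OF fst_P])
  have "(\<lambda>x. indicator S x *\<^sub>R f x) \<in> borel_measurable borel"
    using H_measurable[OF f] S by (simp add: borel_measurable_restrict_space_iff)
  moreover have "(\<lambda>x. indicator S x *\<^sub>R f x) = zero_extension S f"
    by (auto simp: zero_extension_def indicator_def)
  ultimately have "zero_extension S f \<in> borel_measurable (marginal UNIV P)"
    by (simp add: marginal_UNIV)
  moreover have "\<bar>zero_extension S f x\<bar> \<le> \<bar>K * nrm f\<bar>" for x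
    using abs_eval_le[OF f, of x] by (auto simp: zero_extension_def)
  ultimately show ?thesis
    by (intro M.integrable_const_bound[where B="\<bar>K * nrm f\<bar>"]) (auto intro!: AE_I2)
qed

lemma L1_norm_marginal:
  assumes "integrable (marginal UNIV P) h"
  shows "L1_norm (marginal UNIV P) h = (\<integral>z. \<bar>h (fst z)\<bar> \<partial>P)"
  using borel_measurable_integrable[OF assms]
  by (simp add: L1_norm_def marginal_UNIV integral_distr[OF fst_P])

lemma integral_cells:
  fixes h :: "'x \<Rightarrow> real"
  assumes C: "\<And>b. b \<in> I \<Longrightarrow> C b \<in> sets borel" "disjoint_family_on C I" "(\<Union>b\<in>I. C b) = UNIV" "finite I"
    and h: "integrable (marginal UNIV P) h"
  shows "L1_norm (marginal UNIV P) h = (\<Sum>b\<in>I. \<integral>z. \<bar>h (fst z)\<bar> \<partial>RS (C b))"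
proof -
  have int: "integrable P (\<lambda>z. \<bar>h (fst z)\<bar>)"
    using h integrable_distr_eq[OF fst_P, of h] borel_measurable_integrable[OF h]
    by (simp add: marginal_UNIV)
  have "\<bar>h (fst z)\<bar> = (\<Sum>b\<in>I. indicator (C b \<times> Y) z *\<^sub>R \<bar>h (fst z)\<bar>)" if "z \<in> space P" for z
  proof -
    obtain b where b: "b \<in> I" "fst z \<in> C b" using C(3) by auto
    have "(\<Sum>b\<in>I. indicator (C b \<times> Y) z *\<^sub>R \<bar>h (fst z)\<bar>) = (\<Sum>b'\<in>I. if b' = b then \<bar>h (fst z)\<bar> else 0)"
      using b that C(2) by (intro sum.cong) (auto simp: indicator_def disjoint_family_on_def space_P mem_Times_iff)
    then show ?thesis using b C(4) by simp
  qed
  then have "(\<integral>z. \<bar>h (fst z)\<bar> \<partial>P) = (\<integral>z. (\<Sum>b\<in>I. indicator (C b \<times> Y) z *\<^sub>R \<bar>h (fst z)\<bar>) \<partial>P)"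
    by (rule Bochner_Integration.integral_cong[OF refl])
  also have "\<dots> = (\<Sum>b\<in>I. \<integral>z. indicator (C b \<times> Y) z *\<^sub>R \<bar>h (fst z)\<bar> \<partial>P)"
    by (intro Bochner_Integration.integral_sum integrable_mult_indicator cylinder_sets C int)
  also have "\<dots> = (\<Sum>b\<in>I. \<integral>z. \<bar>h (fst z)\<bar> \<partial>RS (C b))"
    by (intro sum.cong refl integral_restrict_space[symmetric] cylinder_Int C)
  finally show ?thesis by (simp add: L1_norm_marginal[OF h])
qed

end

theorem theorem3p4:
  fixes Y :: "real set"
    and P :: "nat \<Rightarrow> ('x::polish_space \<times> real) measure"
    and A :: "nat \<Rightarrow> nat"
    and X :: "nat \<Rightarrow> nat \<Rightarrow> 'x set"
    and B :: nat
    and Xs :: "nat \<Rightarrow> 'x set"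
    and lam :: "nat \<Rightarrow> nat \<Rightarrow> real"
    and k :: "nat \<Rightarrow> nat \<Rightarrow> 'x \<Rightarrow> 'x \<Rightarrow> real"
    and H :: "nat \<Rightarrow> nat \<Rightarrow> ('x \<Rightarrow> real) set"
    and ip :: "nat \<Rightarrow> nat \<Rightarrow> ('x \<Rightarrow> real) \<Rightarrow> ('x \<Rightarrow> real) \<Rightarrow> real"
    and L :: "'x \<Rightarrow> real \<Rightarrow> real \<Rightarrow> real"
  assumes Y: "closed Y"
    and P: "\<And>i. i \<in> {1, 2} \<Longrightarrow> prob_space (P i)"
      "\<And>i. i \<in> {1, 2} \<Longrightarrow> sets (P i) = sets (restrict_space borel (UNIV \<times> Y))"
    and X: "\<And>i. i \<in> {1, 2} \<Longrightarrow> regionalization (A i) (X i)"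
    and Xs: "bij_betw Xs {1..B}
        {X 1 a1 \<inter> X 2 a2 | a1 a2. a1 \<in> {1..A 1} \<and> a2 \<in> {1..A 2} \<and> X 1 a1 \<inter> X 2 a2 \<noteq> {}}"
    and pos: "\<And>i b. i \<in> {1, 2} \<Longrightarrow> b \<in> {1..B} \<Longrightarrow> measure (P i) (Xs b \<times> Y) > 0"
    and lam: "\<And>i a. i \<in> {1, 2} \<Longrightarrow> a \<in> {1..A i} \<Longrightarrow> lam i a > 0"
    and k: "\<And>i a. i \<in> {1, 2} \<Longrightarrow> a \<in> {1..A i} \<Longrightarrow> kernel_on (X i a) (k i a)"
      "\<And>i a. i \<in> {1, 2} \<Longrightarrow> a \<in> {1..A i} \<Longrightarrow> bounded_kernel (X i a) (k i a)"
      "\<And>i a. i \<in> {1, 2} \<Longrightarrow> a \<in> {1..A i} \<Longrightarrow> measurable_kernel (X i a) (k i a)"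
    and H: "\<And>i a. i \<in> {1, 2} \<Longrightarrow> a \<in> {1..A i} \<Longrightarrow> is_rkhs (X i a) (k i a) (H i a) (ip i a)"
      "\<And>i a. i \<in> {1, 2} \<Longrightarrow> a \<in> {1..A i} \<Longrightarrow> separable_function_space (X i a) (H i a) (ip i a)"
    and L: "loss_function Y L" "convex_loss Y L" "lipschitz_loss Y L"
  shows
    "let idx = (\<lambda>i b. cell_index (A i) (X i) (Xs b));
         PX = marginal UNIV (P 1);
         knorm = (\<lambda>i a. kernel_norm (X i a) (k i a));
         kappa = (\<lambda>b. max (knorm 1 (idx 1 b)) (knorm 2 (idx 2 b)));
         tau = (\<lambda>b. min (lam 1 (idx 1 b)) (lam 2 (idx 2 b)));
         rho = (\<lambda>b. max (measure PX (X 1 (idx 1 b))) (measure PX (X 2 (idx 2 b))));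
         PXs = (\<lambda>b. marginal (Xs b) (local_measure (P 1) Y (Xs b)));
         kdist = (\<lambda>b. L1_norm (PXs b \<Otimes>\<^sub>M PXs b)
                    (\<lambda>(x, x'). k 1 (idx 1 b) x x' - k 2 (idx 2 b) x x'));
         f = (\<lambda>i x. \<Sum>a=1..A i. zero_extension (X i a)
                    (svm L (local_measure (P i) Y (X i a)) (lam i a) (H i a) (ip i a)) x)
     in integrable PX (\<lambda>x. f 1 x - f 2 x) \<and>
        L1_norm PX (\<lambda>x. f 1 x - f 2 x)
        \<le> lipschitz_const Y L *
            (\<Sum>a=1..A 2. measure PX (X 2 a) * ((knorm 2 a)\<^sup>2 / lam 2 a) *
               tv_norm (local_measure (P 1) Y (X 2 a))
                 (\<lambda>E. measure (local_measure (P 1) Y (X 2 a)) E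
                     - measure (local_measure (P 2) Y (X 2 a)) E))
          + lipschitz_const Y L *
            (\<Sum>b=1..B.
               rho b * ((kappa b)\<^sup>2 / (tau b)\<^sup>2) * \<bar>lam 1 (idx 1 b) - lam 2 (idx 2 b)\<bar>
             + measure PX (Xs b) *
                 (1 / (2 * tau b) * kdist b + kappa b / tau b * sqrt (kdist b))
             + rho b * ((kappa b)\<^sup>2 / tau b) *
                 regionalization_dist PX (\<lambda>i. X i (idx i b)) (Xs b))"
proof -
  define c where "c = lipschitz_const Y L"
  have c: "0 \<le> c" "\<And>x y s t. y \<in> Y \<Longrightarrow> \<bar>L x y s - L x y t\<bar> \<le> c * \<bar>s - t\<bar>"
    unfolding c_def by (intro lipschitz_const_bound L)+
  have setting: "svm_setting (P i) Y L c" if "i \<in> {1, 2}" for i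
    using P(1)[OF that] P(2)[OF that] L(1,2) c
    by (simp add: svm_setting_def svm_setting_axioms_def)
  interpret P1: svm_setting "P 1" Y L c by (rule setting) simp
  interpret P2: svm_setting "P 2" Y L c by (rule setting) simp
  define K where "K i a = kernel_norm (X i a) (k i a)" for i a
  define idx where "idx i b = cell_index (A i) (X i) (Xs b)" for i b
  have cell: "X i a \<in> sets borel" "X i a \<noteq> {}" if "i \<in> {1, 2}" "a \<in> {1..A i}" for i a
    using X[OF that(1)] that(2) by (simp_all add: regionalization_def)
  have disj: "disjoint_family_on (X i) {1..A i}" and cover: "(\<Union>a\<in>{1..A i}. X i a) = UNIV" if "i \<in> {1, 2}" for i
    using X[OF that] by (simp_all add: regionalization_def)
  \<comment> \<open>The free bound \<open>M\<close> becomes \<open>K 2 a\<close> for the change of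
    measure and \<open>kappa b\<close> on an intersection.\<close>
  have r: "rkhs (X i a) (k i a) (H i a) (ip i a) M" if "i \<in> {1, 2}" "a \<in> {1..A i}" "K i a \<le> M" for i a M
    using that by (intro rkhsI H k cell) (simp_all add: K_def)

  \<comment> \<open>The common refinement of the two regionalizations\<close>
  have Xs_mem: "Xs b \<in> {X 1 a1 \<inter> X 2 a2 | a1 a2. a1 \<in> {1..A 1} \<and> a2 \<in> {1..A 2} \<and> X 1 a1 \<inter> X 2 a2 \<noteq> {}}"
    if "b \<in> {1..B}" for b
    using bij_betwE[OF Xs] that by blast
  have Xs_eq: "Xs b = X 1 (idx 1 b) \<inter> X 2 (idx 2 b)" "Xs b \<noteq> {}" "idx 1 b \<in> {1..A 1}" "idx 2 b \<in> {1..A 2}"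
    if b: "b \<in> {1..B}" for b
  proof -
    obtain a1 a2 where a: "Xs b = X 1 a1 \<inter> X 2 a2" "Xs b \<noteq> {}" "a1 \<in> {1..A 1}" "a2 \<in> {1..A 2}"
      using Xs_mem[OF b] by auto
    have "idx 1 b = a1" unfolding idx_def using a by (intro cell_index_eq disj) auto
    moreover have "idx 2 b = a2" unfolding idx_def using a by (intro cell_index_eq disj) auto
    ultimately show "Xs b = X 1 (idx 1 b) \<inter> X 2 (idx 2 b)" "Xs b \<noteq> {}" "idx 1 b \<in> {1..A 1}" "idx 2 b \<in> {1..A 2}"
      using a by simp_all
  qed
  have Xs_sub: "Xs b \<subseteq> X i (idx i b)" "idx i b \<in> {1..A i}" if "b \<in> {1..B}" "i \<in> {1, 2}" for i b
    using Xs_eq[OF that(1)] that(2) by auto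
  have Xs_borel: "Xs b \<in> sets borel" if "b \<in> {1..B}" for b
    unfolding Xs_eq(1)[OF that] using Xs_eq(3,4)[OF that] by (intro sets.Int cell) auto
  have Xs_cover: "\<exists>b\<in>{1..B}. x \<in> Xs b" for x
  proof -
    have "x \<in> (\<Union>a\<in>{1..A 1}. X 1 a)" "x \<in> (\<Union>a\<in>{1..A 2}. X 2 a)" using cover[of 1] cover[of 2] by simp_all
    then obtain a1 a2 where "a1 \<in> {1..A 1}" "x \<in> X 1 a1" "a2 \<in> {1..A 2}" "x \<in> X 2 a2" by blast
    then have "X 1 a1 \<inter> X 2 a2 \<in> Xs ` {1..B}" "x \<in> X 1 a1 \<inter> X 2 a2"
      using bij_betw_imp_surj_on[OF Xs] by auto
    then show ?thesis by auto
  qed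
  have idx_unique: "idx i b = a" if "b \<in> {1..B}" "i \<in> {1, 2}" "a \<in> {1..A i}" "x \<in> X i a" "x \<in> Xs b" for i a b x
    using Xs_sub[OF that(1,2)] disj[OF that(2)] that unfolding disjoint_family_on_def by blast
  have Xs_disj: "disjoint_family_on Xs {1..B}"
    unfolding disjoint_family_on_def
  proof (intro ballI impI)
    fix b b' assume b: "b \<in> {1..B}" "b' \<in> {1..B}" "b \<noteq> b'"
    show "Xs b \<inter> Xs b' = {}"
    proof (rule ccontr)
      assume "Xs b \<inter> Xs b' \<noteq> {}"
      then obtain x where x: "x \<in> Xs b" "x \<in> Xs b'" by blast
      \<comment> \<open>A common point forces equal indices in both regionalizations, hence equal
        intersections, against the injectivity of \<open>Xs\<close>.\<close>
      have "idx i b = idx i b'" if "i \<in> {1, 2}" for i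
        using idx_unique[OF b(1) that Xs_sub(2)[OF b(2) that] _ x(1)] Xs_sub(1)[OF b(2) that] x(2) by blast
      then have "Xs b = Xs b'" using Xs_eq(1)[OF b(1)] Xs_eq(1)[OF b(2)] by simp
      then show False using b bij_betw_imp_inj_on[OF Xs] by (auto dest: inj_onD)
    qed
  qed
  \<comment> \<open>Positivity is assumed on intersections. Every cell contains one, so it extends
    to all cells under either measure, including the mixed pairing of the first measure with the
    second regionalization.\<close>
  have pos_cell: "0 < measure (P j) (X i a \<times> Y)" if ij: "i \<in> {1, 2}" "j \<in> {1, 2}" and a: "a \<in> {1..A i}" for i j a
  proof -
    interpret S: svm_setting "P j" Y L c by (rule setting[OF ij(2)])
    obtain x where x: "x \<in> X i a" using cell(2)[OF ij(1) a] by blast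
    obtain b where b: "b \<in> {1..B}" "x \<in> Xs b" using Xs_cover by blast
    have "Xs b \<subseteq> X i a" using idx_unique[OF b(1) ij(1) a x b(2)] Xs_sub(1)[OF b(1) ij(1)] by simp
    then have "measure (P j) (Xs b \<times> Y) \<le> measure (P j) (X i a \<times> Y)"
      by (intro S.finite_measure_mono S.cylinder_sets cell ij a) auto
    then show ?thesis using pos[OF ij(2) b(1)] by simp
  qed

  \<comment> \<open>Localized SVMs for every pairing of measure and regionalization\<close>
  define PX where "PX = marginal UNIV (P 1)"
  \<comment> \<open>The first index selects the measure, the second the regionalization with its
    kernels and parameters. \<open>F 1 1\<close> and \<open>F 2 2\<close> are the functions of the
    claim, \<open>F 1 2\<close> is the intermediate one.\<close>
  define g where "g j i a = svm L (local_measure (P j) Y (X i a)) (lam i a) (H i a) (ip i a)" for i j a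
  define F where "F j i x = (\<Sum>a=1..A i. zero_extension (X i a) (g j i a) x)" for i j x
  have gH: "g j i a \<in> H i a" if ij: "i \<in> {1, 2}" "j \<in> {1, 2}" and a: "a \<in> {1..A i}" for i j a
    unfolding g_def
    by (rule svm_setting.svm_in[OF setting[OF ij(2)] r[OF ij(1) a order_refl] cell(1)[OF ij(1) a]
          pos_cell[OF ij a] lam[OF ij(1) a]])
  have F_int: "integrable PX (F j i)" if ij: "i \<in> {1, 2}" "j \<in> {1, 2}" for i j
    unfolding F_def[abs_def] PX_def
    using ij by (intro Bochner_Integration.integrable_sum P1.integrable_zero_extension[OF r[OF _ _ order_refl]] cell gH) auto
  have F_eq: "F j i x = g j i a x" if "i \<in> {1, 2}" "a \<in> {1..A i}" "x \<in> X i a" for i j a x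
    unfolding F_def by (rule sum_zero_extension[OF disj[OF that(1)] that(2,3)])
  have PX_eq: "measure PX S = P1.PS S" if "S \<in> sets borel" for S
    unfolding PX_def by (rule P1.measure_marginal[OF that])
  note diff_int = Bochner_Integration.integrable_diff[OF F_int F_int]

  \<comment> \<open>Change of the measure on the second regionalization\<close>
  have tv: "L1_norm PX (\<lambda>x. F 1 2 x - F 2 2 x)
    \<le> (\<Sum>a=1..A 2. c * (measure PX (X 2 a) * ((K 2 a)\<^sup>2 / lam 2 a) *
           tv_norm (local_measure (P 1) Y (X 2 a))
             (\<lambda>E. measure (local_measure (P 1) Y (X 2 a)) E - measure (local_measure (P 2) Y (X 2 a)) E)))"
  proof -
    have "L1_norm PX (\<lambda>x. F 1 2 x - F 2 2 x)
      = (\<Sum>a=1..A 2. \<integral>z. \<bar>F 1 2 (fst z) - F 2 2 (fst z)\<bar> \<partial>P1.RS (X 2 a))"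
      unfolding PX_def using diff_int[of 2 1 2 2] disj[of 2] cover[of 2]
      by (intro P1.integral_cells cell) (auto simp: PX_def)
    also have "\<dots> \<le> (\<Sum>a=1..A 2. c * (measure PX (X 2 a) * ((K 2 a)\<^sup>2 / lam 2 a) *
           tv_norm (local_measure (P 1) Y (X 2 a))
             (\<lambda>E. measure (local_measure (P 1) Y (X 2 a)) E - measure (local_measure (P 2) Y (X 2 a)) E)))"
    proof (rule sum_mono)
      fix a assume a: "a \<in> {1..A 2}"
      let ?Q1 = "local_measure (P 1) Y (X 2 a)" and ?Q2 = "local_measure (P 2) Y (X 2 a)"
      let ?t = "c * ((K 2 a)\<^sup>2 / lam 2 a) * tv_norm ?Q1 (\<lambda>E. measure ?Q1 E - measure ?Q2 E)"
      have Xa: "X 2 a \<in> sets borel" by (rule cell(1)) (use a in simp_all)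
      have p: "0 < P1.PS (X 2 a)" "0 < P2.PS (X 2 a)" by (rule pos_cell; use a in simp)+
      have ra: "rkhs (X 2 a) (k 2 a) (H 2 a) (ip 2 a) (K 2 a)" by (rule r) (use a in simp_all)
      have la: "0 < lam 2 a" by (rule lam) (use a in simp_all)
      note prob1 = P1.local_problem[OF ra Xa p(1) la] and prob2 = P2.local_problem[OF ra Xa p(2) la]
      have sets: "sets ?Q1 = sets ?Q2"
        unfolding P1.sets_local[OF p(1)] P2.sets_local[OF p(2)] sets_restrict_space P1.sets_P P2.sets_P ..
      have "Y \<noteq> {}" using P1.not_empty unfolding P1.space_P by blast
      then have ne: "space ?Q1 \<noteq> {}" unfolding P1.space_local[OF p(1)] using cell(2)[of 2 a] a by simp
      interpret R: finite_measure "P1.RS (X 2 a)" by (rule P1.finite_RS[OF Xa])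
      have le: "\<bar>F 1 2 (fst z) - F 2 2 (fst z)\<bar> \<le> ?t" if "z \<in> space (P1.RS (X 2 a))" for z
      proof -
        have x: "fst z \<in> X 2 a" using that unfolding P1.space_RS by auto
        have "\<bar>g 1 2 a (fst z) - g 2 2 a (fst z)\<bar> \<le> ?t"
          unfolding g_def
          by (rule svm_measure_stability[OF prob1 prob2 sets ne P1.svm_minimizer[OF prob1] P2.svm_minimizer[OF prob2] x])
        then show ?thesis using F_eq[of 2 a "fst z"] a x by simp
      qed
      have "(\<integral>z. \<bar>F 1 2 (fst z) - F 2 2 (fst z)\<bar> \<partial>P1.RS (X 2 a)) \<le> (\<integral>z. ?t \<partial>P1.RS (X 2 a))"
        using R.integrable_const le order_trans[OF abs_ge_zero le] by (rule integral_mono')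
      also have "\<dots> = ?t * measure PX (X 2 a)"
        using P1.measure_RS[OF Xa] by (simp add: PX_eq[OF Xa])
      finally show "(\<integral>z. \<bar>F 1 2 (fst z) - F 2 2 (fst z)\<bar> \<partial>P1.RS (X 2 a))
        \<le> c * (measure PX (X 2 a) * ((K 2 a)\<^sup>2 / lam 2 a) * tv_norm ?Q1 (\<lambda>E. measure ?Q1 E - measure ?Q2 E))"
        by (simp add: mult_ac)
    qed
    finally show ?thesis .
  qed

  \<comment> \<open>Change of cells, kernels and parameters under the first measure\<close>
  have two: "(\<Sum>i\<in>{1, 2}. h i) = h 1 + h 2" for h :: "nat \<Rightarrow> real" by simp
  define kappa where "kappa b = max (K 1 (idx 1 b)) (K 2 (idx 2 b))" for b
  define tau where "tau b = min (lam 1 (idx 1 b)) (lam 2 (idx 2 b))" for b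
  define rho where "rho b = max (measure PX (X 1 (idx 1 b))) (measure PX (X 2 (idx 2 b)))" for b
  define PXs where "PXs b = marginal (Xs b) (local_measure (P 1) Y (Xs b))" for b
  define kdist where "kdist b = L1_norm (PXs b \<Otimes>\<^sub>M PXs b) (\<lambda>(x, x'). k 1 (idx 1 b) x x' - k 2 (idx 2 b) x x')" for b

  have cells: "L1_norm PX (\<lambda>x. F 1 1 x - F 1 2 x)
    \<le> (\<Sum>b=1..B. c * (rho b * ((kappa b)\<^sup>2 / (tau b)\<^sup>2) * \<bar>lam 1 (idx 1 b) - lam 2 (idx 2 b)\<bar>
             + measure PX (Xs b) * (1 / (2 * tau b) * kdist b + kappa b / tau b * sqrt (kdist b))
             + rho b * ((kappa b)\<^sup>2 / tau b) * regionalization_dist PX (\<lambda>i. X i (idx i b)) (Xs b)))"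
  proof -
    have "L1_norm PX (\<lambda>x. F 1 1 x - F 1 2 x)
      = (\<Sum>b=1..B. \<integral>z. \<bar>F 1 1 (fst z) - F 1 2 (fst z)\<bar> \<partial>P1.RS (Xs b))"
      unfolding PX_def using diff_int[of 1 1 2 1] Xs_disj Xs_cover
      by (intro P1.integral_cells Xs_borel) (auto simp: PX_def)
    also have "\<dots> \<le> (\<Sum>b=1..B. c * (rho b * ((kappa b)\<^sup>2 / (tau b)\<^sup>2) * \<bar>lam 1 (idx 1 b) - lam 2 (idx 2 b)\<bar>
             + measure PX (Xs b) * (1 / (2 * tau b) * kdist b + kappa b / tau b * sqrt (kdist b))
             + rho b * ((kappa b)\<^sup>2 / tau b) * regionalization_dist PX (\<lambda>i. X i (idx i b)) (Xs b)))"
    proof (rule sum_mono)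
      fix b assume b: "b \<in> {1..B}"
      let ?a = "idx 1 b" and ?a' = "idx 2 b"
      have ia: "?a \<in> {1..A 1}" "?a' \<in> {1..A 2}" using Xs_eq[OF b] by auto
      have S: "X 1 ?a \<in> sets borel" "X 2 ?a' \<in> sets borel" by (rule cell(1); use ia in simp)+
      have sub: "Xs b \<subseteq> X 1 ?a" "Xs b \<subseteq> X 2 ?a'" by (rule Xs_sub[OF b]; simp)+
      have r1: "rkhs (X 1 ?a) (k 1 ?a) (H 1 ?a) (ip 1 ?a) (kappa b)"
        and r2: "rkhs (X 2 ?a') (k 2 ?a') (H 2 ?a') (ip 2 ?a') (kappa b)"
        by (rule r; use ia in \<open>simp add: kappa_def\<close>)+
      have ll: "0 < lam 1 ?a" "0 < lam 2 ?a'" by (rule lam; use ia in simp)+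
      have posb: "0 < P1.PS (Xs b)" by (rule pos[OF _ b]) simp
      have reg: "regionalization_dist PX (\<lambda>i. X i (idx i b)) (Xs b)
        = \<bar>P1.PS (X 1 ?a) - P1.PS (X 2 ?a')\<bar> / max (P1.PS (X 1 ?a)) (P1.PS (X 2 ?a'))
          + ((1 / 2 * (P1.PS (Xs b) / P1.PS (X 1 ?a)) * (1 - P1.PS (Xs b) / P1.PS (X 1 ?a))
               + sqrt (P1.PS (Xs b) / P1.PS (X 1 ?a) * (1 - P1.PS (Xs b) / P1.PS (X 1 ?a))))
            + (1 / 2 * (P1.PS (Xs b) / P1.PS (X 2 ?a')) * (1 - P1.PS (Xs b) / P1.PS (X 2 ?a'))
               + sqrt (P1.PS (Xs b) / P1.PS (X 2 ?a') * (1 - P1.PS (Xs b) / P1.PS (X 2 ?a')))))"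
        unfolding regionalization_dist_def Let_def two PX_eq[OF S(1)] PX_eq[OF S(2)] PX_eq[OF Xs_borel[OF b]] ..
      have "(\<integral>z. \<bar>F 1 1 (fst z) - F 1 2 (fst z)\<bar> \<partial>P1.RS (Xs b))
        = (\<integral>z. \<bar>g 1 1 ?a (fst z) - g 1 2 ?a' (fst z)\<bar> \<partial>P1.RS (Xs b))"
      proof (rule Bochner_Integration.integral_cong[OF refl])
        fix z assume "z \<in> space (P1.RS (Xs b))"
        then have "fst z \<in> X 1 ?a" "fst z \<in> X 2 ?a'" using sub unfolding P1.space_RS by auto
        then show "\<bar>F 1 1 (fst z) - F 1 2 (fst z)\<bar> = \<bar>g 1 1 ?a (fst z) - g 1 2 ?a' (fst z)\<bar>"
          using F_eq[of 1 ?a "fst z" 1] F_eq[of 2 ?a' "fst z" 1] ia by simp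
      qed
      also have "\<dots> \<le> c * (rho b * ((kappa b)\<^sup>2 / (tau b)\<^sup>2) * \<bar>lam 1 ?a - lam 2 ?a'\<bar>
             + measure PX (Xs b) * (1 / (2 * tau b) * kdist b + kappa b / tau b * sqrt (kdist b))
             + rho b * ((kappa b)\<^sup>2 / tau b) * regionalization_dist PX (\<lambda>i. X i (idx i b)) (Xs b))"
        unfolding reg g_def rho_def tau_def kdist_def PXs_def PX_eq[OF S(1)] PX_eq[OF S(2)] PX_eq[OF Xs_borel[OF b]]
        by (rule P1.cell_comparison[OF r1 r2 S sub Xs_borel[OF b] posb ll])
      finally show "(\<integral>z. \<bar>F 1 1 (fst z) - F 1 2 (fst z)\<bar> \<partial>P1.RS (Xs b))
        \<le> c * (rho b * ((kappa b)\<^sup>2 / (tau b)\<^sup>2) * \<bar>lam 1 ?a - lam 2 ?a'\<bar>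
             + measure PX (Xs b) * (1 / (2 * tau b) * kdist b + kappa b / tau b * sqrt (kdist b))
             + rho b * ((kappa b)\<^sup>2 / tau b) * regionalization_dist PX (\<lambda>i. X i (idx i b)) (Xs b))" .
    qed
    finally show ?thesis .
  qed

  have int12: "integrable PX (\<lambda>x. F 1 1 x - F 2 2 x)" by (rule diff_int) simp_all
  \<comment> \<open>Triangle inequality through the intermediate function.\<close>
  have "L1_norm PX (\<lambda>x. F 1 1 x - F 2 2 x)
    \<le> L1_norm PX (\<lambda>x. F 1 2 x - F 2 2 x) + L1_norm PX (\<lambda>x. F 1 1 x - F 1 2 x)"
  proof -
    have i: "integrable PX (\<lambda>x. \<bar>F 1 2 x - F 2 2 x\<bar>)" "integrable PX (\<lambda>x. \<bar>F 1 1 x - F 1 2 x\<bar>)"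
      by (intro integrable_abs diff_int; simp)+
    show ?thesis
      unfolding L1_norm_def Bochner_Integration.integral_add[OF i, symmetric]
      by (rule integral_mono'[OF Bochner_Integration.integrable_add[OF i]]) auto
  qed
  note total = order_trans[OF this add_mono[OF tv cells]]
  show ?thesis
    unfolding Let_def PX_def[symmetric] idx_def[symmetric] K_def[symmetric] c_def[symmetric]
      g_def[symmetric] F_def[symmetric] kappa_def[symmetric] tau_def[symmetric] rho_def[symmetric]
      PXs_def[symmetric] kdist_def[symmetric] sum_distrib_left
    using int12 total by (intro conjI)
qed

end
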